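(* Let $\Omega\subset\mathbb R^n$ be open and bounded with smooth boundary, and for each $\tau\in\partial\Omega$ let $A_\tau\subset\mathbb R^m$ be a non-empty compact convex set varying continuously with $\tau$ (with respect to the Hausdorff metric). For $x\in\Omega$ let $$A_x:=\int_{\partial\Omega}A_\tau\,d\mu_x(\tau)$$ be the harmonic interpolation, where $d\mu_x$ is the harmonic measure on $\partial\Omega$ with respect to $x$. Then the map $$x\mapsto-\log\operatorname{vol}(A_x)$$ is subharmonic on $\Omega$.
   Context: The harmonic measure $d\mu_x$ of $\Omega$ with respect to $x\in\Omega$ is the Borel probability measure on $\partial\Omega$ such that for every continuous $g:\partial\Omega\to\mathbb R$ the function $x\mapsto\int_{\partial\Omega}g\,d\mu_x$ is the harmonic function on $\Omega$ with boundary values $g$. The set-valued integral $\int_{\partial\Omega}A_\tau\,d\mu_x(\tau)$ is the limit of Riemann sums formed with Minkowski addition $A+B=\{a+b:a\in A,b\in B\}$ and scaling $tA=\{ta:a\in A\}$. Equivalently, it is the compact convex subset of $\mathbb R^m$ whose support function is $u\mapsto\int_{\partial\Omega}h_{A_\tau}(u)\,d\mu_x(\tau)$, where $h_A(u)=\sup_{z\in A}z\cdot u$. $\operatorname{vol}$ is Lebesgue measure on $\mathbb R^m$. Subharmonic is meant in the usual sense; when $n=1$ it means convex. *)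

theory Defs
  imports "HOL-Probability.Probability"
begin

primrec Ck_on :: "nat \<Rightarrow> 'a::euclidean_space set \<Rightarrow> ('a \<Rightarrow> real) \<Rightarrow> bool" where
  "Ck_on 0 U f \<longleftrightarrow> continuous_on U f"
| "Ck_on (Suc k) U f \<longleftrightarrow> (\<forall>x\<in>U. f differentiable (at x)) \<and>
     (\<forall>v. Ck_on k U (\<lambda>x. frechet_derivative f (at x) v))"

text \<open>These derivatives are two-sided, so the notions below are meant for open \<open>U\<close>.\<close>

definition smooth_on :: "'a::euclidean_space set \<Rightarrow> ('a \<Rightarrow> real) \<Rightarrow> bool" where
  "smooth_on U f \<longleftrightarrow> (\<forall>k. Ck_on k U f)"

definition laplacian :: "('a::euclidean_space \<Rightarrow> real) \<Rightarrow> 'a \<Rightarrow> real" where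
  "laplacian f x =
     (\<Sum>b\<in>Basis. frechet_derivative (\<lambda>y. frechet_derivative f (at y) b) (at x) b)"

definition harmonic_on :: "'a::euclidean_space set \<Rightarrow> ('a \<Rightarrow> real) \<Rightarrow> bool" where
  "harmonic_on U f \<longleftrightarrow> Ck_on 2 U f \<and> (\<forall>x\<in>U. laplacian f x = 0)"

text \<open>Smoothness of the boundary is expressed by local defining functions:
  near each boundary point, the set is the sublevel set of a smooth function
  with nowhere vanishing differential.\<close>

definition smooth_boundary :: "'a::euclidean_space set \<Rightarrow> bool" where
  "smooth_boundary \<Omega> \<longleftrightarrow>
     (\<forall>p\<in>frontier \<Omega>. \<exists>U \<rho>. open U \<and> p \<in> U \<and> smooth_on U \<rho> \<and>
        (\<forall>x\<in>U. \<exists>v. frechet_derivative \<rho> (at x) v \<noteq> 0) \<and>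
        \<Omega> \<inter> U = {x \<in> U. \<rho> x < 0})"

text \<open>The family \<open>\<mu>\<close> is indexed by the points of \<open>\<Omega>\<close>; each \<open>\<mu> x\<close> is a measure whose
  underlying space is the boundary itself.\<close>

definition harmonic_measure :: "'a::euclidean_space set \<Rightarrow> ('a \<Rightarrow> 'a measure) \<Rightarrow> bool" where
  "harmonic_measure \<Omega> \<mu> \<longleftrightarrow>
     (\<forall>x\<in>\<Omega>. prob_space (\<mu> x) \<and> sets (\<mu> x) = sets (restrict_space borel (frontier \<Omega>))) \<and>
     (\<forall>g :: 'a \<Rightarrow> real. continuous_on (frontier \<Omega>) g \<longrightarrow>
        harmonic_on \<Omega> (\<lambda>x. \<integral>\<tau>. g \<tau> \<partial>\<mu> x) \<and>
        (\<forall>\<tau>\<in>frontier \<Omega>. ((\<lambda>x. \<integral>\<sigma>. g \<sigma> \<partial>\<mu> x) \<longlongrightarrow> g \<tau>) (at \<tau> within \<Omega>)))"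

text \<open>The Hausdorff distance; meaningful for non-empty bounded sets.\<close>

definition hausdorff_dist :: "'a::metric_space set \<Rightarrow> 'a set \<Rightarrow> real" where
  "hausdorff_dist S T = max (SUP x\<in>S. infdist x T) (SUP y\<in>T. infdist y S)"

definition hausdorff_continuous_on ::
    "'a::metric_space set \<Rightarrow> ('a \<Rightarrow> 'b::metric_space set) \<Rightarrow> bool" where
  "hausdorff_continuous_on X A \<longleftrightarrow>
     (\<forall>\<tau>\<in>X. \<forall>\<epsilon>>0. \<exists>\<delta>>0. \<forall>\<sigma>\<in>X. dist \<sigma> \<tau> < \<delta> \<longrightarrow> hausdorff_dist (A \<sigma>) (A \<tau>) < \<epsilon>)"

text \<open>In the Riemann sums, \<open>\<Sum>\<close> is Minkowski addition of sets, as set up in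
  \<open>HOL-Library.Set_Algebras\<close>.\<close>

definition riemann_sum ::
    "'a measure \<Rightarrow> ('a \<Rightarrow> 'b::euclidean_space set) \<Rightarrow> 'a set set \<Rightarrow> ('a set \<Rightarrow> 'a) \<Rightarrow> 'b set" where
  "riemann_sum M A P t = (\<Sum>E\<in>P. (\<lambda>z. measure M E *\<^sub>R z) ` A (t E))"

definition has_minkowski_integral ::
    "'a::metric_space measure \<Rightarrow> ('a \<Rightarrow> 'b::euclidean_space set) \<Rightarrow> 'b set \<Rightarrow> bool" where
  "has_minkowski_integral M A K \<longleftrightarrow> K \<noteq> {} \<and> compact K \<and>
     (\<forall>\<epsilon>>0. \<exists>\<delta>>0. \<forall>P t. finite P \<and> partition_on (space M) P \<and> P \<subseteq> sets M \<and>
        (\<forall>E\<in>P. t E \<in> E \<and> (\<forall>x\<in>E. \<forall>y\<in>E. dist x y < \<delta>)) \<longrightarrow>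
        hausdorff_dist (riemann_sum M A P t) K < \<epsilon>)"

definition minkowski_integral ::
    "'a::metric_space measure \<Rightarrow> ('a \<Rightarrow> 'b::euclidean_space set) \<Rightarrow> 'b set" where
  "minkowski_integral M A = (THE K. has_minkowski_integral M A K)"

text \<open>The library has \<open>ln 0 = 0\<close>, whereas here \<open>- log 0 = \<infinity>\<close>.  Intended for sets of finite
  volume.\<close>

definition neg_log_vol :: "'a::euclidean_space set \<Rightarrow> ereal" where
  "neg_log_vol K = (if measure lborel K = 0 then \<infinity> else ereal (- ln (measure lborel K)))"

text \<open>Subharmonicity on an open set: upper semicontinuity together with domination by
  harmonic majorants on closed balls.  In dimension one the harmonic functions are the affine
  ones, so the last clause says that \<open>f\<close> lies below its chords, i.e. is convex.  As usual the
  values are to lie in \<open>[-\<infinity>, \<infinity>)\<close>; the only exception admitted is that \<open>f\<close> may be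
  identically \<open>\<infinity>\<close> on a connected component (for \<open>neg_log_vol\<close>, when the bodies are
  degenerate there).\<close>

definition subharmonic_on :: "'a::euclidean_space set \<Rightarrow> ('a \<Rightarrow> ereal) \<Rightarrow> bool" where
  "subharmonic_on U f \<longleftrightarrow>
     (\<forall>C\<in>components U. (\<forall>x\<in>C. f x < \<infinity>) \<or> (\<forall>x\<in>C. f x = \<infinity>)) \<and>
     (\<forall>x\<in>U. Limsup (at x within U) f \<le> f x) \<and>
     (\<forall>a r h. 0 < r \<and> cball a r \<subseteq> U \<and> continuous_on (cball a r) h \<and> harmonic_on (ball a r) h \<and>
        (\<forall>x\<in>sphere a r. f x \<le> ereal (h x)) \<longrightarrow> (\<forall>x\<in>cball a r. f x \<le> ereal (h x)))"

end

(* The mean value property and Poisson kernels are avoided by producing harmonic minorants.  Replace the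
volume by the smoothed volume V(L), the integral of the square of (1 - beta d(z, L)^2)_+.  The midpoint
Prekopa-Leindler inequality makes ln V midpoint concave under Minkowski combinations, and the first
variation of V at a body K is an explicit integral of the support function h_L against the offsets
z - pi_K(z).  Hence ln V(L) is bounded above by a functional of L that is affine in h_L and agrees with
ln V(K) at L = K.  Inserting L = A_y, whose support function is the integral of h_{A_tau} against mu_y,
turns this bound into a harmonic function of y touching ln V(A_y) at the point where K = A_x.  The weak
maximum principle then yields the majorant inequality for - ln V, and beta to infinity recovers the
volume.  Degenerate bodies have vanishing width in some direction; the width is a nonnegative harmonic
function, so it vanishes on the whole component. *)

theory Submission
  imports Defs
begin

section \<open>The midpoint Prekopa-Leindler inequality\<close>

text \<open>Volume itself is an awkward function of the body: its first variation is governed by the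
  surface area measure, and its logarithm is not finite on degenerate bodies. Smoothing repairs
  both. V is positive on every body, and since the cutoff is squared, the remainder of its
  first-order expansion is quadratic in the change of the support function, with no regularity asked
  of the boundary of the body. V also overestimates the volume, which is the right direction: a
  majorant of - ln vol on a sphere is a majorant of - ln V there, and the resulting bound on V at an
  inner point does not depend on beta. The tangent bound stands in for a Jensen inequality over a
  continuum of bodies. Only two bodies are ever averaged at a time; dyadic iteration turns the
  midpoint inequality into the tangent bound, and Fubini carries an affine functional of the support
  function through the integral over the boundary. Each point x has its own comparison function, of
  which only the value at x is used in the end.\<close>

lemma emeasure_interval_sum_le:
  fixes A B C :: "real set"
  assumes [measurable]: "A \<in> sets borel" "B \<in> sets borel" "C \<in> sets borel"
    and "A \<noteq> {}" "B \<noteq> {}" "A \<subseteq> {-k..k}" "B \<subseteq> {-k..k}"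
    and sub: "\<And>x y. x \<in> A \<Longrightarrow> y \<in> B \<Longrightarrow> x + y \<in> C"
  shows "emeasure lborel A + emeasure lborel B \<le> emeasure lborel C"
proof (rule ennreal_le_epsilon)
  fix e :: real assume e: "0 < e"
  have bA: "bdd_above A" and bB: "bdd_below B"
    using assms by (meson bdd_above_Icc bdd_above_mono bdd_below_Icc bdd_below_mono)+
  obtain a where a: "a \<in> A" "Sup A - e/2 < a"
    using less_cSup_iff[OF \<open>A \<noteq> {}\<close> bA, of "Sup A - e/2"] e by auto
  obtain b where b: "b \<in> B" "b < Inf B + e/2"
    using cInf_less_iff[OF \<open>B \<noteq> {}\<close> bB, of "Inf B + e/2"] e by auto
  \<comment> \<open>The translates \<open>b + ?A\<close> and \<open>a + ?B\<close> both lie in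
    \<open>C\<close> and are disjoint, being separated by the point \<open>a + b\<close>. Since
    \<open>A\<close> and \<open>B\<close> need not contain their extrema, \<open>a\<close> and
    \<open>b\<close> only approximate \<open>Sup A\<close> and \<open>Inf B\<close>; each cut costs
    at most \<open>e/2\<close>.\<close>
  let ?A = "A \<inter> {..a}" and ?B = "B \<inter> {b<..}"
  have tr: "emeasure lborel ((\<lambda>x. c + x) ` X) = emeasure lborel X" if "X \<in> sets borel" for c :: real and X
  proof -
    have "emeasure lborel X = emeasure (distr lborel borel ((+) (-c))) X"
      by (simp add: lborel_distr_plus)
    also have "\<dots> = emeasure lborel ((+) (-c) -` X)"
      using that by (subst emeasure_distr) auto
    also have "(+) (-c) -` X = (\<lambda>x. c + x) ` X"
      by (auto simp: image_iff) (metis add.commute add_diff_cancel_left' diff_add_cancel uminus_add_conv_diff)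
    finally show ?thesis by simp
  qed
  have sb: "(\<lambda>x. c + x) ` X \<in> sets borel" if "X \<in> sets borel" for c :: real and X
  proof -
    have "(\<lambda>x. c + x) ` X = (\<lambda>x. x - c) -` X"
      by (auto simp: image_iff) (metis add.commute diff_add_cancel)
    also have "\<dots> \<in> sets borel" using that by (auto intro!: measurable_sets_borel[of _ borel])
    finally show ?thesis .
  qed
  have A: "emeasure lborel A \<le> emeasure lborel ?A + ennreal (e/2)"
  proof -
    have "A \<subseteq> ?A \<union> {a..Sup A}" using cSup_upper[OF _ bA] by auto
    then have "emeasure lborel A \<le> emeasure lborel (?A \<union> {a..Sup A})"
      by (intro emeasure_mono) auto
    also have "\<dots> \<le> emeasure lborel ?A + emeasure lborel {a..Sup A}"
      by (intro emeasure_subadditive) auto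
    also have "emeasure lborel {a..Sup A} \<le> ennreal (e/2)"
      using a cSup_upper[OF _ bA] by (simp add: ennreal_leI)
    finally show ?thesis by (simp add: add_left_mono)
  qed
  have B: "emeasure lborel B \<le> emeasure lborel ?B + ennreal (e/2)"
  proof -
    have "B \<subseteq> ?B \<union> {Inf B..b}" using cInf_lower[OF _ bB] by auto
    then have "emeasure lborel B \<le> emeasure lborel (?B \<union> {Inf B..b})"
      by (intro emeasure_mono) auto
    also have "\<dots> \<le> emeasure lborel ?B + emeasure lborel {Inf B..b}"
      by (intro emeasure_subadditive) auto
    also have "emeasure lborel {Inf B..b} \<le> ennreal (e/2)"
      using b cInf_lower[OF _ bB] by (simp add: ennreal_leI)
    finally show ?thesis by (simp add: add_left_mono)
  qed
  have "emeasure lborel ?A + emeasure lborel ?B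
      = emeasure lborel ((\<lambda>x. b + x) ` ?A) + emeasure lborel ((\<lambda>x. a + x) ` ?B)"
    by (simp add: tr)
  also have "\<dots> = emeasure lborel ((\<lambda>x. b + x) ` ?A \<union> (\<lambda>x. a + x) ` ?B)"
    by (intro plus_emeasure) (auto simp: sb)
  also have "\<dots> \<le> emeasure lborel C"
  proof (intro emeasure_mono)
    show "(\<lambda>x. b + x) ` ?A \<union> (\<lambda>x. a + x) ` ?B \<subseteq> C"
      using sub a(1) b(1) by (auto simp: add.commute[of b])
  qed auto
  finally have AB: "emeasure lborel ?A + emeasure lborel ?B \<le> emeasure lborel C" .
  have "emeasure lborel A + emeasure lborel B
      \<le> (emeasure lborel ?A + emeasure lborel ?B) + (ennreal (e/2) + ennreal (e/2))"
    using add_mono[OF A B] by (simp add: ac_simps)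
  also have "ennreal (e/2) + ennreal (e/2) = ennreal e"
    using e by (simp flip: ennreal_plus)
  finally show "emeasure lborel A + emeasure lborel B \<le> emeasure lborel C + ennreal e"
    using AB by (meson add_right_mono order_trans)
qed

text \<open>The levels stop at 1 because in the normalized inequality only levels below the common
  supremum 1 of \<open>u\<close> and \<open>v\<close> give two non-empty superlevel sets. For
  \<open>w\<close>, which has no upper bound there, the cut at 1 only lowers the integral.\<close>

lemma layer_cake_unit:
  fixes u :: "real \<Rightarrow> real"
  assumes [measurable]: "u \<in> borel_measurable borel" and u: "\<And>x. 0 \<le> u x"
  shows "(\<integral>\<^sup>+x. ennreal (min 1 (u x)) \<partial>lborel)
       = (\<integral>\<^sup>+l. indicator {0<..<1} l * emeasure lborel {x. l < u x} \<partial>lborel)"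
proof -
  have "ennreal (min 1 (u x)) = (\<integral>\<^sup>+l. indicator {0<..<1} l * indicator {l. l < u x} l \<partial>lborel)" for x
  proof -
    have "(\<integral>\<^sup>+l. indicator {0<..<1} l * indicator {l. l < u x} l \<partial>lborel)
        = (\<integral>\<^sup>+l. indicator {0<..<min 1 (u x)} l \<partial>lborel)"
      by (intro nn_integral_cong) (auto simp: indicator_def)
    then show ?thesis using u[of x] by simp
  qed
  then have "(\<integral>\<^sup>+x. ennreal (min 1 (u x)) \<partial>lborel)
     = (\<integral>\<^sup>+x. \<integral>\<^sup>+l. indicator {0<..<1} l * indicator {p. fst p < u (snd p)} (l, x) \<partial>lborel \<partial>lborel)"
    by (simp add: indicator_def)
  also have "\<dots> = (\<integral>\<^sup>+l. \<integral>\<^sup>+x. indicator {0<..<1} l * indicator {p. fst p < u (snd p)} (l, x) \<partial>lborel \<partial>lborel)"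
    by (rule lborel_pair.Fubini') measurable
  also have "\<dots> = (\<integral>\<^sup>+l. indicator {0<..<1} l * (\<integral>\<^sup>+x. indicator {x. l < u x} x \<partial>lborel) \<partial>lborel)"
    by (subst nn_integral_cmult[symmetric]) (auto simp: indicator_def)
  finally show ?thesis by simp
qed

text \<open>The sum inequality for sets fails when one of them is empty. With both suprema equal to
  1, the superlevel sets of \<open>u\<close> and \<open>v\<close> at any level in (0, 1) are
  non-empty, so the inequality holds level by level and can be integrated over the level.\<close>

lemma prekopa_leindler_normalized:
  fixes u v w :: "real \<Rightarrow> real"
  assumes [measurable]: "u \<in> borel_measurable borel" "v \<in> borel_measurable borel" "w \<in> borel_measurable borel"
    and pos: "\<And>x. 0 \<le> u x" "\<And>x. 0 \<le> v x" "\<And>x. 0 \<le> w x"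
    and le1: "\<And>x. u x \<le> 1" "\<And>x. v x \<le> 1"
    and supp: "\<And>x. u x \<noteq> 0 \<Longrightarrow> \<bar>x\<bar> \<le> k" "\<And>x. v x \<noteq> 0 \<Longrightarrow> \<bar>x\<bar> \<le> k"
    and sup: "\<And>l. l < 1 \<Longrightarrow> \<exists>x. l < u x" "\<And>l. l < 1 \<Longrightarrow> \<exists>x. l < v x"
    and w: "\<And>l x y. 0 < l \<Longrightarrow> l < u x \<Longrightarrow> l < v y \<Longrightarrow> l < w ((x + y) / 2)"
  shows "(\<integral>\<^sup>+x. ennreal (u x) \<partial>lborel) + (\<integral>\<^sup>+x. ennreal (v x) \<partial>lborel) \<le> 2 * (\<integral>\<^sup>+x. ennreal (w x) \<partial>lborel)"
proof -
  have uu: "min 1 (u x) = u x" "min 1 (v x) = v x" for x using le1[of x] by auto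
  have key: "emeasure lborel {x. l < u x} + emeasure lborel {x. l < v x} \<le> 2 * emeasure lborel {x. l < w x}"
    if "0 < l" "l < 1" for l
  proof -
    \<comment> \<open>Sums instead of averages of points are compared, so \<open>w\<close> appears
      dilated by 2; undoing the dilation gives the factor 2 of the conclusion.\<close>
    have 1: "emeasure lborel {x. l < u x} + emeasure lborel {x. l < v x} \<le> emeasure lborel {x. l < w (x/2)}"
    proof (rule emeasure_interval_sum_le[where k = k])
      show "{x. l < u x} \<noteq> {}" "{x. l < v x} \<noteq> {}" using sup that by auto
      have "u x \<noteq> 0" if "l < u x" for x using that \<open>0 < l\<close> by auto
      then show "{x. l < u x} \<subseteq> {-k..k}" using supp(1) by (auto simp: abs_le_iff minus_le_iff)
      have "v x \<noteq> 0" if "l < v x" for x using that \<open>0 < l\<close> by auto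
      then show "{x. l < v x} \<subseteq> {-k..k}" using supp(2) by (auto simp: abs_le_iff minus_le_iff)
      show "x + y \<in> {x. l < w (x/2)}" if "x \<in> {x. l < u x}" "y \<in> {x. l < v x}" for x y
        using w \<open>0 < l\<close> that by simp
    qed measurable
    have "emeasure lborel {x. l < w (x/2)} = (\<integral>\<^sup>+x. indicator {x. l < w x} (x/2) \<partial>lborel)"
      
    proof -
      have "(\<integral>\<^sup>+x. indicator {x. l < w x} (x/2) \<partial>lborel) = (\<integral>\<^sup>+x. indicator {x. l < w (x/2)} x \<partial>lborel)"
        by (intro nn_integral_cong) (simp add: indicator_def)
      then show ?thesis by simp
    qed
    also have "\<dots> = 2 * (\<integral>\<^sup>+x. indicator {x. l < w x} x \<partial>lborel)"
      by (subst nn_integral_real_affine[where c = 2 and t = 0]) auto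
    finally show ?thesis using 1 by simp
  qed
  have "(\<integral>\<^sup>+x. ennreal (u x) \<partial>lborel) + (\<integral>\<^sup>+x. ennreal (v x) \<partial>lborel)
     = (\<integral>\<^sup>+l. indicator {0<..<1} l * emeasure lborel {x. l < u x} \<partial>lborel)
       + (\<integral>\<^sup>+l. indicator {0<..<1} l * emeasure lborel {x. l < v x} \<partial>lborel)"
    using layer_cake_unit[of u] layer_cake_unit[of v] pos by (simp add: uu)
  also have "\<dots> = (\<integral>\<^sup>+l. indicator {0<..<1} l * emeasure lborel {x. l < u x} + indicator {0<..<1} l * emeasure lborel {x. l < v x} \<partial>lborel)"
    by (subst nn_integral_add) auto
  also have "\<dots> \<le> (\<integral>\<^sup>+l. 2 * (indicator {0<..<1} l * emeasure lborel {x. l < w x}) \<partial>lborel)"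
    using key by (intro nn_integral_mono) (auto simp: indicator_def)
  also have "\<dots> = 2 * (\<integral>\<^sup>+x. ennreal (min 1 (w x)) \<partial>lborel)"
    using layer_cake_unit[of w] pos by (subst nn_integral_cmult) auto
  also have "\<dots> \<le> 2 * (\<integral>\<^sup>+x. ennreal (w x) \<partial>lborel)"
    by (intro mult_left_mono nn_integral_mono ennreal_leI) auto
  finally show ?thesis .
qed

lemma ennreal_mult_le_square_of_add_le:
  fixes U V W :: ennreal
  assumes "U + V \<le> 2 * W"
  shows "U * V \<le> W\<^sup>2"
proof (cases "W = \<top>")
  case True
  then show ?thesis by (simp add: power2_eq_square)
next
  case False
  then obtain w where w: "W = ennreal w" "0 \<le> w" by (cases W) auto
  have "U + V \<noteq> \<top>" using assms False 
    by (auto simp: ennreal_mult_eq_top_iff top_unique)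
  then obtain u v where uv: "U = ennreal u" "0 \<le> u" "V = ennreal v" "0 \<le> v"
    by (cases U; cases V) auto
  have "ennreal (u + v) \<le> ennreal (2 * w)"
    using assms uv w by (simp add: ennreal_plus ennreal_mult')
  then have "u + v \<le> 2 * w" using w by (simp add: ennreal_le_iff)
  then have "(u + v)\<^sup>2 \<le> (2 * w)\<^sup>2" using uv by (intro power_mono) auto
  moreover have "4 * (u * v) \<le> (u + v)\<^sup>2" using zero_le_power2[of "u - v"] by (simp add: power2_eq_square algebra_simps)
  ultimately have "u * v \<le> w\<^sup>2" by (simp add: power2_eq_square)
  then show ?thesis using uv w
    by (simp add: ennreal_power ennreal_leI flip: ennreal_mult)
qed

text \<open>Dividing \<open>f\<close>, \<open>g\<close> by their suprema \<open>a\<close>,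
  \<open>b\<close> and \<open>h\<close> by \<open>sqrt (a * b)\<close> reduces to the normalized
  case, and AM-GM turns the additive conclusion into a multiplicative one. If a supremum is 0, one
  of the integrals on the left vanishes.\<close>

lemma prekopa_leindler_bounded:
  fixes f g :: "real \<Rightarrow> real" and h :: "real \<Rightarrow> ennreal"
  assumes [measurable]: "f \<in> borel_measurable borel" "g \<in> borel_measurable borel" "h \<in> borel_measurable borel"
    and pos: "\<And>x. 0 \<le> f x" "\<And>x. 0 \<le> g x"
    and le: "\<And>x. f x \<le> n" "\<And>x. g x \<le> n"
    and supp: "\<And>x. f x \<noteq> 0 \<Longrightarrow> \<bar>x\<bar> \<le> k" "\<And>x. g x \<noteq> 0 \<Longrightarrow> \<bar>x\<bar> \<le> k"
    and h: "\<And>x y. ennreal (f x * g y) \<le> (h ((x + y) / 2))\<^sup>2"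
  shows "(\<integral>\<^sup>+x. ennreal (f x) \<partial>lborel) * (\<integral>\<^sup>+x. ennreal (g x) \<partial>lborel) \<le> (\<integral>\<^sup>+x. h x \<partial>lborel)\<^sup>2"
proof -
  define a b where "a = (SUP x. f x)" and "b = (SUP x. g x)"
  have bdd: "bdd_above (range f)" "bdd_above (range g)"
    using le by (auto intro!: bdd_aboveI2)
  have ab: "f x \<le> a" "g x \<le> b" for x
    unfolding a_def b_def using bdd by (auto intro: cSUP_upper)
  then have ab0: "0 \<le> a" "0 \<le> b" using pos order_trans by blast+
  show ?thesis
  proof (cases "a = 0 \<or> b = 0")
    case True
    then have "(\<forall>x. f x = 0) \<or> (\<forall>x. g x = 0)" using ab pos by (metis order_antisym)
    then show ?thesis by auto
  next
    case False
    with ab0 have ab': "0 < a" "0 < b" by auto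
    define c where "c = sqrt (a * b)"
    have c: "0 < c" "c\<^sup>2 = a * b" using ab' by (auto simp: c_def)
    \<comment> \<open>Capping \<open>h\<close> at \<open>c\<close> makes it real-valued. Nothing is
      lost, because \<open>l < w x\<close> is only asked for levels \<open>l\<close> below 1, that
      is, for heights of \<open>h\<close> below \<open>c\<close>.\<close>
    define w where "w x = enn2real (min (h x) (ennreal c)) / c" for x
    have w_eq: "ennreal (c * w x) = min (h x) (ennreal c)" for x
    proof -
      have "min (h x) (ennreal c) < \<top>" by (simp add: min_less_iff_disj)
      then show ?thesis using c by (simp add: w_def)
    qed
    have "(\<integral>\<^sup>+x. ennreal (f x / a) \<partial>lborel) + (\<integral>\<^sup>+x. ennreal (g x / b) \<partial>lborel) \<le> 2 * (\<integral>\<^sup>+x. ennreal (w x) \<partial>lborel)"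
    proof (rule prekopa_leindler_normalized)
      show "\<exists>x. l < f x / a" if "l < 1" for l
        using less_cSup_iff[OF _ bdd(1), of "l * a"] that ab'
        by (auto simp: a_def[symmetric] pos_less_divide_eq)
      show "\<exists>x. l < g x / b" if "l < 1" for l
        using less_cSup_iff[OF _ bdd(2), of "l * b"] that ab'
        by (auto simp: b_def[symmetric] pos_less_divide_eq)
      show "l < w ((x + y) / 2)" if l: "0 < l" "l < f x / a" "l < g y / b" for l x y
      proof -
        have "l * a < f x" "l * b < g y" using l ab' by (auto simp: pos_less_divide_eq)
        then have "(l * a) * (l * b) < f x * g y" using l ab'
          by (intro mult_strict_mono) (auto intro: less_trans[OF mult_pos_pos])
        then have "(l * c)\<^sup>2 < f x * g y" by (simp add: c power_mult_distrib) (simp add: power2_eq_square mult_ac)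
        then have "ennreal ((l * c)\<^sup>2) < (h ((x + y) / 2))\<^sup>2"
          using h[of x y] by (meson ennreal_lessI less_le_trans zero_le_power2 le_less_trans)
        then have "(ennreal (l * c))\<^sup>2 < (h ((x + y) / 2))\<^sup>2" using l c by (simp add: ennreal_power)
        then have "ennreal (l * c) < h ((x + y) / 2)"
          by (metis linorder_not_le power_mono zero_le)
        moreover have "l < 1" using l(2) ab[of x] ab' by (meson divide_le_eq_1_pos less_le_trans)
        then have "ennreal (l * c) < ennreal c" using l c by (simp add: ennreal_lessI)
        ultimately have "ennreal (l * c) < ennreal (c * w ((x + y) / 2))"
          unfolding w_eq by simp
        then show ?thesis using l c by (simp add: ennreal_less_iff mult.commute)
      qed
      show "0 \<le> w x" for x using c by (simp add: w_def)
      show "w \<in> borel_measurable borel" unfolding w_def by measurable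
    qed (use ab ab' pos supp in \<open>auto\<close>)
    note * = ennreal_mult_le_square_of_add_le[OF this]
    have "(\<integral>\<^sup>+x. ennreal (f x) \<partial>lborel) = ennreal a * (\<integral>\<^sup>+x. ennreal (f x / a) \<partial>lborel)"
      using ab' pos by (subst nn_integral_cmult[symmetric]) (auto simp flip: ennreal_mult)
    moreover have "(\<integral>\<^sup>+x. ennreal (g x) \<partial>lborel) = ennreal b * (\<integral>\<^sup>+x. ennreal (g x / b) \<partial>lborel)"
      using ab' pos by (subst nn_integral_cmult[symmetric]) (auto simp flip: ennreal_mult)
    ultimately have "(\<integral>\<^sup>+x. ennreal (f x) \<partial>lborel) * (\<integral>\<^sup>+x. ennreal (g x) \<partial>lborel)
      = (ennreal c)\<^sup>2 * ((\<integral>\<^sup>+x. ennreal (f x / a) \<partial>lborel) * (\<integral>\<^sup>+x. ennreal (g x / b) \<partial>lborel))"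
      using ab' c by (simp add: ennreal_power ennreal_mult mult_ac)
    also have "\<dots> \<le> (ennreal c)\<^sup>2 * (\<integral>\<^sup>+x. ennreal (w x) \<partial>lborel)\<^sup>2"
      using * by (intro mult_left_mono) auto
    also have "\<dots> = (\<integral>\<^sup>+x. ennreal (c * w x) \<partial>lborel)\<^sup>2"
    proof -
      have [measurable]: "w \<in> borel_measurable borel" unfolding w_def by measurable
      have "(\<integral>\<^sup>+x. ennreal (c * w x) \<partial>lborel) = ennreal c * (\<integral>\<^sup>+x. ennreal (w x) \<partial>lborel)"
        using c by (subst nn_integral_cmult[symmetric]) (auto simp: ennreal_mult')
      then show ?thesis by (simp add: power_mult_distrib)
    qed
    also have "\<dots> \<le> (\<integral>\<^sup>+x. h x \<partial>lborel)\<^sup>2"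
      by (intro power_mono nn_integral_mono) (auto simp: w_eq)
    finally show ?thesis .
  qed
qed

text \<open>Truncating both in height and to a bounded interval gives increasing approximations of
  \<open>f\<close> and \<open>g\<close>. Their orders \<open>n\<close> and \<open>m\<close> are
  independent because a product of two suprema is a supremum over pairs.\<close>

lemma prekopa_leindler_real:
  fixes f g h :: "real \<Rightarrow> ennreal"
  assumes [measurable]: "f \<in> borel_measurable borel" "g \<in> borel_measurable borel" "h \<in> borel_measurable borel"
    and h: "\<And>x y. f x * g y \<le> (h ((x + y) / 2))\<^sup>2"
  shows "(\<integral>\<^sup>+x. f x \<partial>lborel) * (\<integral>\<^sup>+x. g x \<partial>lborel) \<le> (\<integral>\<^sup>+x. h x \<partial>lborel)\<^sup>2"
proof -
  define tr where "tr F n x = min (F x) (of_nat n) * indicator {- real n..real n} x"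
    for F :: "real \<Rightarrow> ennreal" and n :: nat and x :: real
  have tr_le: "tr F n x \<le> F x" "tr F n x \<le> of_nat n" for F n x
    by (auto simp: tr_def indicator_def)
  have tr_fin: "tr F n x < \<top>" for F n x
    using tr_le(2)[of F n x] of_nat_less_top le_less_trans by blast
  have [measurable]: "tr F n \<in> borel_measurable borel" if [measurable]: "F \<in> borel_measurable borel" for F n
    unfolding tr_def by measurable
  have tr_inc: "incseq (tr F)" for F
    by (auto simp: tr_def incseq_def le_fun_def indicator_def intro: min.coboundedI2)
  have tr_SUP: "(SUP n. tr F n x) = F x" for F x
  proof (rule antisym)
    show "(SUP n. tr F n x) \<le> F x" by (auto intro: SUP_least tr_le)
    show "F x \<le> (SUP n. tr F n x)"
    proof (rule ccontr)
      assume "\<not> F x \<le> (SUP n. tr F n x)"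
      then have lt: "(SUP n. tr F n x) < F x" by simp
      then obtain s where s: "(SUP n. tr F n x) = ennreal s" "0 \<le> s"
        by (cases "SUP n. tr F n x") auto
      obtain n :: nat where n: "max s \<bar>x\<bar> < real n" using reals_Archimedean2 by blast
      have "ennreal s < min (F x) (of_nat n)"
        using lt s n by (simp add: ennreal_less_iff ennreal_of_nat_eq_real_of_nat)
      also have "\<dots> = tr F n x" using n by (auto simp: tr_def indicator_def)
      also have "\<dots> \<le> (SUP n. tr F n x)" by (rule SUP_upper) auto
      finally show False using s by simp
    qed
  qed
  have lim: "(\<integral>\<^sup>+x. F x \<partial>lborel) = (SUP n. \<integral>\<^sup>+x. tr F n x \<partial>lborel)"
    if [measurable]: "F \<in> borel_measurable borel" for F
    using nn_integral_monotone_convergence_SUP[OF tr_inc, of F lborel]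
    by (simp add: tr_SUP)
  have main: "(\<integral>\<^sup>+x. tr f n x \<partial>lborel) * (\<integral>\<^sup>+x. tr g m x \<partial>lborel) \<le> (\<integral>\<^sup>+x. h x \<partial>lborel)\<^sup>2" for n m
  proof -
    have e: "ennreal (enn2real (tr F n x)) = tr F n x" for F n x
      using tr_fin by simp
    have "(\<integral>\<^sup>+x. ennreal (enn2real (tr f n x)) \<partial>lborel) * (\<integral>\<^sup>+x. ennreal (enn2real (tr g m x)) \<partial>lborel)
      \<le> (\<integral>\<^sup>+x. h x \<partial>lborel)\<^sup>2"
    proof (rule prekopa_leindler_bounded)
      show "enn2real (tr f n x) \<le> real (max n m)" "enn2real (tr g m x) \<le> real (max n m)" for x
      proof -
        have "tr F j x \<le> ennreal (real (max n m))" if "j \<le> max n m" for F j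
          using tr_le(2)[of F j x] that ennreal_leI[of "real j" "real (max n m)"]
          by (auto simp: ennreal_of_nat_eq_real_of_nat simp del: of_nat_max intro: order_trans)
        then show "enn2real (tr f n x) \<le> real (max n m)" "enn2real (tr g m x) \<le> real (max n m)"
          by (auto intro!: enn2real_leI simp del: of_nat_max)
      qed
      show "\<bar>x\<bar> \<le> real (max n m)" if "enn2real (tr f n x) \<noteq> 0" for x
      proof -
        have "x \<in> {- real n..real n}" using that by (cases "x \<in> {- real n..real n}") (simp_all add: tr_def)
        then show ?thesis by auto
      qed
      show "\<bar>x\<bar> \<le> real (max n m)" if "enn2real (tr g m x) \<noteq> 0" for x
      proof -
        have "x \<in> {- real m..real m}" using that by (cases "x \<in> {- real m..real m}") (simp_all add: tr_def)
        then show ?thesis by auto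
      qed
      show "ennreal (enn2real (tr f n x) * enn2real (tr g m y)) \<le> (h ((x + y) / 2))\<^sup>2" for x y
        using h[of x y] mult_mono[OF tr_le(1)[of f n x] tr_le(1)[of g m y]]
        by (simp add: ennreal_mult e)
    qed auto
    then show ?thesis by (simp add: e)
  qed
  show ?thesis unfolding lim[OF assms(1)] lim[OF assms(2)]
    by (simp add: SUP_mult_left_ennreal SUP_mult_right_ennreal) (auto intro!: SUP_least main)
qed

text \<open>Tensorization: by the induction hypothesis the partial integrals over \<open>I\<close>
  satisfy the one-dimensional hypothesis in the remaining coordinate. These partial integrals may be
  infinite, which is why the real case is stated for \<open>ennreal\<close> values.\<close>

lemma prekopa_leindler_PiM:
  fixes f g h :: "('i \<Rightarrow> real) \<Rightarrow> ennreal"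
  assumes "finite I"
    and "f \<in> borel_measurable (\<Pi>\<^sub>M i\<in>I. lborel)" "g \<in> borel_measurable (\<Pi>\<^sub>M i\<in>I. lborel)"
      "h \<in> borel_measurable (\<Pi>\<^sub>M i\<in>I. lborel)"
    and "\<And>x y. x \<in> extensional I \<Longrightarrow> y \<in> extensional I \<Longrightarrow> f x * g y \<le> (h (\<lambda>i\<in>I. (x i + y i) / 2))\<^sup>2"
  shows "(\<integral>\<^sup>+x. f x \<partial>(\<Pi>\<^sub>M i\<in>I. lborel)) * (\<integral>\<^sup>+x. g x \<partial>(\<Pi>\<^sub>M i\<in>I. lborel))
     \<le> (\<integral>\<^sup>+x. h x \<partial>(\<Pi>\<^sub>M i\<in>I. lborel))\<^sup>2"
  using assms
proof (induction I arbitrary: f g h rule: finite_induct)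
  case empty
  interpret product_sigma_finite "\<lambda>_::'i. lborel :: real measure" by standard
  show ?case using empty.prems(4)[of "\<lambda>_. undefined" "\<lambda>_. undefined"]
    by (simp add: nn_integral_empty restrict_def)
next
  case (insert i I)
  note [measurable] = insert.prems(1-3)
  interpret product_sigma_finite "\<lambda>_::'i. lborel :: real measure" by standard
  interpret finite_product_sigma_finite "\<lambda>_::'i. lborel :: real measure" I
    by standard (rule insert.hyps)
  have m[measurable]: "(\<lambda>y. \<integral>\<^sup>+x. F (x(i := y)) \<partial>(\<Pi>\<^sub>M i\<in>I. lborel)) \<in> borel_measurable borel"
    if [measurable]: "F \<in> borel_measurable (\<Pi>\<^sub>M i\<in>insert i I. lborel)" for F :: "('i \<Rightarrow> real) \<Rightarrow> ennreal"
    by measurable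
  have "(\<integral>\<^sup>+s. \<integral>\<^sup>+x. f (x(i := s)) \<partial>(\<Pi>\<^sub>M i\<in>I. lborel) \<partial>lborel) * (\<integral>\<^sup>+t. \<integral>\<^sup>+x. g (x(i := t)) \<partial>(\<Pi>\<^sub>M i\<in>I. lborel) \<partial>lborel)
    \<le> (\<integral>\<^sup>+r. \<integral>\<^sup>+x. h (x(i := r)) \<partial>(\<Pi>\<^sub>M i\<in>I. lborel) \<partial>lborel)\<^sup>2"
  proof (rule prekopa_leindler_real)
    fix s t :: real
    show "(\<integral>\<^sup>+x. f (x(i := s)) \<partial>(\<Pi>\<^sub>M i\<in>I. lborel)) * (\<integral>\<^sup>+x. g (x(i := t)) \<partial>(\<Pi>\<^sub>M i\<in>I. lborel))
      \<le> (\<integral>\<^sup>+x. h (x(i := (s + t) / 2)) \<partial>(\<Pi>\<^sub>M i\<in>I. lborel))\<^sup>2"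
    proof (rule insert.IH)
      fix x y :: "'i \<Rightarrow> real" assume xy: "x \<in> extensional I" "y \<in> extensional I"
      have "(\<lambda>j\<in>insert i I. ((x(i := s)) j + (y(i := t)) j) / 2) = (\<lambda>j\<in>I. (x j + y j) / 2)(i := (s + t) / 2)"
        using insert.hyps by (auto simp: fun_eq_iff restrict_def)
      moreover have "x(i := s) \<in> extensional (insert i I)" "y(i := t) \<in> extensional (insert i I)"
        using xy by (auto simp: extensional_def)
      ultimately show "f (x(i := s)) * g (y(i := t)) \<le> (h ((\<lambda>j\<in>I. (x j + y j) / 2)(i := (s + t) / 2)))\<^sup>2"
        using insert.prems(4)[of "x(i := s)" "y(i := t)"] by metis
    qed measurable
  qed measurable
  then show ?case
    using insert.hyps by (simp add: product_nn_integral_insert_rev)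
qed

theorem prekopa_leindler_midpoint:
  fixes f g h :: "'a::euclidean_space \<Rightarrow> ennreal"
  assumes [measurable]: "f \<in> borel_measurable borel" "g \<in> borel_measurable borel" "h \<in> borel_measurable borel"
    and h: "\<And>x y. f x * g y \<le> (h ((1/2) *\<^sub>R (x + y)))\<^sup>2"
  shows "(\<integral>\<^sup>+x. f x \<partial>lborel) * (\<integral>\<^sup>+x. g x \<partial>lborel) \<le> (\<integral>\<^sup>+x. h x \<partial>lborel)\<^sup>2"
proof -
  let ?T = "\<lambda>x::'a \<Rightarrow> real. \<Sum>b\<in>Basis. x b *\<^sub>R b"
  let ?P = "\<Pi>\<^sub>M b\<in>(Basis::'a set). (lborel :: real measure)"
  have T[measurable]: "?T \<in> borel_measurable ?P" by measurable
  have *: "(\<integral>\<^sup>+x. F x \<partial>lborel) = (\<integral>\<^sup>+x. F (?T x) \<partial>?P)" if [measurable]: "F \<in> borel_measurable borel"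
    for F :: "'a \<Rightarrow> ennreal"
    by (subst lborel_eq) (simp add: nn_integral_distr)
  show ?thesis unfolding *[OF assms(1)] *[OF assms(2)] *[OF assms(3)]
  proof (rule prekopa_leindler_PiM)
    fix x y :: "'a \<Rightarrow> real"
    have "?T (\<lambda>b\<in>Basis. (x b + y b) / 2) = (1/2) *\<^sub>R (?T x + ?T y)"
      by (simp add: scaleR_sum_right scaleR_add_left scaleR_add_right add_divide_distrib flip: sum.distrib)
    then show "f (?T x) * g (?T y) \<le> (h (?T (\<lambda>b\<in>Basis. (x b + y b) / 2)))\<^sup>2"
      using h[of "?T x" "?T y"] by simp
  qed (auto intro: finite_Basis)
qed

section \<open>Maximum principles\<close>

text \<open>Working with second derivatives along coordinate lines avoids the second Frechet derivative
  and its chain rule.\<close>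

definition has_laplacian :: "('a::euclidean_space \<Rightarrow> real) \<Rightarrow> 'a \<Rightarrow> real \<Rightarrow> bool" where
  "has_laplacian f x L \<longleftrightarrow>
     (\<exists>D. L = (\<Sum>b\<in>Basis. D b) \<and>
       (\<forall>b\<in>Basis. \<exists>f'. (\<forall>\<^sub>F t in nhds 0. ((\<lambda>t. f (x + t *\<^sub>R b)) has_real_derivative f' t) (at t)) \<and>
          (f' has_real_derivative D b) (at 0)))"

lemma has_laplacian_add:
  assumes "has_laplacian f x L" "has_laplacian g x M"
  shows "has_laplacian (\<lambda>x. f x + g x) x (L + M)"
proof -
  from assms obtain D E where
    D: "L = (\<Sum>b\<in>Basis. D b)" "\<And>b. b \<in> Basis \<Longrightarrow> \<exists>f'. (\<forall>\<^sub>F t in nhds 0. ((\<lambda>t. f (x + t *\<^sub>R b)) has_real_derivative f' t) (at t)) \<and>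
          (f' has_real_derivative D b) (at 0)" and
    E: "M = (\<Sum>b\<in>Basis. E b)" "\<And>b. b \<in> Basis \<Longrightarrow> \<exists>f'. (\<forall>\<^sub>F t in nhds 0. ((\<lambda>t. g (x + t *\<^sub>R b)) has_real_derivative f' t) (at t)) \<and>
          (f' has_real_derivative E b) (at 0)"
    unfolding has_laplacian_def by blast
  show ?thesis unfolding has_laplacian_def
  proof (intro exI[of _ "\<lambda>b. D b + E b"] conjI ballI)
    show "L + M = (\<Sum>b\<in>Basis. D b + E b)" using D E by (simp add: sum.distrib)
    fix b :: 'a assume b: "b \<in> Basis"
    obtain f' g' where
      f: "\<forall>\<^sub>F t in nhds 0. ((\<lambda>t. f (x + t *\<^sub>R b)) has_real_derivative f' t) (at t)" "(f' has_real_derivative D b) (at 0)" and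
      g: "\<forall>\<^sub>F t in nhds 0. ((\<lambda>t. g (x + t *\<^sub>R b)) has_real_derivative g' t) (at t)" "(g' has_real_derivative E b) (at 0)"
      using D(2)[OF b] E(2)[OF b] by blast
    show "\<exists>f'. (\<forall>\<^sub>F t in nhds 0. ((\<lambda>t. f (x + t *\<^sub>R b) + g (x + t *\<^sub>R b)) has_real_derivative f' t) (at t)) \<and>
          (f' has_real_derivative D b + E b) (at 0)"
      using eventually_conj[OF f(1) g(1)] f(2) g(2)
      by (intro exI[of _ "\<lambda>t. f' t + g' t"]) (auto elim!: eventually_mono intro!: derivative_intros)
  qed
qed

lemma has_laplacian_cmult:
  assumes "has_laplacian f x L"
  shows "has_laplacian (\<lambda>x. c * f x) x (c * L)"
proof -
  from assms obtain D where
    D: "L = (\<Sum>b\<in>Basis. D b)" "\<And>b. b \<in> Basis \<Longrightarrow> \<exists>f'. (\<forall>\<^sub>F t in nhds 0. ((\<lambda>t. f (x + t *\<^sub>R b)) has_real_derivative f' t) (at t)) \<and>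
          (f' has_real_derivative D b) (at 0)"
    unfolding has_laplacian_def by blast
  show ?thesis unfolding has_laplacian_def
  proof (intro exI[of _ "\<lambda>b. c * D b"] conjI ballI)
    show "c * L = (\<Sum>b\<in>Basis. c * D b)" using D by (simp add: sum_distrib_left)
    fix b :: 'a assume b: "b \<in> Basis"
    obtain f' where
      f: "\<forall>\<^sub>F t in nhds 0. ((\<lambda>t. f (x + t *\<^sub>R b)) has_real_derivative f' t) (at t)" "(f' has_real_derivative D b) (at 0)"
      using D(2)[OF b] by blast
    show "\<exists>f'. (\<forall>\<^sub>F t in nhds 0. ((\<lambda>t. c * f (x + t *\<^sub>R b)) has_real_derivative f' t) (at t)) \<and>
          (f' has_real_derivative c * D b) (at 0)"
      using f by (intro exI[of _ "\<lambda>t. c * f' t"]) (auto elim!: eventually_mono intro!: DERIV_cmult)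
  qed
qed

lemma has_laplacian_harmonic_on:
  fixes f :: "'a::euclidean_space \<Rightarrow> real"
  assumes "open U" "x \<in> U" and h: "harmonic_on U f"
  shows "has_laplacian f x 0"
  unfolding has_laplacian_def
proof (intro exI[of _ "\<lambda>b. frechet_derivative (\<lambda>y. frechet_derivative f (at y) b) (at x) b"] conjI ballI)
  have ck: "Ck_on (Suc (Suc 0)) U f" using h by (simp add: harmonic_on_def numeral_2_eq_2)
  then have d1: "\<And>y. y \<in> U \<Longrightarrow> f differentiable (at y)"
    and d2: "\<And>y v. y \<in> U \<Longrightarrow> (\<lambda>x. frechet_derivative f (at x) v) differentiable (at y)"
    by auto
  show "0 = (\<Sum>b\<in>Basis. frechet_derivative (\<lambda>y. frechet_derivative f (at y) b) (at x) b)"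
    using h \<open>x \<in> U\<close> by (simp add: harmonic_on_def laplacian_def)
  fix b :: 'a assume "b \<in> Basis"
  have line: "((\<lambda>t. g (x + t *\<^sub>R b)) has_real_derivative frechet_derivative g (at (x + t *\<^sub>R b)) b) (at t)"
    if "g differentiable (at (x + t *\<^sub>R b))" for g :: "'a \<Rightarrow> real" and t :: real
  proof -
    let ?g' = "frechet_derivative g (at (x + t *\<^sub>R b))"
    have g: "(g has_derivative ?g') (at (x + t *\<^sub>R b))" using that by (simp add: frechet_derivative_works)
    have l: "((\<lambda>t. x + t *\<^sub>R b) has_derivative (\<lambda>s. s *\<^sub>R b)) (at t)"
      by (auto intro!: derivative_eq_intros)
    have "((\<lambda>t. g (x + t *\<^sub>R b)) has_derivative (\<lambda>s. ?g' (s *\<^sub>R b))) (at t)"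
      using diff_chain_at[OF l g] by (simp add: o_def)
    moreover have "(\<lambda>s. ?g' (s *\<^sub>R b)) = (*) (?g' b)"
      using linear_frechet_derivative[OF that] by (auto simp: linear_cmul)
    ultimately show ?thesis by (simp add: has_field_derivative_def)
  qed
  show "\<exists>f'. (\<forall>\<^sub>F t in nhds 0. ((\<lambda>t. f (x + t *\<^sub>R b)) has_real_derivative f' t) (at t)) \<and>
          (f' has_real_derivative frechet_derivative (\<lambda>y. frechet_derivative f (at y) b) (at x) b) (at 0)"
  proof (intro exI[of _ "\<lambda>t. frechet_derivative f (at (x + t *\<^sub>R b)) b"] conjI)
    have "((\<lambda>t. x + t *\<^sub>R b) \<longlongrightarrow> x + 0 *\<^sub>R b) (nhds 0)" by (intro tendsto_intros filterlim_ident)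
    then have "\<forall>\<^sub>F t in nhds 0. x + t *\<^sub>R b \<in> U"
      using assms by (intro topological_tendstoD) auto
    then show "\<forall>\<^sub>F t in nhds 0. ((\<lambda>t. f (x + t *\<^sub>R b)) has_real_derivative frechet_derivative f (at (x + t *\<^sub>R b)) b) (at t)"
      by eventually_elim (intro line d1)
    show "((\<lambda>t. frechet_derivative f (at (x + t *\<^sub>R b)) b) has_real_derivative
       frechet_derivative (\<lambda>y. frechet_derivative f (at y) b) (at x) b) (at 0)"
      using line[of "\<lambda>y. frechet_derivative f (at y) b" 0] d2 \<open>x \<in> U\<close> by simp
  qed
qed

text \<open>Some coordinate has a positive second derivative. At a local maximum the first
  derivative along that line is 0, hence positive just to the right, and the mean value theorem
  makes the function increase. The second derivative is thus needed at the point \<open>x\<close>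
  only.\<close>

lemma has_laplacian_pos_not_local_max:
  assumes L: "has_laplacian f x L" "0 < L"
  shows "\<not> (\<forall>\<^sub>F y in nhds x. f y \<le> f x)"
proof
  assume mx: "\<forall>\<^sub>F y in nhds x. f y \<le> f x"
  from L obtain D where
    D: "L = (\<Sum>b\<in>Basis. D b)" "\<And>b. b \<in> Basis \<Longrightarrow> \<exists>f'. (\<forall>\<^sub>F t in nhds 0. ((\<lambda>t. f (x + t *\<^sub>R b)) has_real_derivative f' t) (at t)) \<and>
          (f' has_real_derivative D b) (at 0)"
    unfolding has_laplacian_def by blast
  obtain b where b: "b \<in> Basis" "0 < D b"
    using L(2) D(1) by (meson linorder_not_le sum_nonpos)
  obtain f' where
      f: "\<forall>\<^sub>F t in nhds 0. ((\<lambda>t. f (x + t *\<^sub>R b)) has_real_derivative f' t) (at t)" "(f' has_real_derivative D b) (at 0)"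
    using D(2)[OF b(1)] by blast
  have "((\<lambda>t. x + t *\<^sub>R b) \<longlongrightarrow> x + 0 *\<^sub>R b) (nhds 0)" by (intro tendsto_intros filterlim_ident)
  then have "filterlim (\<lambda>t. x + t *\<^sub>R b) (nhds x) (nhds 0)" by simp
  then have "\<forall>\<^sub>F t in nhds 0. f (x + t *\<^sub>R b) \<le> f x"
    using mx by (auto simp: filterlim_iff dest: spec[of _ "\<lambda>y. f y \<le> f x"])
  from eventually_conj[OF this f(1)] obtain d where d: "0 < d"
    "\<And>t. \<bar>t\<bar> < d \<Longrightarrow> f (x + t *\<^sub>R b) \<le> f x"
    "\<And>t. \<bar>t\<bar> < d \<Longrightarrow> ((\<lambda>t. f (x + t *\<^sub>R b)) has_real_derivative f' t) (at t)"
    by (auto simp: eventually_nhds_metric dist_real_def)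
  have f'0: "f' 0 = 0"
    using DERIV_local_max[OF d(3)[of 0], of d] d by auto
  obtain e where e: "0 < e" "\<And>h. 0 < h \<Longrightarrow> h < e \<Longrightarrow> f' 0 < f' (0 + h)"
    using DERIV_pos_inc_right[OF f(2) b(2)] by blast
  define s where "s = min d e / 2"
  have s: "0 < s" "s < d" "s < e" using d(1) e(1) by (auto simp: s_def)
  obtain z where z: "0 < z" "z < s" "f (x + s *\<^sub>R b) - f (x + 0 *\<^sub>R b) = (s - 0) * f' z"
    using MVT2[of 0 s "\<lambda>t. f (x + t *\<^sub>R b)" f'] d s by auto
  have "0 < f' z" using e(2)[of z] z s f'0 by simp
  then have "0 < f (x + s *\<^sub>R b) - f x" using z s by simp
  then show False using d(2)[of s] s by simp
qed

text \<open>Serves two purposes: \<open>N = 1\<close> is the perturbation that makes a Laplacian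
  strictly signed, and large \<open>N\<close> is a barrier that is strictly subharmonic away from
  the centre \<open>p\<close>. For \<open>N = 1\<close> the truncated exponent \<open>N - 2\<close>
  does no harm, its coefficient \<open>N - 1\<close> being 0.\<close>

lemma has_laplacian_radial_power:
  fixes p x :: "'a::euclidean_space" and r :: real
  defines "c \<equiv> r\<^sup>2 - (norm (x - p))\<^sup>2"
  shows "has_laplacian (\<lambda>x. (r\<^sup>2 - (norm (x - p))\<^sup>2) ^ N) x
     (real N * (real (N - 1) * c ^ (N - 2) * (4 * (norm (x - p))\<^sup>2) - c ^ (N - 1) * (2 * DIM('a))))"
  unfolding has_laplacian_def
proof (intro exI[of _ "\<lambda>b. real N * (real (N - 1) * c ^ (N - 2) * (4 * ((x - p) \<bullet> b)\<^sup>2) - c ^ (N - 1) * 2)"] conjI ballI)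
  have "(norm (x - p))\<^sup>2 = (\<Sum>b\<in>Basis. ((x - p) \<bullet> b)\<^sup>2)"
    by (simp only: power2_norm_eq_inner) (simp add: euclidean_inner[of "x - p" "x - p"] power2_eq_square)
  then show "real N * (real (N - 1) * c ^ (N - 2) * (4 * (norm (x - p))\<^sup>2) - c ^ (N - 1) * (2 * DIM('a)))
    = (\<Sum>b\<in>Basis. real N * (real (N - 1) * c ^ (N - 2) * (4 * ((x - p) \<bullet> b)\<^sup>2) - c ^ (N - 1) * 2))"
    by (simp add: sum_distrib_left sum_subtractf algebra_simps)
  fix b :: 'a assume b: "b \<in> Basis"
  define q where "q = (x - p) \<bullet> b"
  have line: "r\<^sup>2 - (norm (x + t *\<^sub>R b - p))\<^sup>2 = c - 2 * q * t - t\<^sup>2" for t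
  proof -
    have "(norm (x + t *\<^sub>R b - p))\<^sup>2 = (norm ((x - p) + t *\<^sub>R b))\<^sup>2" by (simp add: algebra_simps)
    also have "\<dots> = (norm (x - p))\<^sup>2 + 2 * q * t + t\<^sup>2"
      unfolding power2_norm_eq_inner using b
      by (simp only: inner_add_left inner_add_right inner_scaleR_left inner_scaleR_right inner_Basis q_def)
        (simp add: inner_commute power2_eq_square algebra_simps)
    finally show ?thesis by (simp add: c_def)
  qed
  show "\<exists>f'. (\<forall>\<^sub>F t in nhds 0. ((\<lambda>t. (r\<^sup>2 - (norm (x + t *\<^sub>R b - p))\<^sup>2) ^ N) has_real_derivative f' t) (at t)) \<and>
    (f' has_real_derivative real N * (real (N - 1) * c ^ (N - 2) * (4 * ((x - p) \<bullet> b)\<^sup>2) - c ^ (N - 1) * 2)) (at 0)"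
    unfolding line q_def[symmetric]
    apply (intro exI[of _ "\<lambda>t. real N * (c - 2 * q * t - t\<^sup>2) ^ (N - 1) * (- 2 * q - 2 * t)"] conjI always_eventually allI)
    subgoal by (rule derivative_eq_intros refl | simp)+
    subgoal by (rule derivative_eq_intros refl | simp add: numeral_2_eq_2)+ (simp add: power2_eq_square algebra_simps numeral_2_eq_2)
    done
qed

text \<open>A positive maximum over \<open>S\<close> would be attained in \<open>U\<close>, where a
  positive Laplacian forbids it. The set \<open>S - U\<close> takes the part of the boundary, so
  balls and annuli are treated alike; strictness of the Laplacian is left to the caller.\<close>

lemma weak_maximum_principle:
  fixes f :: "'a::euclidean_space \<Rightarrow> real"
  assumes "compact S" "open U" "U \<subseteq> S" and cont: "continuous_on S f"
    and sub: "\<And>x. x \<in> U \<Longrightarrow> 0 < f x \<Longrightarrow> \<exists>L>0. has_laplacian f x L"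
    and bd: "\<And>x. x \<in> S - U \<Longrightarrow> f x \<le> 0"
    and "x \<in> S"
  shows "f x \<le> 0"
proof -
  obtain z where z: "z \<in> S" "\<And>y. y \<in> S \<Longrightarrow> f y \<le> f z"
    using continuous_attains_sup[OF \<open>compact S\<close> _ cont] \<open>x \<in> S\<close> by blast
  have "f z \<le> 0"
  proof (rule ccontr)
    assume "\<not> f z \<le> 0"
    then have "z \<in> U" using bd z by force
    then obtain L where L: "0 < L" "has_laplacian f z L" using sub \<open>\<not> f z \<le> 0\<close> by force
    have "\<forall>\<^sub>F y in nhds z. y \<in> U" using \<open>open U\<close> \<open>z \<in> U\<close> by (rule eventually_nhds_in_open)
    then have "\<forall>\<^sub>F y in nhds z. f y \<le> f z" by eventually_elim (use z \<open>U \<subseteq> S\<close> in auto)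
    then show False using has_laplacian_pos_not_local_max[OF L(2,1)] by blast
  qed
  then show ?thesis using z(2)[OF \<open>x \<in> S\<close>] by linarith
qed

text \<open>The difference \<open>f - g\<close> has Laplacian 0, not a positive one. Subtracting
  \<open>d * (r^2 - |y - a|^2)\<close> raises the Laplacian to \<open>2 * d * DIM('a)\<close>,
  changes nothing on the sphere, and costs at most \<open>d * r^2 = e\<close> inside.\<close>

lemma harmonic_on_ball_le:
  fixes f g :: "'a::euclidean_space \<Rightarrow> real"
  assumes r: "0 < r"
    and f: "continuous_on (cball a r) f" "harmonic_on (ball a r) f"
    and g: "continuous_on (cball a r) g" "harmonic_on (ball a r) g"
    and bd: "\<And>x. x \<in> sphere a r \<Longrightarrow> f x \<le> g x" and x: "x \<in> cball a r"
  shows "f x \<le> g x"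
proof (rule field_le_epsilon)
  fix e :: real assume e: "0 < e"
  define d where "d = e / r\<^sup>2"
  have d: "0 < d" using e r by (simp add: d_def)
  define F where "F y = (f y + (- 1) * g y) + (- d) * (r\<^sup>2 - (norm (y - a))\<^sup>2) ^ 1" for y
  have "F x \<le> 0"
  proof (rule weak_maximum_principle[where S = "cball a r" and U = "ball a r"])
    show "continuous_on (cball a r) F" unfolding F_def by (intro continuous_intros f g)
    show "\<exists>L>0. has_laplacian F y L" if "y \<in> ball a r" for y
    proof -
      have "has_laplacian F y ((0 + (- 1) * 0) + (- d) * (real 1 * (real (1 - 1) * (r\<^sup>2 - (norm (y - a))\<^sup>2) ^ (1 - 2) * (4 * (norm (y - a))\<^sup>2)
          - (r\<^sup>2 - (norm (y - a))\<^sup>2) ^ (1 - 1) * (2 * DIM('a)))))"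
        unfolding F_def
        by (intro has_laplacian_add has_laplacian_cmult has_laplacian_radial_power
            has_laplacian_harmonic_on[OF open_ball that] f g)
      then show ?thesis using d by (intro exI[of _ "d * (2 * DIM('a))"]) simp
    qed
    show "F y \<le> 0" if "y \<in> cball a r - ball a r" for y
      using bd[of y] that by (auto simp: F_def dist_norm norm_minus_commute)
  qed (use x in auto)
  moreover have "d * (r\<^sup>2 - (norm (x - a))\<^sup>2) \<le> d * r\<^sup>2" using d by simp
  moreover have "d * r\<^sup>2 = e" using r by (simp add: d_def)
  ultimately show "f x \<le> g x + e" by (simp add: F_def)
qed

text \<open>A barrier argument in place of the strong maximum principle. On an annulus around
  \<open>p\<close>, a small multiple of \<open>(r^2 - |y - p|^2)^N\<close> with \<open>N\<close>
  large is strictly subharmonic and lies below \<open>w\<close> on both boundary spheres, hence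
  throughout; it is positive at distance less than \<open>r\<close> from \<open>p\<close>.\<close>

lemma harmonic_on_positive_spread:
  fixes w :: "'a::euclidean_space \<Rightarrow> real"
  assumes h: "harmonic_on U w" "continuous_on U w" and "open U" and nn: "\<And>y. y \<in> U \<Longrightarrow> 0 \<le> w y"
    and sub: "cball p r \<subseteq> U" and p: "0 < w p" and x: "dist p x < r"
  shows "0 < w x"
proof -
  have r: "0 < r" using x by (meson dist_triangle_lt dist_self zero_le_dist le_less_trans)
  have "p \<in> U" using sub r by auto
  then obtain s where s: "0 < s" "\<And>y. dist y p < s \<Longrightarrow> y \<in> U \<Longrightarrow> w p / 2 < w y"
  proof -
    have "continuous (at p within U) w" using h(2) \<open>p \<in> U\<close> continuous_on_eq_continuous_within by blast
    then obtain s where "0 < s" "\<And>y. y \<in> U \<Longrightarrow> dist y p < s \<Longrightarrow> dist (w y) (w p) < w p / 2"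
      using p unfolding continuous_within_eps_delta by (meson half_gt_zero)
    moreover have "w p / 2 < v" if "dist v (w p) < w p / 2" for v
      using that unfolding dist_real_def by linarith
    ultimately show thesis by (intro that[of s]) auto
  qed
  define t where "t = min s r / 2"
  have t: "0 < t" "t < s" "t < r" using s r by (auto simp: t_def)
  define S where "S = cball p r - ball p t"
  define V where "V = ball p r - cball p t"
  \<comment> \<open>Up to a positive factor the Laplacian of the barrier is
    \<open>(N - 1) * 2 * n^2 - DIM('a) * c\<close>, with \<open>n\<close> the distance to
    \<open>p\<close> and \<open>c = r^2 - n^2\<close>. On the annulus \<open>n > t\<close> and
    \<open>c \<le> r^2\<close>, so \<open>DIM('a) * r^2 < k * (2 * t^2)\<close> makes it positive
    for \<open>N = k + 2\<close>.\<close>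
  obtain k :: nat where k: "real DIM('a) * r\<^sup>2 / (2 * t\<^sup>2) < real k" using reals_Archimedean2 by blast
  define N where "N = k + 2"
  \<comment> \<open>The largest value of the unscaled barrier is \<open>(r^2)^N\<close>, so this
    factor keeps it at most \<open>w p / 2\<close>. That is below \<open>w\<close> on the inner
    sphere, whose radius \<open>t\<close> is less than the continuity radius
    \<open>s\<close>.\<close>
  define e where "e = w p / 2 / (r\<^sup>2) ^ N"
  have e: "0 < e" using p r by (simp add: e_def)
  define v where "v y = (r\<^sup>2 - (norm (y - p))\<^sup>2) ^ N" for y
  have v_le: "e * v y \<le> w p / 2" if "y \<in> cball p r" for y
  proof -
    have "(norm (y - p))\<^sup>2 \<le> r\<^sup>2" using that by (intro power_mono) (auto simp: dist_norm norm_minus_commute)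
    then have "v y \<le> (r\<^sup>2) ^ N" unfolding v_def by (intro power_mono) auto
    then have "e * v y \<le> e * (r\<^sup>2) ^ N" using e by (intro mult_left_mono) auto
    then show ?thesis using r by (simp add: e_def)
  qed
  have le: "e * v y + (- 1) * w y \<le> 0" if "y \<in> S" for y
  proof (rule weak_maximum_principle[where S = S and U = V and f = "\<lambda>y. e * v y + (- 1) * w y"])
    show "compact S" unfolding S_def by (intro compact_diff) auto
    show "open V" unfolding V_def by (intro open_Diff) auto
    show "V \<subseteq> S" unfolding V_def S_def by auto
    show "continuous_on S (\<lambda>y. e * v y + (- 1) * w y)" unfolding v_def
      by (intro continuous_intros continuous_on_subset[OF h(2)]) (use sub in \<open>auto simp: S_def\<close>)
    show "e * v y + (- 1) * w y \<le> 0" if y: "y \<in> S - V" for y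
    proof -
      have yU: "y \<in> U" using y sub by (auto simp: S_def)
      consider "dist p y = r" | "dist p y = t" using y by (fastforce simp: S_def V_def)
      then show ?thesis
      proof cases
        case 1
        then have "v y = 0" by (simp add: v_def dist_norm norm_minus_commute N_def)
        then show ?thesis using nn[OF yU] by simp
      next
        case 2
        then show ?thesis using v_le[of y] s(2)[OF _ yU] t by (simp add: dist_commute)
      qed
    qed
    show "\<exists>L>0. has_laplacian (\<lambda>y. e * v y + (- 1) * w y) y L" if y: "y \<in> V" for y
    proof -
      define n where "n = norm (y - p)"
      define c where "c = r\<^sup>2 - n\<^sup>2"
      have n: "t < n" "n < r" using y by (auto simp: V_def n_def dist_norm norm_minus_commute)
      have c: "0 < c" unfolding c_def using n t by (simp add: power_strict_mono)
      have "c \<le> r\<^sup>2" by (simp add: c_def)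
      have "y \<in> U" using y sub by (auto simp: V_def)
      then have "has_laplacian (\<lambda>y. e * v y + (- 1) * w y) y
          (e * (real N * (real (N - 1) * c ^ (N - 2) * (4 * n\<^sup>2) - c ^ (N - 1) * (2 * DIM('a)))) + (- 1) * 0)"
        unfolding v_def c_def n_def
        by (intro has_laplacian_add has_laplacian_cmult has_laplacian_radial_power
            has_laplacian_harmonic_on[OF \<open>open U\<close> _ h(1)])
      moreover have "0 < real (N - 1) * c ^ (N - 2) * (4 * n\<^sup>2) - c ^ (N - 1) * (2 * DIM('a))"
      proof -
        have "DIM('a) * c \<le> DIM('a) * r\<^sup>2" using \<open>c \<le> r\<^sup>2\<close> by (simp add: mult_left_mono)
        also have "\<dots> < real k * (2 * t\<^sup>2)" using k t by (simp add: pos_divide_less_eq)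
        also have "\<dots> \<le> real (k + 1) * (2 * n\<^sup>2)"
          using n t by (intro mult_mono) (auto intro: power_mono)
        finally have "0 < c ^ k * (2 * (real (k + 1) * (2 * n\<^sup>2) - DIM('a) * c))"
          using c by (intro mult_pos_pos) auto
        then show ?thesis by (simp add: N_def algebra_simps)
      qed
      ultimately show ?thesis using e by (intro exI conjI) (auto simp: N_def)
    qed
  qed (use that in auto)
  show ?thesis
  proof (cases "x \<in> S")
    case True
    have "(norm (x - p))\<^sup>2 < r\<^sup>2" using x by (intro power_strict_mono) (auto simp: dist_norm norm_minus_commute)
    then have "0 < e * v x" using e by (simp add: v_def)
    then show ?thesis using le[OF True] by simp
  next
    case False
    then have "dist x p < s" using x t by (auto simp: S_def dist_commute)
    moreover have "x \<in> U" using sub x by auto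
    ultimately show ?thesis using s(2)[of x] p by simp
  qed
qed

text \<open>The set where \<open>w\<close> is positive is open by continuity. The zero set is open
  too: positivity at a point close to a zero would spread to that zero. Connectedness leaves room
  for only one of them.\<close>

lemma harmonic_on_zero_connected:
  fixes w :: "'a::euclidean_space \<Rightarrow> real"
  assumes h: "harmonic_on U w" "continuous_on U w" and "open U" and nn: "\<And>y. y \<in> U \<Longrightarrow> 0 \<le> w y"
    and C: "connected C" "open C" "C \<subseteq> U" and x: "x \<in> C" "w x = 0" and y: "y \<in> C"
  shows "w y = 0"
proof (rule ccontr)
  assume "w y \<noteq> 0"
  define P where "P = {z \<in> C. 0 < w z}"
  define Z where "Z = {z \<in> C. w z = 0}"
  have cont: "continuous_on C w" using h(2) C(3) continuous_on_subset by blast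
  have "P = C \<inter> w -` {0<..}" by (auto simp: P_def)
  then have oP: "open P" using continuous_open_preimage[OF cont \<open>open C\<close>, of "{0<..}"] by simp
  have oZ: "open Z"
    unfolding open_contains_ball
  proof
    fix z assume z: "z \<in> Z"
    then obtain d where d: "0 < d" "ball z d \<subseteq> C" using \<open>open C\<close> by (auto simp: Z_def open_contains_ball)
    \<comment> \<open>For \<open>p\<close> within \<open>d/3\<close> of \<open>z\<close>, the ball
      of radius \<open>d/2\<close> about \<open>p\<close> reaches \<open>z\<close> and still stays
      inside \<open>ball z d\<close>.\<close>
    have "ball z (d/3) \<subseteq> Z"
    proof
      fix p assume p: "p \<in> ball z (d/3)"
      then have pC: "p \<in> C" using d by auto
      have "cball p (d/2) \<subseteq> ball z d"
      proof
        fix q assume "q \<in> cball p (d/2)"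
        then show "q \<in> ball z d" using p d dist_triangle[of z q p] by auto
      qed
      then have "cball p (d/2) \<subseteq> U" using d C by auto
      then have "\<not> 0 < w p"
        using harmonic_on_positive_spread[OF h \<open>open U\<close> nn, of p "d/2" z] p d z
        by (auto simp: Z_def dist_commute)
      then show "p \<in> Z" using nn[of p] pC C by (auto simp: Z_def)
    qed
    then show "\<exists>e>0. ball z e \<subseteq> Z" using d by (intro exI[of _ "d/3"]) auto
  qed
  have "P \<inter> Z = {}" "P \<union> Z = C" using nn C by (force simp: P_def Z_def)+
  moreover have "y \<in> P" "x \<in> Z" using y x \<open>w y \<noteq> 0\<close> nn[of y] C by (force simp: P_def Z_def)+
  ultimately show False using C(1) oP oZ unfolding connected_def by blast
qed

section \<open>Support functions\<close>

definition convex_body :: "'a::euclidean_space set \<Rightarrow> bool" where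
  "convex_body K \<longleftrightarrow> K \<noteq> {} \<and> compact K \<and> convex K"

definition support_fun :: "'a::euclidean_space set \<Rightarrow> 'a \<Rightarrow> real" where
  "support_fun K u = (SUP z\<in>K. z \<bullet> u)"

lemma support_fun_ge: "compact K \<Longrightarrow> z \<in> K \<Longrightarrow> z \<bullet> u \<le> support_fun K u"
  unfolding support_fun_def
  by (intro cSUP_upper bounded_imp_bdd_above compact_imp_bounded compact_continuous_image continuous_intros)

lemma support_fun_attained:
  assumes "compact K" "K \<noteq> {}"
  obtains z where "z \<in> K" "z \<bullet> u = support_fun K u"
proof -
  obtain z where z: "z \<in> K" "\<And>y. y \<in> K \<Longrightarrow> y \<bullet> u \<le> z \<bullet> u"
  proof -
    have "continuous_on K (\<lambda>z. z \<bullet> u)" by (intro continuous_intros)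
    from continuous_attains_sup[OF assms this] show thesis using that by blast
  qed
  have "support_fun K u = z \<bullet> u"
    unfolding support_fun_def using z by (intro cSup_eq_maximum) auto
  then show thesis using z that by auto
qed

lemma support_fun_eqI:
  assumes "compact K" "\<And>z. z \<in> K \<Longrightarrow> z \<bullet> u \<le> s" "w \<in> K" "w \<bullet> u = s"
  shows "support_fun K u = s"
  using support_fun_attained[OF assms(1), of u] support_fun_ge[OF assms(1,3), of u] assms
  by (metis antisym empty_iff)

lemma support_fun_least:
  assumes "compact K" "K \<noteq> {}" "\<And>z. z \<in> K \<Longrightarrow> z \<bullet> u \<le> s"
  shows "support_fun K u \<le> s"
  using support_fun_attained[OF assms(1,2), of u] assms(3) by metis

lemma support_fun_add_le:
  assumes "compact K" "K \<noteq> {}"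
  shows "support_fun K (u + v) \<le> support_fun K u + support_fun K v"
  using assms by (intro support_fun_least) (auto simp: inner_add_right intro!: add_mono support_fun_ge)

lemma support_fun_scaleR:
  assumes "compact K" "K \<noteq> {}" "0 \<le> c"
  shows "support_fun K (c *\<^sub>R u) = c * support_fun K u"
proof -
  obtain z where "z \<in> K" "z \<bullet> u = support_fun K u" using support_fun_attained assms by metis
  then show ?thesis using assms
    by (intro support_fun_eqI[where w = z]) (auto intro!: mult_left_mono support_fun_ge)
qed

lemma support_fun_abs_le:
  assumes "compact K" "K \<noteq> {}" "\<And>z. z \<in> K \<Longrightarrow> norm z \<le> R"
  shows "\<bar>support_fun K u\<bar> \<le> R * norm u"
proof -
  obtain z where z: "z \<in> K" "z \<bullet> u = support_fun K u" using support_fun_attained assms by metis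
  then have "\<bar>support_fun K u\<bar> \<le> norm z * norm u" by (metis Cauchy_Schwarz_ineq2)
  also have "\<dots> \<le> R * norm u" using assms z by (intro mult_right_mono) auto
  finally show ?thesis .
qed

lemma support_fun_lipschitz:
  assumes "compact K" "K \<noteq> {}" "\<And>z. z \<in> K \<Longrightarrow> norm z \<le> R"
  shows "\<bar>support_fun K u - support_fun K v\<bar> \<le> R * norm (u - v)"
  using support_fun_add_le[OF assms(1,2), of "u - v" v] support_fun_add_le[OF assms(1,2), of "v - u" u]
    support_fun_abs_le[OF assms, of "u - v"] support_fun_abs_le[OF assms, of "v - u"]
  by (simp add: norm_minus_commute[of v u])

text \<open>The vector from the closest point to \<open>z\<close> is an outer normal of
  \<open>K\<close> there, so the closest point is where this linear functional is largest. This
  identity drives both the separation arguments and the first variation of the distance.\<close>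

lemma support_fun_closest_point:
  assumes "convex_body K"
  shows "support_fun K (z - closest_point K z) = closest_point K z \<bullet> (z - closest_point K z)"
proof (rule support_fun_eqI)
  show "w \<bullet> (z - closest_point K z) \<le> closest_point K z \<bullet> (z - closest_point K z)" if "w \<in> K" for w
    using closest_point_dot[of K w z] assms that
    by (auto simp: convex_body_def compact_imp_closed inner_diff_right inner_diff_left inner_commute)
qed (use assms in \<open>auto simp: convex_body_def intro: closest_point_in_set compact_imp_closed\<close>)

text \<open>The only direction to test is the one from the closest point to \<open>z\<close>: the
  inequality there forces its squared length to be 0.\<close>

lemma mem_convex_body_iff:
  assumes "convex_body K"
  shows "z \<in> K \<longleftrightarrow> (\<forall>u. z \<bullet> u \<le> support_fun K u)"
proof
  assume *: "\<forall>u. z \<bullet> u \<le> support_fun K u"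
  have "(z - closest_point K z) \<bullet> (z - closest_point K z) \<le> 0"
    using spec[OF *, of "z - closest_point K z"] support_fun_closest_point[OF assms, of z]
    by (simp add: inner_diff_left)
  then have "z - closest_point K z = 0" by (metis inner_eq_zero_iff inner_ge_zero order_antisym)
  then have "z = closest_point K z" by simp
  then show "z \<in> K"
    by (metis assms closest_point_in_set compact_imp_closed convex_body_def)
qed (use assms in \<open>auto simp: convex_body_def intro: support_fun_ge\<close>)

lemma infdist_le_of_support_fun_le:
  assumes K: "convex_body K" and S: "compact S" "z \<in> S"
    and le: "\<And>u. support_fun S u \<le> support_fun K u + e * norm u" and "0 \<le> e"
  shows "infdist z K \<le> e"
proof -
  define k where "k = closest_point K z"
  have k: "k \<in> K" using K by (auto simp: k_def convex_body_def intro: closest_point_in_set compact_imp_closed)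
  have "z \<bullet> (z - k) \<le> k \<bullet> (z - k) + e * norm (z - k)"
    using support_fun_ge[OF S, of "z - k"] le[of "z - k"] support_fun_closest_point[OF K, of z]
    unfolding k_def by linarith
  then have "(norm (z - k))\<^sup>2 \<le> e * norm (z - k)"
    by (simp add: power2_norm_eq_inner inner_diff_left)
  then have "norm (z - k) \<le> e"
    using \<open>0 \<le> e\<close> by (cases "norm (z - k) = 0") (auto simp: power2_eq_square)
  then show ?thesis using infdist_le[OF k, of z] by (simp add: dist_norm)
qed

lemma hausdorff_dist_le_of_support_fun:
  assumes "convex_body S" "convex_body K" "0 \<le> e"
    and "\<And>u. \<bar>support_fun S u - support_fun K u\<bar> \<le> e * norm u"
  shows "hausdorff_dist S K \<le> e"
proof -
  have le: "support_fun S u \<le> support_fun K u + e * norm u" "support_fun K u \<le> support_fun S u + e * norm u" for u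
    using assms(4)[of u] by (auto simp: abs_le_iff)
  have c: "compact S" "compact K" "S \<noteq> {}" "K \<noteq> {}" using assms by (auto simp: convex_body_def)
  have "(SUP x\<in>S. infdist x K) \<le> e"
    by (intro cSUP_least c infdist_le_of_support_fun_le[OF assms(2) c(1) _ le(1) assms(3)])
  moreover have "(SUP x\<in>K. infdist x S) \<le> e"
    by (intro cSUP_least c infdist_le_of_support_fun_le[OF assms(1) c(2) _ le(2) assms(3)])
  ultimately show ?thesis by (simp add: hausdorff_dist_def)
qed

lemma infdist_le_hausdorff_dist:
  assumes "bounded S" "bounded T" "S \<noteq> {}" "T \<noteq> {}"
  shows "z \<in> S \<Longrightarrow> infdist z T \<le> hausdorff_dist S T" "z \<in> T \<Longrightarrow> infdist z S \<le> hausdorff_dist S T"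
proof -
  have *: "bdd_above ((\<lambda>x. infdist x Y) ` X)" if "bounded X" "Y \<noteq> {}" for X Y :: "'a set"
  proof -
    from that(2) obtain y where y: "y \<in> Y" by blast
    from that(1) obtain e where "\<forall>x\<in>X. dist y x \<le> e" unfolding bounded_any_center[of X y] by blast
    then have "infdist x Y \<le> e" if "x \<in> X" for x
      using infdist_le[OF y, of x] that by (force simp: dist_commute)
    then show ?thesis by (intro bdd_aboveI2[of _ _ e])
  qed
  show "z \<in> S \<Longrightarrow> infdist z T \<le> hausdorff_dist S T"
    unfolding hausdorff_dist_def by (rule max.coboundedI1) (intro cSUP_upper * assms)
  show "z \<in> T \<Longrightarrow> infdist z S \<le> hausdorff_dist S T"
    unfolding hausdorff_dist_def by (rule max.coboundedI2) (intro cSUP_upper * assms)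
qed

lemma support_fun_le_of_infdist_le:
  assumes "compact S" "S \<noteq> {}" "compact K" "K \<noteq> {}" and le: "\<And>z. z \<in> S \<Longrightarrow> infdist z K \<le> e"
  shows "support_fun S u \<le> support_fun K u + e * norm u"
proof (rule support_fun_least)
  fix z assume z: "z \<in> S"
  obtain k where k: "k \<in> K" "infdist z K = dist z k"
    using infdist_attains_inf[of K z] assms by (auto simp: compact_imp_closed)
  have "z \<bullet> u = k \<bullet> u + (z - k) \<bullet> u" by (simp add: inner_diff_left)
  also have "(z - k) \<bullet> u \<le> norm (z - k) * norm u" by (rule norm_cauchy_schwarz)
  also have "\<dots> \<le> e * norm u" using le[OF z] k by (intro mult_right_mono) (auto simp: dist_norm)
  finally show "z \<bullet> u \<le> support_fun K u + e * norm u"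
    using support_fun_ge[OF \<open>compact K\<close> k(1), of u] by linarith
qed (use assms in auto)

lemma support_fun_diff_le_hausdorff_dist:
  assumes "compact S" "S \<noteq> {}" "compact K" "K \<noteq> {}"
  shows "\<bar>support_fun S u - support_fun K u\<bar> \<le> hausdorff_dist S K * norm u"
proof -
  note b = compact_imp_bounded[OF assms(1)] compact_imp_bounded[OF assms(3)] assms(2,4)
  have "support_fun S u \<le> support_fun K u + hausdorff_dist S K * norm u"
    by (rule support_fun_le_of_infdist_le[OF assms infdist_le_hausdorff_dist(1)[OF b]])
  moreover have "support_fun K u \<le> support_fun S u + hausdorff_dist S K * norm u"
    by (rule support_fun_le_of_infdist_le[OF assms(3,4,1,2) infdist_le_hausdorff_dist(2)[OF b]])
  ultimately show ?thesis by linarith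
qed

text \<open>Gives the uniqueness behind the \<open>THE\<close> in \<open>minkowski_integral\<close>.
  The sets \<open>S\<close> will be Riemann sums; the argument goes through distances of points, so
  that no triangle inequality for \<open>hausdorff_dist\<close> has to be set up.\<close>

lemma hausdorff_limit_unique:
  fixes K L :: "'a::heine_borel set"
  assumes "compact K" "K \<noteq> {}" "compact L" "L \<noteq> {}"
    and "\<And>e. 0 < e \<Longrightarrow> \<exists>S. compact S \<and> S \<noteq> {} \<and> hausdorff_dist S K < e \<and> hausdorff_dist S L < e"
  shows "K = L"
proof -
  have 1: "z \<in> L" if z: "z \<in> K" and KL: "compact K" "K \<noteq> {}" "compact L" "L \<noteq> {}"
    and ex: "\<And>e. 0 < e \<Longrightarrow> \<exists>S. compact S \<and> S \<noteq> {} \<and> hausdorff_dist S K < e \<and> hausdorff_dist S L < e"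
    for K L :: "'a set" and z
  proof -
    have "infdist z L \<le> 0"
    proof (rule field_le_epsilon)
      fix e :: real assume "0 < e"
      then obtain S where S: "compact S" "S \<noteq> {}" "hausdorff_dist S K < e/2" "hausdorff_dist S L < e/2"
        using ex[of "e/2"] by auto
      obtain s where s: "s \<in> S" "infdist z S = dist z s"
        using infdist_attains_inf[of S z] S by (auto simp: compact_imp_closed)
      have "infdist z S < e/2" "infdist s L < e/2"
        using infdist_le_hausdorff_dist(2)[of S K z] infdist_le_hausdorff_dist(1)[of S L s] S s z KL
        by (auto simp: compact_imp_bounded)
      then show "infdist z L \<le> 0 + e" using infdist_triangle[of z L s] s by simp
    qed
    then have "infdist z L = 0" using infdist_nonneg[of z L] by linarith
    then show ?thesis using KL by (simp add: in_closed_iff_infdist_zero compact_imp_closed)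
  qed
  show ?thesis
  proof
    show "K \<subseteq> L" using 1[OF _ assms] by blast
    have "\<exists>S. compact S \<and> S \<noteq> {} \<and> hausdorff_dist S L < e \<and> hausdorff_dist S K < e" if "0 < e" for e
      using assms(5)[OF that] by blast
    then show "L \<subseteq> K" using 1[OF _ assms(3,4,1,2)] by blast
  qed
qed

section \<open>Minkowski operations, and bodies with a prescribed support function\<close>

lemma convex_body_set_plus:
  assumes "convex_body K" "convex_body L"
  shows "convex_body (K + L)" "support_fun (K + L) u = support_fun K u + support_fun L u"
proof -
  have eq: "K + L = {x + y |x y. x \<in> K \<and> y \<in> L}" by (auto simp: set_plus_def)
  show b: "convex_body (K + L)"
    using assms compact_sums[of K L] convex_set_plus[of K L]
    by (auto simp: convex_body_def eq[symmetric])
  obtain k where k: "k \<in> K" "k \<bullet> u = support_fun K u" using support_fun_attained assms unfolding convex_body_def by metis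
  obtain l where l: "l \<in> L" "l \<bullet> u = support_fun L u" using support_fun_attained assms unfolding convex_body_def by metis
  show "support_fun (K + L) u = support_fun K u + support_fun L u"
  proof (rule support_fun_eqI)
    show "compact (K + L)" using b by (simp add: convex_body_def)
    show "k + l \<in> K + L" using k l by auto
    show "(k + l) \<bullet> u = support_fun K u + support_fun L u" using k l by (simp add: inner_add_left)
    show "z \<bullet> u \<le> support_fun K u + support_fun L u" if "z \<in> K + L" for z
      using that assms unfolding set_plus_def convex_body_def
      by (auto simp: inner_add_left intro!: add_mono support_fun_ge)
  qed
qed

lemma convex_body_scale:
  assumes "convex_body K" "0 \<le> c"
  shows "convex_body ((*\<^sub>R) c ` K)" "support_fun ((*\<^sub>R) c ` K) u = c * support_fun K u"
proof -
  show b: "convex_body ((*\<^sub>R) c ` K)"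
    using assms by (auto simp: convex_body_def compact_scaling convex_scaling)
  obtain k where k: "k \<in> K" "k \<bullet> u = support_fun K u" using support_fun_attained assms unfolding convex_body_def by metis
  show "support_fun ((*\<^sub>R) c ` K) u = c * support_fun K u"
    using assms k b
    by (intro support_fun_eqI[where w = "c *\<^sub>R k"]) (auto simp: convex_body_def intro!: mult_left_mono support_fun_ge)
qed

lemma convex_body_sum:
  assumes "finite P" "\<And>E. E \<in> P \<Longrightarrow> convex_body (K E)"
  shows "convex_body (\<Sum>E\<in>P. K E) \<and> support_fun (\<Sum>E\<in>P. K E) u = (\<Sum>E\<in>P. support_fun (K E) u)"
  using assms
proof (induction P rule: finite_induct)
  case empty
  have "(0::'b set) = {0}" by (rule set_zero)
  then show ?case by (simp add: convex_body_def support_fun_def)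
next
  case (insert E P)
  then show ?case using convex_body_set_plus[of "K E" "\<Sum>E\<in>P. K E"] by auto
qed

text \<open>Existence of the set-valued integral rests on this: the averaged support function is
  sublinear, hence the support function of a body. That the half-spaces
  \<open>z \<bullet> u \<le> H u\<close> are tight, and have a common point at all, follows by
  separating a point from the epigraph of \<open>H\<close>.\<close>

lemma sublinear_imp_support_fun:
  fixes H :: "'a::euclidean_space \<Rightarrow> real"
  assumes sub: "\<And>u v. H (u + v) \<le> H u + H v" and hom: "\<And>c u. 0 \<le> c \<Longrightarrow> H (c *\<^sub>R u) = c * H u"
  obtains K where "convex_body K" "\<And>u. support_fun K u = H u"
proof -
  define K where "K = {z. \<forall>u. z \<bullet> u \<le> H u}"
  have H0: "H 0 = 0" using hom[of 0 0] by simp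
  have cvx: "convex_on UNIV H"
    by (intro convex_onI) (auto simp: hom intro: order_trans[OF sub])
  then have cont: "continuous_on UNIV H" by (rule convex_on_continuous[OF open_UNIV])
  define S where "S = {p. H (fst p) \<le> snd p}"
  have S: "convex S" "closed S"
  proof -
    have "S = epigraph UNIV H" by (auto simp: S_def epigraph_def)
    then show "convex S" using cvx by (simp add: convex_epigraph)
    show "closed S" unfolding S_def
      by (intro closed_Collect_le continuous_on_compose2[OF cont] continuous_intros) auto
  qed
  have approx: "\<exists>z\<in>K. H u - e \<le> z \<bullet> u" if "0 < e" for u e
  proof -
    \<comment> \<open>A point slightly below the epigraph is used because strict separation needs a
      point outside the closed set. The separating functional \<open>(a, q)\<close> has
      \<open>q > 0\<close>, and its slope \<open>- a / q\<close> will be the wanted point of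
      \<open>K\<close>.\<close>
    have "(u, H u - e) \<notin> S" using that by (simp add: S_def)
    then obtain p b where b: "p \<bullet> (u, H u - e) < b" "\<And>x. x \<in> S \<Longrightarrow> b < p \<bullet> x"
      using separating_hyperplane_closed_point[OF S] by blast
    obtain a q where p: "p = (a, q)" by (cases p)
    have b1: "a \<bullet> u + q * (H u - e) < b" using b(1) by (simp add: p)
    have b2: "b < a \<bullet> v + q * s" if "H v \<le> s" for v s using b(2)[of "(v, s)"] that by (simp add: p S_def)
    have q: "0 < q"
    proof -
      have "q * (H u - e) < q * H u" using b1 b2[of u "H u"] by simp
      then show ?thesis using \<open>0 < e\<close> by (simp add: right_diff_distrib zero_less_mult_iff)
    qed
    have "b < 0" using b2[of 0 0] by (simp add: H0)
    have pos: "0 \<le> a \<bullet> v + q * H v" for v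
    proof (rule ccontr)
      assume neg: "\<not> 0 \<le> a \<bullet> v + q * H v"
      \<comment> \<open>The epigraph is a cone, so a negative value of the functional on it could be
        rescaled to exactly \<open>b\<close>, against strict separation. The functional is therefore
        nonnegative on the graph of \<open>H\<close>.\<close>
      define c where "c = b / (a \<bullet> v + q * H v)"
      have "0 \<le> c" using neg \<open>b < 0\<close> by (simp add: c_def divide_nonpos_neg)
      have "b < a \<bullet> (c *\<^sub>R v) + q * H (c *\<^sub>R v)" by (rule b2) simp
      also have "\<dots> = c * (a \<bullet> v + q * H v)" using \<open>0 \<le> c\<close> by (simp add: hom algebra_simps)
      also have "\<dots> = b" using neg by (simp add: c_def)
      finally show False by simp
    qed
    define z where "z = - (1 / q) *\<^sub>R a"
    have zv: "z \<bullet> v = - (a \<bullet> v) / q" for v by (simp add: z_def)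
    have "z \<in> K" unfolding K_def
    proof (intro CollectI allI)
      fix v show "z \<bullet> v \<le> H v" using pos[of v] q by (simp add: zv field_simps)
    qed
    moreover have "H u - e \<le> z \<bullet> u" using b1 \<open>b < 0\<close> q by (simp add: zv field_simps)
    ultimately show ?thesis by blast
  qed
  have "bounded K"
  proof -
    have "norm z \<le> (\<Sum>b\<in>Basis. \<bar>H b\<bar> + \<bar>H (- b)\<bar>)" if "z \<in> K" for z
    proof -
      have "\<bar>z \<bullet> b\<bar> \<le> \<bar>H b\<bar> + \<bar>H (- b)\<bar>" for b
      proof -
        have "z \<bullet> b \<le> H b" "z \<bullet> (- b) \<le> H (- b)" using that unfolding K_def by blast+
        then show ?thesis by (auto simp: abs_le_iff)
      qed
      then have "(\<Sum>b\<in>Basis. \<bar>z \<bullet> b\<bar>) \<le> (\<Sum>b\<in>Basis. \<bar>H b\<bar> + \<bar>H (- b)\<bar>)" by (intro sum_mono)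
      then show ?thesis using norm_le_l1[of z] by linarith
    qed
    then show ?thesis by (auto simp: bounded_iff)
  qed
  moreover have Kint: "K = (\<Inter>u. {z. z \<bullet> u \<le> H u})" by (auto simp: K_def)
  have "closed K" unfolding Kint by (intro closed_INT ballI closed_Collect_le continuous_intros)
  ultimately have "compact K" by (simp add: compact_eq_bounded_closed)
  moreover have "convex K" unfolding Kint by (intro convex_INT) (simp add: convex_halfspace_le inner_commute)
  moreover have "K \<noteq> {}" using approx[of 1 0] by auto
  ultimately have body: "convex_body K" by (simp add: convex_body_def)
  moreover have "support_fun K u = H u" for u
  proof (rule antisym)
    show "support_fun K u \<le> H u" using \<open>compact K\<close> \<open>K \<noteq> {}\<close> by (rule support_fun_least) (simp add: K_def)
    show "H u \<le> support_fun K u"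
    proof (rule field_le_epsilon)
      fix e :: real assume "0 < e"
      then obtain z where "z \<in> K" "H u - e \<le> z \<bullet> u" using approx by blast
      then show "H u \<le> support_fun K u + e" using support_fun_ge[OF \<open>compact K\<close>, of z u] by linarith
    qed
  qed
  ultimately show thesis by (rule that)
qed

text \<open>The cells collect the points that lie in the same balls of a finite cover by balls of
  radius \<open>d/2\<close>. Without arbitrarily fine partitions the limit of Riemann sums would be
  vacuous and its uniqueness would fail.\<close>

lemma fine_borel_partition:
  fixes F :: "'a::euclidean_space set"
  assumes "compact F" "0 < d"
  obtains P where "finite P" "partition_on F P" "P \<subseteq> sets (restrict_space borel F)"
    "\<And>E x y. E \<in> P \<Longrightarrow> x \<in> E \<Longrightarrow> y \<in> E \<Longrightarrow> dist x y < d"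
proof -
  obtain D where D: "finite D" "F \<subseteq> (\<Union>c\<in>D. ball c (d/2))"
    using compactE_image[OF assms(1), of F "\<lambda>c. ball c (d/2)"] assms by (metis UN_I centre_in_ball half_gt_zero open_ball subsetI)
  define sig where "sig x = {c \<in> D. dist c x < d/2}" for x
  define P where "P = (\<lambda>T. F \<inter> {x. sig x = T}) ` Pow D - {{}}"
  show thesis
  proof (rule that)
    show "finite P" using D by (simp add: P_def)
    show "partition_on F P"
    proof (rule partition_onI)
      have "x \<in> \<Union> P" if "x \<in> F" for x
        using that unfolding P_def by (intro UnionI[of "F \<inter> {y. sig y = sig x}"]) (auto simp: sig_def)
      then show "\<Union> P = F" by (auto simp: P_def)
    qed (auto simp: P_def disjnt_def)
    show "P \<subseteq> sets (restrict_space borel F)"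
    proof -
      have "F \<inter> {x. sig x = T} \<in> sets (restrict_space borel F)" if "T \<subseteq> D" for T
      proof -
        have "{x. sig x = T} = (\<Inter>c\<in>D. {x. c \<in> T \<longleftrightarrow> dist c x < d/2})" using that by (auto simp: sig_def)
        also have "\<dots> = {x \<in> space borel. \<forall>c\<in>D. c \<in> T \<longleftrightarrow> dist c x < d/2}" by auto
        also have "\<dots> \<in> sets borel" using D(1)
        proof (intro sets.sets_Collect_finite_All)
          show "{x \<in> space borel. (c \<in> T) = (dist c x < d / 2)} \<in> sets borel" for c
            by measurable
        qed
        finally show ?thesis by (auto simp: sets_restrict_space)
      qed
      then show ?thesis by (auto simp: P_def)
    qed
    show "dist x y < d" if "E \<in> P" "x \<in> E" "y \<in> E" for E x y
    proof -
      have xy: "sig x = sig y" "x \<in> F" using that by (auto simp: P_def)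
      then obtain c where "c \<in> sig x" using D by (auto simp: sig_def)
      then have "dist c x < d/2" "dist c y < d/2" using xy by (auto simp: sig_def)
      then show ?thesis using dist_triangle2[of x y c] by (simp add: dist_commute)
    qed
  qed
qed

section \<open>Minkowski integrals of continuous families\<close>

locale body_family =
  fixes F :: "'a::euclidean_space set" and A :: "'a \<Rightarrow> 'b::euclidean_space set"
  assumes compact_F: "compact F"
    and body: "\<And>\<tau>. \<tau> \<in> F \<Longrightarrow> convex_body (A \<tau>)"
    and hausdorff_cont: "hausdorff_continuous_on F A"
begin

lemma body_parts: "\<tau> \<in> F \<Longrightarrow> A \<tau> \<noteq> {}" "\<tau> \<in> F \<Longrightarrow> compact (A \<tau>)"
  using body by (auto simp: convex_body_def)

lemma continuous_on_support_fun: "continuous_on F (\<lambda>\<tau>. support_fun (A \<tau>) u)"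
  unfolding continuous_on_iff
proof (intro ballI allI impI)
  fix \<tau> and e :: real assume \<tau>: "\<tau> \<in> F" and e: "0 < e"
  have "0 < e / (norm u + 1)" using e by (simp add: add_nonneg_pos)
  then obtain d where d: "0 < d" "\<And>\<sigma>. \<sigma> \<in> F \<Longrightarrow> dist \<sigma> \<tau> < d \<Longrightarrow> hausdorff_dist (A \<sigma>) (A \<tau>) < e / (norm u + 1)"
    using hausdorff_cont \<tau> unfolding hausdorff_continuous_on_def by meson
  have "dist (support_fun (A \<sigma>) u) (support_fun (A \<tau>) u) < e" if "\<sigma> \<in> F" "dist \<sigma> \<tau> < d" for \<sigma>
  proof -
    have "\<bar>support_fun (A \<sigma>) u - support_fun (A \<tau>) u\<bar> \<le> hausdorff_dist (A \<sigma>) (A \<tau>) * norm u"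
      using that \<tau> by (intro support_fun_diff_le_hausdorff_dist body_parts)
    also have "\<dots> \<le> e / (norm u + 1) * norm u"
      using d(2)[OF that] by (intro mult_right_mono) auto
    also have "\<dots> < e" using e by (simp add: pos_divide_less_eq add_nonneg_pos distrib_left)
    finally show ?thesis by (simp add: dist_real_def)
  qed
  then show "\<exists>d>0. \<forall>\<sigma>\<in>F. dist \<sigma> \<tau> < d \<longrightarrow> dist (support_fun (A \<sigma>) u) (support_fun (A \<tau>) u) < e"
    using d(1) by blast
qed

text \<open>The support function in the directions of the basis vectors and their negatives is
  continuous on the compact set \<open>F\<close>; its bounds there control all coordinates of all
  points of all bodies at once.\<close>

lemma uniformly_bounded:
  obtains R where "0 < R" "\<And>\<tau> z. \<tau> \<in> F \<Longrightarrow> z \<in> A \<tau> \<Longrightarrow> norm z \<le> R"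
proof -
  have "\<exists>B. \<forall>\<tau>\<in>F. \<bar>support_fun (A \<tau>) u\<bar> \<le> B" for u
    using compact_imp_bounded[OF compact_continuous_image[OF continuous_on_support_fun compact_F], of u]
    by (auto simp: bounded_iff)
  then obtain B where B: "\<And>u \<tau>. \<tau> \<in> F \<Longrightarrow> \<bar>support_fun (A \<tau>) u\<bar> \<le> B u" by metis
  define R where "R = (\<Sum>b\<in>Basis. \<bar>B b\<bar> + \<bar>B (- b)\<bar>)"
  have "norm z \<le> R" if "\<tau> \<in> F" "z \<in> A \<tau>" for \<tau> z
  proof -
    have "\<bar>z \<bullet> b\<bar> \<le> \<bar>B b\<bar> + \<bar>B (- b)\<bar>" for b
    proof -
      have "z \<bullet> b \<le> support_fun (A \<tau>) b" "z \<bullet> (- b) \<le> support_fun (A \<tau>) (- b)"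
        using that by (intro support_fun_ge body_parts; simp)+
      then show ?thesis using B[OF that(1), of b] B[OF that(1), of "- b"] unfolding inner_minus_right by linarith
    qed
    then have "(\<Sum>b\<in>Basis. \<bar>z \<bullet> b\<bar>) \<le> R" unfolding R_def by (intro sum_mono)
    then show ?thesis using norm_le_l1[of z] by linarith
  qed
  then show thesis by (intro that[of "max R 1"]) (auto simp: le_max_iff_disj)
qed

lemma continuous_on_support_fun_joint:
  "continuous_on (F \<times> UNIV) (\<lambda>p. support_fun (A (fst p)) (snd p))"
  unfolding continuous_on_iff
proof (intro ballI allI impI)
  fix p :: "'a \<times> 'b" and e :: real assume p: "p \<in> F \<times> UNIV" and e: "0 < e"
  obtain \<tau> u where pe: "p = (\<tau>, u)" by (cases p)
  then have \<tau>: "\<tau> \<in> F" using p by auto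
  obtain R where R: "0 < R" "\<And>\<tau> z. \<tau> \<in> F \<Longrightarrow> z \<in> A \<tau> \<Longrightarrow> norm z \<le> R" by (rule uniformly_bounded) blast
  obtain d where d: "0 < d" "\<And>\<sigma>. \<sigma> \<in> F \<Longrightarrow> dist \<sigma> \<tau> < d \<Longrightarrow> dist (support_fun (A \<sigma>) u) (support_fun (A \<tau>) u) < e/2"
    using continuous_on_support_fun[of u] \<tau> e half_gt_zero[OF e] unfolding continuous_on_iff by meson
  define d' where "d' = min d (e / (2 * R))"
  have "0 < d'" using d e R by (simp add: d'_def)
  moreover have "dist (support_fun (A (fst q)) (snd q)) (support_fun (A (fst p)) (snd p)) < e"
    if q: "q \<in> F \<times> UNIV" "dist q p < d'" for q
  proof -
    obtain \<sigma> v where qe: "q = (\<sigma>, v)" by (cases q)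
    then have \<sigma>: "\<sigma> \<in> F" using q by auto
    have "dist \<sigma> \<tau> < d'" "dist v u < d'"
      using q(2) dist_fst_le[of q p] dist_snd_le[of q p] by (auto simp: pe qe)
    then have D: "dist \<sigma> \<tau> < d" "dist v u < e / (2 * R)" by (auto simp: d'_def)
    have "\<bar>support_fun (A \<sigma>) v - support_fun (A \<sigma>) u\<bar> \<le> R * norm (v - u)"
      using \<sigma> R by (intro support_fun_lipschitz body_parts) auto
    also have "\<dots> < e / 2" using D(2) R(1) by (simp add: dist_norm field_simps)
    finally show ?thesis using d(2)[OF \<sigma> D(1)] unfolding pe qe dist_real_def fst_conv snd_conv by linarith
  qed
  ultimately show "\<exists>d>0. \<forall>q\<in>F \<times> UNIV. dist q p < d \<longrightarrow>
      dist (support_fun (A (fst q)) (snd q)) (support_fun (A (fst p)) (snd p)) < e" by blast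
qed

text \<open>Compactness of \<open>F\<close> times the unit sphere gives a modulus that serves every
  unit direction, and homogeneity extends it to all \<open>u\<close>. The bound
  \<open>e * norm u\<close> is exactly the form that \<open>hausdorff_dist_le_of_support_fun\<close>
  consumes.\<close>

lemma uniformly_continuous_support_fun:
  assumes "0 < e"
  obtains d where "0 < d" "\<And>\<sigma> \<tau> u. \<sigma> \<in> F \<Longrightarrow> \<tau> \<in> F \<Longrightarrow> dist \<sigma> \<tau> < d \<Longrightarrow>
     \<bar>support_fun (A \<sigma>) u - support_fun (A \<tau>) u\<bar> \<le> e * norm u"
proof -
  have "uniformly_continuous_on (F \<times> sphere 0 1) (\<lambda>p. support_fun (A (fst p)) (snd p))"
    by (intro compact_uniformly_continuous compact_Times compact_F compact_sphere
        continuous_on_subset[OF continuous_on_support_fun_joint]) auto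
  then obtain d where d: "0 < d" "\<And>p q. p \<in> F \<times> sphere 0 1 \<Longrightarrow> q \<in> F \<times> sphere 0 1 \<Longrightarrow> dist q p < d \<Longrightarrow>
      dist (support_fun (A (fst q)) (snd q)) (support_fun (A (fst p)) (snd p)) < e"
    using assms unfolding uniformly_continuous_on_def by meson
  have "\<bar>support_fun (A \<sigma>) u - support_fun (A \<tau>) u\<bar> \<le> e * norm u"
    if "\<sigma> \<in> F" "\<tau> \<in> F" "dist \<sigma> \<tau> < d" for \<sigma> \<tau> u
  proof (cases "u = 0")
    case True
    then show ?thesis using support_fun_scaleR[of "A \<sigma>" 0 0] support_fun_scaleR[of "A \<tau>" 0 0] body_parts that by simp
  next
    case False
    define v where "v = u /\<^sub>R norm u"
    have v: "norm v = 1" "u = norm u *\<^sub>R v" using False by (auto simp: v_def)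
    have "dist (support_fun (A \<sigma>) v) (support_fun (A \<tau>) v) < e"
      using d(2)[of "(\<tau>, v)" "(\<sigma>, v)"] that v by (simp add: dist_Pair_Pair)
    then have "norm u * \<bar>support_fun (A \<sigma>) v - support_fun (A \<tau>) v\<bar> \<le> norm u * e"
      by (intro mult_left_mono) (auto simp: dist_real_def)
    also have "norm u * \<bar>support_fun (A \<sigma>) v - support_fun (A \<tau>) v\<bar>
        = \<bar>norm u * support_fun (A \<sigma>) v - norm u * support_fun (A \<tau>) v\<bar>"
      by (simp add: abs_mult flip: right_diff_distrib)
    also have "\<dots> = \<bar>support_fun (A \<sigma>) u - support_fun (A \<tau>) u\<bar>"
      using support_fun_scaleR[of "A \<sigma>" "norm u" v] support_fun_scaleR[of "A \<tau>" "norm u" v] body_parts that v(2) by simp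
    finally show ?thesis by (simp add: mult.commute)
  qed
  with d(1) show thesis by (rule that)
qed

end

locale body_family_measure = body_family F A + prob_space M
  for F :: "'a::euclidean_space set" and A :: "'a \<Rightarrow> 'b::euclidean_space set" and M :: "'a measure" +
  assumes sets_M: "sets M = sets (restrict_space borel F)"
begin

lemma space_M: "space M = F"
  using sets_eq_imp_space_eq[OF sets_M] by (simp add: space_restrict_space)

lemma measurable_continuous_on: "continuous_on F g \<Longrightarrow> (g :: 'a \<Rightarrow> real) \<in> borel_measurable M"
  using borel_measurable_continuous_on_restrict[of F g] by (simp add: measurable_cong_sets[OF sets_M refl])

lemma integrable_continuous_on:
  assumes "continuous_on F g" shows "integrable M (g :: 'a \<Rightarrow> real)"
proof -
  obtain B where "\<forall>\<tau>\<in>F. norm (g \<tau>) \<le> B"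
    using compact_imp_bounded[OF compact_continuous_image[OF assms compact_F]] by (auto simp: bounded_iff)
  then show ?thesis
    by (intro integrable_const_bound[of _ B] measurable_continuous_on assms AE_I2) (simp add: space_M)
qed

lemma integrable_support_fun: "integrable M (\<lambda>\<tau>. support_fun (A \<tau>) u)"
  by (intro integrable_continuous_on continuous_on_support_fun)

lemma riemann_sum_support_fun:
  assumes P: "finite P" "partition_on (space M) P" "P \<subseteq> sets M" "\<And>E. E \<in> P \<Longrightarrow> t E \<in> E"
  shows "convex_body (riemann_sum M A P t)"
    and "support_fun (riemann_sum M A P t) u = (\<Sum>E\<in>P. measure M E * support_fun (A (t E)) u)"
proof -
  have t: "t E \<in> F" if "E \<in> P" for E
    using P that partition_onD1[OF P(2)] by (auto simp: space_M)
  have *: "convex_body ((*\<^sub>R) (measure M E) ` A (t E))"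
    "support_fun ((*\<^sub>R) (measure M E) ` A (t E)) u = measure M E * support_fun (A (t E)) u" if "E \<in> P" for E
    using that by (auto intro!: convex_body_scale body t)
  have "convex_body (\<Sum>E\<in>P. (*\<^sub>R) (measure M E) ` A (t E)) \<and>
      support_fun (\<Sum>E\<in>P. (*\<^sub>R) (measure M E) ` A (t E)) u
        = (\<Sum>E\<in>P. support_fun ((*\<^sub>R) (measure M E) ` A (t E)) u)"
    by (rule convex_body_sum[OF P(1)]) (rule *(1))
  then show "convex_body (riemann_sum M A P t)"
    "support_fun (riemann_sum M A P t) u = (\<Sum>E\<in>P. measure M E * support_fun (A (t E)) u)"
    unfolding riemann_sum_def using *(2) by auto
qed

lemma riemann_sum_approx:
  assumes P: "finite P" "partition_on (space M) P" "P \<subseteq> sets M" "\<And>E. E \<in> P \<Longrightarrow> t E \<in> E"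
    and e: "\<And>E \<tau>. E \<in> P \<Longrightarrow> \<tau> \<in> E \<Longrightarrow> \<bar>support_fun (A \<tau>) u - support_fun (A (t E)) u\<bar> \<le> e"
  shows "\<bar>support_fun (riemann_sum M A P t) u - (\<integral>\<tau>. support_fun (A \<tau>) u \<partial>M)\<bar> \<le> e"
proof -
  \<comment> \<open>The step function that is constant on each cell, with the value at its tag. Its
    integral is the support function of the Riemann sum, so the claim becomes an estimate under one
    integral.\<close>
  define s where "s \<tau> = (\<Sum>E\<in>P. indicator E \<tau> * support_fun (A (t E)) u)" for \<tau>
  have fin: "E \<in> P \<Longrightarrow> E \<in> sets M" for E using P(3) by blast
  have int: "integrable M (\<lambda>\<tau>. indicator E \<tau> * support_fun (A (t E)) u)" if "E \<in> P" for E
    using fin[OF that] by (intro integrable_mult_left) (auto simp: emeasure_eq_measure)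
  have s_int: "integrable M s" unfolding s_def by (intro Bochner_Integration.integrable_sum int)
  have "(\<integral>\<tau>. s \<tau> \<partial>M) = (\<Sum>E\<in>P. \<integral>\<tau>. indicator E \<tau> * support_fun (A (t E)) u \<partial>M)"
    unfolding s_def by (intro Bochner_Integration.integral_sum int)
  also have "\<dots> = (\<Sum>E\<in>P. measure M E * support_fun (A (t E)) u)"
    by (intro sum.cong refl) (simp add: fin)
  also have "\<dots> = support_fun (riemann_sum M A P t) u"
    by (rule riemann_sum_support_fun(2)[where u = u, OF P, symmetric])
  finally have "(\<integral>\<tau>. s \<tau> \<partial>M) = support_fun (riemann_sum M A P t) u" .
  then have "\<bar>support_fun (riemann_sum M A P t) u - (\<integral>\<tau>. support_fun (A \<tau>) u \<partial>M)\<bar>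
      = \<bar>\<integral>\<tau>. s \<tau> - support_fun (A \<tau>) u \<partial>M\<bar>"
    by (simp add: s_int integrable_support_fun)
  also have "\<dots> \<le> (\<integral>\<tau>. \<bar>s \<tau> - support_fun (A \<tau>) u\<bar> \<partial>M)" by (rule integral_abs_bound)
  also have "\<dots> \<le> (\<integral>\<tau>. e \<partial>M)"
  proof (intro integral_mono)
    fix \<tau> assume "\<tau> \<in> space M"
    then obtain E where E: "E \<in> P" "\<tau> \<in> E" using partition_onD1[OF P(2)] by auto
    have "s \<tau> = (\<Sum>E'\<in>P. if E' = E then support_fun (A (t E)) u else 0)"
      unfolding s_def using E partition_onD2[OF P(2)]
      by (intro sum.cong) (auto simp: disjoint_def indicator_def)
    then have "s \<tau> = support_fun (A (t E)) u" using E P by simp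
    then show "\<bar>s \<tau> - support_fun (A \<tau>) u\<bar> \<le> e" using e[OF E] by (simp add: abs_minus_commute)
  qed (auto intro!: integrable_abs Bochner_Integration.integrable_diff s_int integrable_support_fun)
  also have "\<dots> = e" by (simp add: prob_space)
  finally show ?thesis .
qed

text \<open>Reconciles the Riemann-sum definition with the one by support functions. The body with
  the averaged support function is a limit of the Riemann sums, by uniform continuity, and the only
  one; all later arguments can then work with support functions alone.\<close>

theorem minkowski_integral_support_fun:
  "convex_body (minkowski_integral M A)"
  "support_fun (minkowski_integral M A) u = (\<integral>\<tau>. support_fun (A \<tau>) u \<partial>M)"
proof -
  obtain K where K: "convex_body K" "\<And>u. support_fun K u = (\<integral>\<tau>. support_fun (A \<tau>) u \<partial>M)"
  proof (rule sublinear_imp_support_fun)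
    show "(\<integral>\<tau>. support_fun (A \<tau>) (u + v) \<partial>M) \<le> (\<integral>\<tau>. support_fun (A \<tau>) u \<partial>M) + (\<integral>\<tau>. support_fun (A \<tau>) v \<partial>M)" for u v
    proof -
      have "(\<integral>\<tau>. support_fun (A \<tau>) (u + v) \<partial>M) \<le> (\<integral>\<tau>. support_fun (A \<tau>) u + support_fun (A \<tau>) v \<partial>M)"
        by (intro integral_mono integrable_support_fun Bochner_Integration.integrable_add support_fun_add_le body_parts)
          (auto simp: space_M)
      then show ?thesis by (simp add: integrable_support_fun)
    qed
    show "(\<integral>\<tau>. support_fun (A \<tau>) (c *\<^sub>R u) \<partial>M) = c * (\<integral>\<tau>. support_fun (A \<tau>) u \<partial>M)" if "0 \<le> c" for c u
    proof -
      have "(\<integral>\<tau>. support_fun (A \<tau>) (c *\<^sub>R u) \<partial>M) = (\<integral>\<tau>. c * support_fun (A \<tau>) u \<partial>M)"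
        using that by (intro Bochner_Integration.integral_cong refl support_fun_scaleR body_parts) (auto simp: space_M)
      then show ?thesis by simp
    qed
  qed blast
  have K': "compact K" "K \<noteq> {}" using K by (auto simp: convex_body_def)
  define mesh where "mesh d P t \<longleftrightarrow> finite P \<and> partition_on (space M) P \<and> P \<subseteq> sets M \<and>
        (\<forall>E\<in>P. t E \<in> E \<and> (\<forall>x\<in>E. \<forall>y\<in>E. dist x y < d))" for d P t
  have hmi_iff: "has_minkowski_integral M A L \<longleftrightarrow> L \<noteq> {} \<and> compact L \<and>
      (\<forall>e>0. \<exists>d>0. \<forall>P t. mesh d P t \<longrightarrow> hausdorff_dist (riemann_sum M A P t) L < e)" for L
    by (simp add: has_minkowski_integral_def mesh_def)
  have hmi: "has_minkowski_integral M A K"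
    unfolding hmi_iff
  proof (intro conjI allI impI K')
    fix e :: real assume "0 < e"
    then have "0 < e/2" by simp
    then obtain d where d: "0 < d" "\<And>\<sigma> \<tau> u. \<sigma> \<in> F \<Longrightarrow> \<tau> \<in> F \<Longrightarrow> dist \<sigma> \<tau> < d \<Longrightarrow>
       \<bar>support_fun (A \<sigma>) u - support_fun (A \<tau>) u\<bar> \<le> e/2 * norm u"
      by (rule uniformly_continuous_support_fun) blast
    have "hausdorff_dist (riemann_sum M A P t) K < e"
      if "mesh d P t" for P t
    proof -
      have P: "finite P \<and> partition_on (space M) P \<and> P \<subseteq> sets M \<and>
        (\<forall>E\<in>P. t E \<in> E \<and> (\<forall>x\<in>E. \<forall>y\<in>E. dist x y < d))"
        using that by (simp add: mesh_def)
      have P': "finite P" "partition_on (space M) P" "P \<subseteq> sets M" "\<And>E. E \<in> P \<Longrightarrow> t E \<in> E" using P by auto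
      have sub: "E \<subseteq> F" if "E \<in> P" for E using that partition_onD1[OF P'(2)] by (auto simp: space_M)
      have "hausdorff_dist (riemann_sum M A P t) K \<le> e/2"
      proof (intro hausdorff_dist_le_of_support_fun riemann_sum_support_fun(1) P' K(1))
        show "\<bar>support_fun (riemann_sum M A P t) u - support_fun K u\<bar> \<le> e/2 * norm u" for u
          unfolding K(2)
        proof (intro riemann_sum_approx P')
          fix E \<tau> assume E: "E \<in> P" "\<tau> \<in> E"
          then show "\<bar>support_fun (A \<tau>) u - support_fun (A (t E)) u\<bar> \<le> e/2 * norm u"
            using sub[OF E(1)] P'(4)[OF E(1)] P by (intro d(2)) blast+
        qed
      qed (use \<open>0 < e\<close> in auto)
      then show ?thesis using \<open>0 < e\<close> by linarith
    qed
    then show "\<exists>d>0. \<forall>P t. mesh d P t \<longrightarrow> hausdorff_dist (riemann_sum M A P t) K < e"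
      using d(1) by blast
  qed
  have "L = K" if L: "has_minkowski_integral M A L" for L
  proof (rule hausdorff_limit_unique)
    show "compact L" "L \<noteq> {}" using L by (auto simp: hmi_iff)
    fix e :: real assume "0 < e"
    obtain d1 where d1: "0 < d1" "\<And>P t. mesh d1 P t \<Longrightarrow> hausdorff_dist (riemann_sum M A P t) L < e"
      using L \<open>0 < e\<close> unfolding hmi_iff by blast
    obtain d2 where d2: "0 < d2" "\<And>P t. mesh d2 P t \<Longrightarrow> hausdorff_dist (riemann_sum M A P t) K < e"
      using hmi \<open>0 < e\<close> unfolding hmi_iff by blast
    \<comment> \<open>A partition fine enough for both limits yields a single Riemann sum close to
      \<open>L\<close> and to \<open>K\<close>.\<close>
    have "0 < min d1 d2" using d1 d2 by simp
    with compact_F obtain P where P: "finite P" "partition_on F P" "P \<subseteq> sets (restrict_space borel F)"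
      "\<And>E x y. E \<in> P \<Longrightarrow> x \<in> E \<Longrightarrow> y \<in> E \<Longrightarrow> dist x y < min d1 d2"
      by (rule fine_borel_partition) blast
    define t where "t E = (SOME x. x \<in> E)" for E :: "'a set"
    have t: "t E \<in> E" if "E \<in> P" for E
    proof -
      have "E \<noteq> {}" using that partition_onD3[OF P(2)] by auto
      then show ?thesis unfolding t_def by (simp add: some_in_eq)
    qed
    have P': "finite P" "partition_on (space M) P" "P \<subseteq> sets M" using P by (auto simp: space_M sets_M)
    let ?S = "riemann_sum M A P t"
    have "convex_body ?S" by (intro riemann_sum_support_fun(1) P' t)
    moreover have "mesh d1 P t" "mesh d2 P t" unfolding mesh_def using P(4)
      by (intro conjI P' ballI t; simp)+
    then have "hausdorff_dist ?S L < e" "hausdorff_dist ?S K < e" by (auto intro: d1(2) d2(2))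
    ultimately show "\<exists>S. compact S \<and> S \<noteq> {} \<and> hausdorff_dist S L < e \<and> hausdorff_dist S K < e"
      by (auto simp: convex_body_def)
  qed (use K' in auto)
  then have "minkowski_integral M A = K" unfolding minkowski_integral_def using hmi by (intro the_equality)
  then show "convex_body (minkowski_integral M A)"
    "support_fun (minkowski_integral M A) u = (\<integral>\<tau>. support_fun (A \<tau>) u \<partial>M)" using K by auto
qed

end

section \<open>Smoothed volume\<close>

text \<open>The squared distance to a convex body is convex, so this cutoff is concave where it is
  positive, as Prekopa-Leindler requires. It is 1 on the body, and away from it vanishes once
  \<open>\<beta>\<close> is large.\<close>

definition bump :: "real \<Rightarrow> 'a::euclidean_space set \<Rightarrow> 'a \<Rightarrow> real" where
  "bump \<beta> K z = max 0 (1 - \<beta> * (infdist z K)\<^sup>2)"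

text \<open>The square makes the truncation at 0 continuously differentiable with a quadratic
  remainder; the bare positive part has a corner.\<close>

definition smooth_vol :: "real \<Rightarrow> 'a::euclidean_space set \<Rightarrow> real" where
  "smooth_vol \<beta> K = (\<integral>z. (bump \<beta> K z)\<^sup>2 \<partial>lborel)"

text \<open>Half the gradient of the squared distance to a convex body, hence the direction in which
  support functions enter the first variation.\<close>

definition offset :: "'a::euclidean_space set \<Rightarrow> 'a \<Rightarrow> 'a" where
  "offset K z = z - closest_point K z"

lemma bump_nonneg: "0 \<le> bump \<beta> K z" by (simp add: bump_def)

lemma bump_le_1: "0 \<le> \<beta> \<Longrightarrow> bump \<beta> K z \<le> 1" by (simp add: bump_def)

lemma bump_in: "z \<in> K \<Longrightarrow> bump \<beta> K z = 1" by (simp add: bump_def)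

lemma continuous_on_bump [continuous_intros]: "continuous_on S (bump \<beta> K)"
  unfolding bump_def by (intro continuous_intros)

text \<open>With \<open>\<beta>\<close> at least 1 the cutoff dies within distance 1 of the body, so
  one ball contains the supports for all such \<open>\<beta>\<close>. This gives the integrable
  majorant for the limit of large \<open>\<beta>\<close>.\<close>

lemma bump_zero_outside:
  assumes "convex_body K" "\<And>z. z \<in> K \<Longrightarrow> norm z \<le> R" "1 \<le> \<beta>" "z \<notin> cball 0 (R + 1)"
  shows "bump \<beta> K z = 0"
proof -
  have K: "closed K" "K \<noteq> {}" using assms by (auto simp: convex_body_def compact_imp_closed)
  obtain k where k: "k \<in> K" "infdist z K = dist z k" using infdist_attains_inf[OF K] by blast
  have "norm z \<le> norm k + norm (z - k)" using norm_triangle_sub[of z k] by simp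
  then have "1 \<le> infdist z K" using assms(2)[OF k(1)] assms(4) k by (simp add: dist_norm)
  then have "1 * 1 \<le> \<beta> * (infdist z K)\<^sup>2" using assms(3) by (intro mult_mono) auto
  then show ?thesis by (simp add: bump_def)
qed

lemma integrable_compact_support:
  fixes f :: "'a::euclidean_space \<Rightarrow> real"
  assumes "continuous_on UNIV f" "\<And>z. z \<notin> cball 0 r \<Longrightarrow> f z = 0"
  shows "integrable lborel f"
proof -
  have "integrable lborel (\<lambda>z. indicator (cball 0 r) z *\<^sub>R f z)"
    by (intro borel_integrable_compact compact_cball continuous_on_subset[OF assms(1)]) auto
  also have "(\<lambda>z. indicator (cball 0 r) z *\<^sub>R f z) = f"
    using assms(2) by (intro ext) (auto simp: indicator_def)
  finally show ?thesis .
qed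

lemma convex_body_norm_bound:
  fixes K L :: "'a::euclidean_space set"
  assumes "convex_body K" "convex_body L"
  obtains R where "0 < R" "\<And>z. z \<in> K \<Longrightarrow> norm z \<le> R" "\<And>z. z \<in> L \<Longrightarrow> norm z \<le> R"
proof -
  have "bounded (K \<union> L)" using assms by (auto simp: convex_body_def compact_imp_bounded)
  then show thesis using that unfolding bounded_pos by auto
qed

lemma integrable_bump_mult:
  assumes K: "convex_body K" "1 \<le> \<beta>" and g: "continuous_on UNIV g"
  shows "integrable lborel (\<lambda>z. bump \<beta> K z * g z)"
proof -
  obtain R where R: "\<And>z. z \<in> K \<Longrightarrow> norm z \<le> R" using convex_body_norm_bound[OF K(1,1)] by metis
  show ?thesis
  proof (rule integrable_compact_support)
    show "continuous_on UNIV (\<lambda>z. bump \<beta> K z * g z)" by (intro continuous_on_mult continuous_on_bump g)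
    show "bump \<beta> K z * g z = 0" if "z \<notin> cball 0 (R + 1)" for z
      using bump_zero_outside[OF K(1) R K(2) that] by simp
  qed
qed

lemma integrable_bump_square:
  assumes K: "convex_body K" "1 \<le> \<beta>"
  shows "integrable lborel (\<lambda>z. (bump \<beta> K z)\<^sup>2)"
  using integrable_bump_mult[OF K continuous_on_bump] by (simp add: power2_eq_square)

lemma measure_le_smooth_vol:
  assumes K: "convex_body K" "1 \<le> \<beta>"
  shows "measure lborel K \<le> smooth_vol \<beta> K"
proof -
  have "compact K" using K by (simp add: convex_body_def)
  then have "measure lborel K = (\<integral>z. indicator K z \<partial>lborel)" by simp
  also have "\<dots> \<le> smooth_vol \<beta> K" unfolding smooth_vol_def
  proof (intro integral_mono integrable_bump_square K integrable_real_indicator)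
    show "K \<in> sets lborel" using \<open>compact K\<close> by (simp add: compact_imp_closed)
    show "emeasure lborel K < \<infinity>" using emeasure_compact_finite[OF \<open>compact K\<close>] by simp
    show "indicator K z \<le> (bump \<beta> K z)\<^sup>2" for z by (auto simp: indicator_def bump_in)
  qed
  finally show ?thesis .
qed

text \<open>Degenerate bodies are included, because a small ball around any point of
  \<open>K\<close> contributes. Hence logarithms of smoothed volumes and division by them are safe
  throughout.\<close>

lemma smooth_vol_pos:
  assumes K: "convex_body K" "1 \<le> \<beta>"
  shows "0 < smooth_vol \<beta> K"
proof -
  obtain k where k: "k \<in> K" using K by (auto simp: convex_body_def)
  \<comment> \<open>Chosen so that \<open>\<beta> * d^2 = 1/2\<close>: the cutoff is then at least
    1/2 on the ball, and its square at least 1/4.\<close>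
  define d where "d = 1 / sqrt (2 * \<beta>)"
  have d: "0 < d" "\<beta> * d\<^sup>2 = 1/2" using K by (auto simp: d_def power_divide)
  have "measure lborel (ball k d) * (1/4) = (\<integral>z. indicator (ball k d) z * (1/4) \<partial>lborel)"
    by simp
  also have "\<dots> \<le> smooth_vol \<beta> K" unfolding smooth_vol_def
  proof (intro integral_mono integrable_bump_square K)
    fix z
    show "indicator (ball k d) z * (1/4) \<le> (bump \<beta> K z)\<^sup>2"
    proof (cases "z \<in> ball k d")
      case True
      then have "infdist z K \<le> d" using infdist_le[OF k, of z] by (auto simp: dist_commute)
      then have "\<beta> * (infdist z K)\<^sup>2 \<le> \<beta> * d\<^sup>2" using K infdist_nonneg[of z K] by (intro mult_left_mono power_mono) auto
      then have "1/2 \<le> bump \<beta> K z" using d by (simp add: bump_def)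
      then have "(1/2)\<^sup>2 \<le> (bump \<beta> K z)\<^sup>2" by (intro power_mono) auto
      moreover have "indicator (ball k d) z = (1::real)" using True by (rule indicator_simps)
      ultimately show ?thesis by (simp add: power2_eq_square)
    qed simp
  qed (use emeasure_lborel_ball_finite[of k d] in auto)
  finally have "measure lborel (ball k d) * (1/4) \<le> smooth_vol \<beta> K" .
  moreover have "0 < measure lborel (ball k d)" using d content_ball_pos[of d k] by simp
  ultimately show ?thesis by linarith
qed

lemma smooth_vol_tendsto:
  assumes K: "convex_body K"
  shows "(\<lambda>n. smooth_vol (real (Suc n)) K) \<longlonglongrightarrow> measure lborel K"
proof -
  have cK: "compact K" "K \<noteq> {}" using K by (auto simp: convex_body_def)
  obtain R where R: "\<And>z. z \<in> K \<Longrightarrow> norm z \<le> R" using convex_body_norm_bound[OF K K] by metis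
  have "(\<lambda>n. \<integral>z. (bump (real (Suc n)) K z)\<^sup>2 \<partial>lborel) \<longlonglongrightarrow> (\<integral>z. indicator K z \<partial>lborel)"
  proof (rule integral_dominated_convergence[where w = "indicator (cball 0 (R + 1))"])
    show "indicator K \<in> borel_measurable lborel" using cK by (auto simp: compact_imp_closed)
    show "(\<lambda>z. (bump (real (Suc n)) K z)\<^sup>2) \<in> borel_measurable lborel" for n
      using integrable_bump_square[OF K, of "real (Suc n)"] by auto
    show "integrable lborel (indicator (cball 0 (R + 1)) :: 'a \<Rightarrow> real)"
      using emeasure_lborel_cball_finite[of "0::'a" "R + 1"] by auto
    show "AE z in lborel. (\<lambda>n. (bump (real (Suc n)) K z)\<^sup>2) \<longlonglongrightarrow> indicator K z"
    proof (intro AE_I2)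
      fix z
      show "(\<lambda>n. (bump (real (Suc n)) K z)\<^sup>2) \<longlonglongrightarrow> indicator K z"
      proof (cases "z \<in> K")
        case False
        then have "infdist z K \<noteq> 0" using cK by (simp add: in_closed_iff_infdist_zero[symmetric] compact_imp_closed)
        then have p: "0 < (infdist z K)\<^sup>2" by simp
        obtain N where N: "1 / (infdist z K)\<^sup>2 < real N" using reals_Archimedean2 by blast
        have "(bump (real (Suc n)) K z)\<^sup>2 = 0" if "N \<le> n" for n
        proof -
          have "1 \<le> real N * (infdist z K)\<^sup>2" using N p by (simp add: pos_divide_less_eq)
          also have "\<dots> \<le> real (Suc n) * (infdist z K)\<^sup>2" using that by (intro mult_right_mono) auto
          finally show ?thesis by (simp add: bump_def)
        qed
        then have "\<forall>\<^sub>F n in sequentially. (bump (real (Suc n)) K z)\<^sup>2 = 0"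
          unfolding eventually_sequentially by blast
        then show ?thesis using False by (simp add: tendsto_eventually)
      qed (simp add: bump_in)
    qed
    show "AE z in lborel. norm ((bump (real (Suc n)) K z)\<^sup>2) \<le> indicator (cball 0 (R + 1)) z" for n
    proof (intro AE_I2)
      fix z
      have "(bump (real (Suc n)) K z)\<^sup>2 \<le> 1"
        using bump_nonneg bump_le_1[of "real (Suc n)" K z] by (intro power_le_one) auto
      then show "norm ((bump (real (Suc n)) K z)\<^sup>2) \<le> indicator (cball 0 (R + 1)) z"
        using bump_zero_outside[OF K R, of "real (Suc n)" z] by (cases "z \<in> cball 0 (R + 1)") auto
    qed
  qed
  then show ?thesis using cK by (simp add: smooth_vol_def)
qed

text \<open>The midpoint of the points of \<open>A\<close> and \<open>B\<close> closest to
  \<open>x\<close> and \<open>y\<close> lies in \<open>C\<close>, which makes the squared distance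
  midpoint convex. So the cutoff at the midpoint dominates the arithmetic mean where both factors
  are positive, and AM-GM gives the product; otherwise the product is 0.\<close>

lemma bump_midpoint:
  assumes AB: "convex_body A" "convex_body B" and \<beta>: "0 \<le> \<beta>"
    and C: "\<And>a b. a \<in> A \<Longrightarrow> b \<in> B \<Longrightarrow> (1/2) *\<^sub>R (a + b) \<in> C"
  shows "bump \<beta> A x * bump \<beta> B y \<le> (bump \<beta> C ((1/2) *\<^sub>R (x + y)))\<^sup>2"
proof (cases "bump \<beta> A x = 0 \<or> bump \<beta> B y = 0")
  case False
  obtain a where a: "a \<in> A" "infdist x A = dist x a"
    using infdist_attains_inf[of A x] AB by (auto simp: convex_body_def compact_imp_closed)
  obtain b where b: "b \<in> B" "infdist y B = dist y b"
    using infdist_attains_inf[of B y] AB by (auto simp: convex_body_def compact_imp_closed)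
  let ?m = "(1/2) *\<^sub>R (x + y)"
  define s t where "s = infdist x A" and "t = infdist y B"
  have "infdist ?m C \<le> dist ?m ((1/2) *\<^sub>R (a + b))" by (intro infdist_le C a b)
  also have "\<dots> = norm ((1/2) *\<^sub>R ((x - a) + (y - b)))" by (simp add: dist_norm algebra_simps)
  also have "\<dots> \<le> (s + t) / 2"
    using norm_triangle_ineq[of "x - a" "y - b"] a b by (simp add: s_def t_def dist_norm)
  finally have "(infdist ?m C)\<^sup>2 \<le> ((s + t) / 2)\<^sup>2" by (intro power_mono infdist_nonneg)
  also have "\<dots> \<le> (s\<^sup>2 + t\<^sup>2) / 2"
    using zero_le_power2[of "s - t"] by (simp add: power2_eq_square field_simps)
  finally have "\<beta> * (infdist ?m C)\<^sup>2 \<le> \<beta> * ((s\<^sup>2 + t\<^sup>2) / 2)" using \<beta> by (rule mult_left_mono)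
  moreover have p: "bump \<beta> A x = 1 - \<beta> * s\<^sup>2" "bump \<beta> B y = 1 - \<beta> * t\<^sup>2"
    using False by (auto simp: bump_def s_def t_def max_def split: if_splits)
  moreover have "\<beta> * ((s\<^sup>2 + t\<^sup>2) / 2) = (\<beta> * s\<^sup>2 + \<beta> * t\<^sup>2) / 2" by (simp add: distrib_left)
  ultimately have "(bump \<beta> A x + bump \<beta> B y) / 2 \<le> 1 - \<beta> * (infdist ?m C)\<^sup>2" by argo
  then have "(bump \<beta> A x + bump \<beta> B y) / 2 \<le> bump \<beta> C ?m" unfolding bump_def[of _ C] by (rule max.coboundedI2)
  then have "((bump \<beta> A x + bump \<beta> B y) / 2)\<^sup>2 \<le> (bump \<beta> C ?m)\<^sup>2"
    by (intro power_mono) (auto simp: bump_nonneg add_nonneg_nonneg)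
  moreover have "bump \<beta> A x * bump \<beta> B y \<le> ((bump \<beta> A x + bump \<beta> B y) / 2)\<^sup>2"
    using zero_le_power2[of "bump \<beta> A x - bump \<beta> B y"] by (simp add: power2_eq_square field_simps)
  ultimately show ?thesis by linarith
qed auto

lemma smooth_vol_midpoint:
  assumes A: "convex_body A" and B: "convex_body B" and C: "convex_body C" and \<beta>: "1 \<le> \<beta>"
    and mid: "\<And>a b. a \<in> A \<Longrightarrow> b \<in> B \<Longrightarrow> (1/2) *\<^sub>R (a + b) \<in> C"
  shows "smooth_vol \<beta> A * smooth_vol \<beta> B \<le> (smooth_vol \<beta> C)\<^sup>2"
proof -
  have eq: "(\<integral>\<^sup>+z. ennreal ((bump \<beta> K z)\<^sup>2) \<partial>lborel) = ennreal (smooth_vol \<beta> K)" if "convex_body K" for K :: "'a set"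
    unfolding smooth_vol_def using integrable_bump_square[OF that \<beta>] by (intro nn_integral_eq_integral) auto
  have [measurable]: "bump \<beta> K \<in> borel_measurable borel" for K :: "'a set"
    by (intro borel_measurable_continuous_onI continuous_on_bump)
  have "(\<integral>\<^sup>+z. ennreal ((bump \<beta> A z)\<^sup>2) \<partial>lborel) * (\<integral>\<^sup>+z. ennreal ((bump \<beta> B z)\<^sup>2) \<partial>lborel)
      \<le> (\<integral>\<^sup>+z. ennreal ((bump \<beta> C z)\<^sup>2) \<partial>lborel)\<^sup>2"
  proof (rule prekopa_leindler_midpoint)
    fix x y
    have "(bump \<beta> A x * bump \<beta> B y)\<^sup>2 \<le> ((bump \<beta> C ((1/2) *\<^sub>R (x + y)))\<^sup>2)\<^sup>2"
      using bump_midpoint[OF A B _ mid, of \<beta>] \<beta> by (intro power_mono mult_nonneg_nonneg bump_nonneg) auto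
    then show "ennreal ((bump \<beta> A x)\<^sup>2) * ennreal ((bump \<beta> B y)\<^sup>2)
        \<le> (ennreal ((bump \<beta> C ((1/2) *\<^sub>R (x + y)))\<^sup>2))\<^sup>2"
      by (simp add: ennreal_power power_mult_distrib ennreal_leI flip: ennreal_mult)
  qed measurable
  then show ?thesis
    unfolding eq[OF A] eq[OF B] eq[OF C] using smooth_vol_pos[OF A \<beta>] smooth_vol_pos[OF B \<beta>] smooth_vol_pos[OF C \<beta>]
    by (simp add: ennreal_power ennreal_le_iff flip: ennreal_mult)
qed

section \<open>First variation of the smoothed volume and the tangent bound\<close>

lemma continuous_on_offset:
  assumes "convex_body K"
  shows "continuous_on S (offset K)"
proof -
  have "continuous_on S (\<lambda>z. z - closest_point K z)"
    using assms
    by (intro continuous_on_diff continuous_on_id continuous_on_closest_point)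
      (auto simp: convex_body_def compact_imp_closed)
  then show ?thesis by (simp add: offset_def[abs_def])
qed

lemma continuous_on_support_fun_vec:
  assumes "convex_body K"
  shows "continuous_on S (support_fun K)"
proof -
  obtain R where R: "0 < R" "\<And>z. z \<in> K \<Longrightarrow> norm z \<le> R" using convex_body_norm_bound[OF assms assms] by metis
  have "R-lipschitz_on S (support_fun K)"
    using assms R by (intro lipschitz_onI) (auto simp: dist_norm convex_body_def intro!: support_fun_lipschitz)
  then show ?thesis by (rule lipschitz_on_continuous_on)
qed

lemma infdist_eq_norm_offset:
  assumes "convex_body K" shows "infdist z K = norm (offset K z)"
proof -
  have K: "closed K" "K \<noteq> {}" using assms by (auto simp: convex_body_def compact_imp_closed)
  obtain k where k: "k \<in> K" "infdist z K = dist z k" using infdist_attains_inf[OF K] by blast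
  have "dist z (closest_point K z) \<le> dist z k" by (rule closest_point_le[OF K(1) k(1)])
  moreover have "infdist z K \<le> dist z (closest_point K z)" by (intro infdist_le closest_point_in_set K)
  ultimately show ?thesis using k by (simp add: offset_def dist_norm)
qed

text \<open>With \<open>w = offset K z\<close> and \<open>l\<close> the point of \<open>L\<close>
  nearest to \<open>z\<close>, expand \<open>|(z - l) - w|^2 \<ge> 0\<close> and use that
  \<open>z \<bullet> w\<close> is \<open>|w|^2\<close> plus the support function of \<open>K\<close>
  at \<open>w\<close>. The resulting first-order lower bound is exact for \<open>L = K\<close> and
  has no error term.\<close>

lemma infdist_square_ge:
  assumes K: "convex_body K" and L: "convex_body L"
  shows "(infdist z K)\<^sup>2 + 2 * (support_fun K (offset K z) - support_fun L (offset K z)) \<le> (infdist z L)\<^sup>2"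
proof -
  let ?w = "offset K z"
  obtain l where l: "l \<in> L" "infdist z L = dist z l"
    using infdist_attains_inf[of L z] L by (auto simp: convex_body_def compact_imp_closed)
  have 1: "z \<bullet> ?w = ?w \<bullet> ?w + support_fun K ?w"
    using support_fun_closest_point[OF K, of z] by (simp add: offset_def inner_diff_left)
  have 2: "l \<bullet> ?w \<le> support_fun L ?w" using l L by (intro support_fun_ge) (auto simp: convex_body_def)
  have "0 \<le> ((z - l) - ?w) \<bullet> ((z - l) - ?w)" by simp
  also have "\<dots> = (z - l) \<bullet> (z - l) - 2 * ((z - l) \<bullet> ?w) + ?w \<bullet> ?w"
    by (simp only: inner_diff_left inner_diff_right) (simp add: inner_commute[of ?w z] inner_commute[of ?w l] algebra_simps)
  finally have "2 * (z \<bullet> ?w - l \<bullet> ?w) \<le> (z - l) \<bullet> (z - l) + ?w \<bullet> ?w"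
    by (simp add: inner_diff_left)
  then have "?w \<bullet> ?w + 2 * (support_fun K ?w - support_fun L ?w) \<le> (z - l) \<bullet> (z - l)"
    using 1 2 by argo
  then show ?thesis
    using l by (simp add: infdist_eq_norm_offset[OF K] dist_norm power2_norm_eq_inner)
qed

text \<open>The squared positive part has a derivative with Lipschitz constant 2, so its first-order
  expansion has the global remainder \<open>x^2\<close>.\<close>

lemma max_0_add_square_le: "(max 0 (a + x))\<^sup>2 \<le> (max 0 a)\<^sup>2 + 2 * (max 0 a) * x + (x::real)\<^sup>2"
proof (cases "0 \<le> a")
  case True
  then have "(max 0 a)\<^sup>2 + 2 * (max 0 a) * x + x\<^sup>2 = (a + x)\<^sup>2" by (simp add: power2_eq_square algebra_simps)
  then show ?thesis by (simp add: max_def)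
next
  case False
  then have "max 0 (a + x) \<le> \<bar>x\<bar>" by auto
  then have "(max 0 (a + x))\<^sup>2 \<le> \<bar>x\<bar>\<^sup>2" by (intro power_mono) auto
  then show ?thesis using False by (simp add: max_def)
qed

lemma bump_square_le:
  assumes K: "convex_body K" and L: "convex_body L" and \<beta>: "0 \<le> \<beta>"
    and x: "x = 2 * \<beta> * (support_fun L (offset K z) - support_fun K (offset K z))"
  shows "(bump \<beta> L z)\<^sup>2 \<le> (bump \<beta> K z)\<^sup>2 + 2 * bump \<beta> K z * x + x\<^sup>2"
proof -
  have "\<beta> * ((infdist z K)\<^sup>2 + 2 * (support_fun K (offset K z) - support_fun L (offset K z))) \<le> \<beta> * (infdist z L)\<^sup>2"
    using infdist_square_ge[OF K L] \<beta> by (rule mult_left_mono)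
  then have "bump \<beta> L z \<le> max 0 ((1 - \<beta> * (infdist z K)\<^sup>2) + x)"
    unfolding bump_def x by (intro max.mono) (auto simp: algebra_simps)
  then have "(bump \<beta> L z)\<^sup>2 \<le> (max 0 ((1 - \<beta> * (infdist z K)\<^sup>2) + x))\<^sup>2"
    by (intro power_mono bump_nonneg)
  also have "\<dots> \<le> (bump \<beta> K z)\<^sup>2 + 2 * bump \<beta> K z * x + x\<^sup>2"
    unfolding bump_def by (rule max_0_add_square_le)
  finally show ?thesis .
qed

text \<open>The first-order expansion of \<open>ln (smooth_vol \<beta> L)\<close> at
  \<open>L = K\<close>. The factor \<open>4 * \<beta>\<close> is 2 from the square of the cutoff
  times \<open>2 * \<beta>\<close> from the variation of \<open>\<beta>\<close> times the squared
  distance; the denominator comes from the logarithm.\<close>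

definition log_tangent :: "real \<Rightarrow> 'a::euclidean_space set \<Rightarrow> 'a set \<Rightarrow> real" where
  "log_tangent \<beta> K L = ln (smooth_vol \<beta> K) + 4 * \<beta> / smooth_vol \<beta> K *
     (\<integral>z. bump \<beta> K z * (support_fun L (offset K z) - support_fun K (offset K z)) \<partial>lborel)"

lemma log_tangent_self: "log_tangent \<beta> K K = ln (smooth_vol \<beta> K)"
  by (simp add: log_tangent_def)

text \<open>The pointwise remainder need not be integrable over the whole space, but outside
  \<open>cball 0 (R + 1)\<close> both cutoffs vanish and it may be cut off there. The factor
  \<open>s\<close> is kept apart so that bodies approaching \<open>K\<close> share the same
  \<open>g\<close> and the same two integrals.\<close>

lemma smooth_vol_taylor_le:
  assumes K: "convex_body K" and L: "convex_body L" and \<beta>: "1 \<le> \<beta>"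
    and R: "\<And>z. z \<in> K \<Longrightarrow> norm z \<le> R" "\<And>z. z \<in> L \<Longrightarrow> norm z \<le> R"
    and g: "continuous_on UNIV g"
    and s: "\<And>z. support_fun L (offset K z) - support_fun K (offset K z) = s * g z"
  shows "smooth_vol \<beta> L \<le> smooth_vol \<beta> K + s * (4 * \<beta> * (\<integral>z. bump \<beta> K z * g z \<partial>lborel))
     + s\<^sup>2 * (4 * \<beta>\<^sup>2 * (\<integral>z. indicator (cball 0 (R + 1)) z * (g z)\<^sup>2 \<partial>lborel))"
proof -
  have "integrable lborel (\<lambda>z. indicator (cball 0 (R + 1)) z *\<^sub>R (g z)\<^sup>2)"
    by (intro borel_integrable_compact compact_cball continuous_intros continuous_on_subset[OF g]) auto
  then have ig: "integrable lborel (\<lambda>z. indicator (cball 0 (R + 1)) z * (g z)\<^sup>2)" by simp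
  note i = integrable_bump_square[OF K \<beta>] integrable_bump_mult[OF K \<beta> g] ig
  have "smooth_vol \<beta> L \<le> (\<integral>z. (bump \<beta> K z)\<^sup>2 + (s * (4 * \<beta>)) * (bump \<beta> K z * g z)
      + (s\<^sup>2 * (4 * \<beta>\<^sup>2)) * (indicator (cball 0 (R + 1)) z * (g z)\<^sup>2) \<partial>lborel)"
    unfolding smooth_vol_def
  proof (intro integral_mono integrable_bump_square L \<beta> Bochner_Integration.integrable_add integrable_mult_right i K)
    fix z
    show "(bump \<beta> L z)\<^sup>2 \<le> (bump \<beta> K z)\<^sup>2 + (s * (4 * \<beta>)) * (bump \<beta> K z * g z)
      + (s\<^sup>2 * (4 * \<beta>\<^sup>2)) * (indicator (cball 0 (R + 1)) z * (g z)\<^sup>2)"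
    proof (cases "z \<in> cball 0 (R + 1)")
      case True
      then show ?thesis
        using bump_square_le[OF K L, of \<beta> _ z, OF _ refl] \<beta> unfolding s
        by (simp add: power_mult_distrib algebra_simps)
    next
      case False
      then show ?thesis using bump_zero_outside[OF K R(1) \<beta> False] bump_zero_outside[OF L R(2) \<beta> False] by simp
    qed
  qed
  also have "\<dots> = smooth_vol \<beta> K + s * (4 * \<beta> * (\<integral>z. bump \<beta> K z * g z \<partial>lborel))
     + s\<^sup>2 * (4 * \<beta>\<^sup>2 * (\<integral>z. indicator (cball 0 (R + 1)) z * (g z)\<^sup>2 \<partial>lborel))"
  proof -
    have lin: "(\<integral>z. f z + a * p z + b * q z \<partial>lborel)
        = (\<integral>z. f z \<partial>lborel) + a * (\<integral>z. p z \<partial>lborel) + b * (\<integral>z. q z \<partial>lborel)"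
      if "integrable lborel f" "integrable lborel p" "integrable lborel q" for a b and f p q :: "'a \<Rightarrow> real"
      using that by simp
    show ?thesis unfolding lin[OF i] smooth_vol_def by (simp only: mult.assoc)
  qed
  finally show ?thesis .
qed

text \<open>Along the bodies \<open>(1 - 2\<^sup>-\<^sup>k) K + 2\<^sup>-\<^sup>k L\<close> the midpoint inequality bounds
  \<open>ln (vol L / vol K)\<close> by \<open>2\<^sup>k\<close> times the logarithm of the ratio at stage \<open>k\<close>, and the first-order
  expansion at \<open>K\<close> evaluates the limit.\<close>

theorem ln_smooth_vol_le_log_tangent:
  assumes K: "convex_body K" and L: "convex_body L" and \<beta>: "1 \<le> \<beta>"
  shows "ln (smooth_vol \<beta> L) \<le> log_tangent \<beta> K L"
proof -
  obtain R where R: "\<And>z. z \<in> K \<Longrightarrow> norm z \<le> R" "\<And>z. z \<in> L \<Longrightarrow> norm z \<le> R"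
    using convex_body_norm_bound[OF K L] by metis
  \<comment> \<open>Iterated midpoints with \<open>K\<close>, starting from \<open>L\<close>. The
    difference of the support functions of \<open>M k\<close> and \<open>K\<close> halves at each
    stage, so weighted combinations never have to be formed.\<close>
  define M where "M k = ((\<lambda>B. (*\<^sub>R) (1/2) ` (K + B)) ^^ k) L" for k
  have M_Suc: "M (Suc k) = (*\<^sub>R) (1/2) ` (K + M k)" for k by (simp add: M_def)
  have body: "convex_body (M k)" for k
    by (induction k) (auto simp: M_Suc M_def[of 0] L intro!: convex_body_scale convex_body_set_plus K)
  have bnd: "z \<in> M k \<Longrightarrow> norm z \<le> R" for z k
  proof (induction k arbitrary: z)
    case (Suc k)
    then obtain a b where ab: "a \<in> K" "b \<in> M k" "z = (1/2) *\<^sub>R (a + b)" by (auto simp: M_Suc set_plus_def)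
    then have "norm z \<le> (norm a + norm b) / 2" using norm_triangle_ineq[of a b] by simp
    then show ?case using R(1)[OF ab(1)] Suc.IH[OF ab(2)] by simp
  qed (use R in \<open>simp add: M_def\<close>)
  define g where "g z = support_fun L (offset K z) - support_fun K (offset K z)" for z
  have supp: "support_fun (M k) u - support_fun K u = (1/2)^k * (support_fun L u - support_fun K u)" for k u
  proof (induction k)
    case (Suc k)
    have "support_fun (M (Suc k)) u = (support_fun K u + support_fun (M k) u) / 2"
      using convex_body_scale(2)[OF convex_body_set_plus(1)[OF K body], of "1/2" k u] convex_body_set_plus(2)[OF K body, of k u]
      by (simp add: M_Suc)
    then have "support_fun (M (Suc k)) u - support_fun K u = (support_fun (M k) u - support_fun K u) / 2"
      by argo
    then show ?case using Suc.IH by simp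
  qed (simp add: M_def)
  have g_cont: "continuous_on UNIV g"
    unfolding g_def
    by (intro continuous_intros continuous_on_compose2[OF continuous_on_support_fun_vec[OF L] continuous_on_offset[OF K]]
      continuous_on_compose2[OF continuous_on_support_fun_vec[OF K] continuous_on_offset[OF K]]) auto
  define V where "V = smooth_vol \<beta> K"
  have V: "0 < V" unfolding V_def by (rule smooth_vol_pos[OF K \<beta>])
  define r where "r k = smooth_vol \<beta> (M k) / V" for k
  have r_pos: "0 < r k" for k using V smooth_vol_pos[OF body \<beta>] by (simp add: r_def)
  have r_step: "r k \<le> (r (Suc k))\<^sup>2" for k
  proof -
    have "V * smooth_vol \<beta> (M k) \<le> (smooth_vol \<beta> (M (Suc k)))\<^sup>2"
      unfolding V_def by (intro smooth_vol_midpoint K body \<beta>) (auto simp: M_Suc)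
    then have "V * smooth_vol \<beta> (M k) / V\<^sup>2 \<le> (smooth_vol \<beta> (M (Suc k)))\<^sup>2 / V\<^sup>2"
      by (intro divide_right_mono) auto
    then show ?thesis using V by (simp add: r_def power_divide power2_eq_square)
  qed
  have r0: "ln (r 0) \<le> 2^k * ln (r k)" for k
  proof (induction k)
    case (Suc k)
    have "ln (r k) \<le> ln ((r (Suc k))\<^sup>2)" using r_step[of k] r_pos[of k] r_pos[of "Suc k"] by simp
    also have "\<dots> = 2 * ln (r (Suc k))" using r_pos[of "Suc k"] by (simp add: ln_realpow)
    finally have "2^k * ln (r k) \<le> 2^k * (2 * ln (r (Suc k)))" by (intro mult_left_mono) auto
    also have "\<dots> = 2 ^ Suc k * ln (r (Suc k))" by simp
    finally show ?case using Suc.IH by (rule order_trans[rotated])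
  qed simp
  define l where "l = 4 * \<beta> * (\<integral>z. bump \<beta> K z * g z \<partial>lborel) / V"
  define C where "C = 4 * \<beta>\<^sup>2 * (\<integral>z. indicator (cball 0 (R + 1)) z * (g z)\<^sup>2 \<partial>lborel) / V"
  have "ln (r 0) \<le> l + (1/2)^k * C" for k
  proof -
    have "smooth_vol \<beta> (M k) \<le> V + (1/2)^k * (V * l) + ((1/2)^k)\<^sup>2 * (V * C)"
      using smooth_vol_taylor_le[OF K body[of k] \<beta> R(1) bnd[of _ k] g_cont, where s = "(1/2)^k"] supp V
      by (simp add: V_def l_def C_def g_def)
    then have "r k \<le> 1 + ((1/2)^k * l + ((1/2)^k)\<^sup>2 * C)"
      using V by (simp add: r_def pos_divide_le_eq algebra_simps)
    then have "ln (r k) \<le> (1/2)^k * l + ((1/2)^k)\<^sup>2 * C"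
      using ln_le_minus_one[OF r_pos[of k]] by linarith
    then have "2^k * ln (r k) \<le> 2^k * ((1/2)^k * l + ((1/2)^k)\<^sup>2 * C)" by (intro mult_left_mono) auto
    also have "\<dots> = l + (1/2)^k * C"
      by (simp add: power_divide field_simps power2_eq_square)
    finally show ?thesis using r0[of k] by linarith
  qed
  moreover have "(\<lambda>k. l + (1/2)^k * C) \<longlonglongrightarrow> l + 0 * C"
    by (intro tendsto_intros LIMSEQ_realpow_zero) auto
  ultimately have "ln (r 0) \<le> l" by (intro LIMSEQ_le_const[of "\<lambda>k. l + (1/2)^k * C"]) auto
  moreover have "ln (r 0) = ln (smooth_vol \<beta> L) - ln V"
    using V smooth_vol_pos[OF L \<beta>] by (simp add: r_def M_def ln_div)
  ultimately show ?thesis by (simp add: log_tangent_def l_def g_def V_def)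
qed

section \<open>The tangent functional along a continuous family of bodies\<close>

context body_family begin

text \<open>Makes the tangent functional an admissible boundary function for
  \<open>harmonic_measure\<close>.\<close>

lemma continuous_on_log_tangent:
  assumes K: "convex_body K" and \<beta>: "1 \<le> \<beta>"
  shows "continuous_on F (\<lambda>\<tau>. log_tangent \<beta> K (A \<tau>))"
  unfolding continuous_on_iff
proof (intro ballI allI impI)
  fix \<tau> and e :: real assume \<tau>: "\<tau> \<in> F" and e: "0 < e"
  define c where "c = 4 * \<beta> / smooth_vol \<beta> K"
  define J where "J = (\<integral>z. bump \<beta> K z * norm (offset K z) \<partial>lborel)"
  have c: "0 < c" using smooth_vol_pos[OF K \<beta>] \<beta> by (simp add: c_def)
  have J: "0 \<le> J" unfolding J_def by (intro integral_nonneg_AE AE_I2 mult_nonneg_nonneg bump_nonneg norm_ge_zero)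
  have int: "integrable lborel (\<lambda>z. bump \<beta> K z * (support_fun (A \<sigma>) (offset K z) - support_fun K (offset K z)))" if "\<sigma> \<in> F" for \<sigma>
    by (intro integrable_bump_mult K \<beta> continuous_intros
        continuous_on_compose2[OF continuous_on_support_fun_vec[OF body[OF that]] continuous_on_offset[OF K]]
        continuous_on_compose2[OF continuous_on_support_fun_vec[OF K] continuous_on_offset[OF K]]) auto
  have intJ: "integrable lborel (\<lambda>z. bump \<beta> K z * norm (offset K z))"
    by (intro integrable_bump_mult K \<beta> continuous_on_norm continuous_on_offset)
  \<comment> \<open>\<open>c * J\<close> bounds the sensitivity to the support function; the added 1
    covers \<open>J = 0\<close> and keeps the final estimate strict.\<close>
  have "0 < e / (c * J + 1)" using e c J by (intro divide_pos_pos add_nonneg_pos mult_nonneg_nonneg) auto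
  then obtain d where d: "0 < d" "\<And>\<sigma> \<tau> u. \<sigma> \<in> F \<Longrightarrow> \<tau> \<in> F \<Longrightarrow> dist \<sigma> \<tau> < d \<Longrightarrow>
     \<bar>support_fun (A \<sigma>) u - support_fun (A \<tau>) u\<bar> \<le> e / (c * J + 1) * norm u"
    by (rule uniformly_continuous_support_fun) blast
  have "dist (log_tangent \<beta> K (A \<sigma>)) (log_tangent \<beta> K (A \<tau>)) < e" if \<sigma>: "\<sigma> \<in> F" "dist \<sigma> \<tau> < d" for \<sigma>
  proof -
    have "log_tangent \<beta> K (A \<sigma>) - log_tangent \<beta> K (A \<tau>)
      = c * (\<integral>z. bump \<beta> K z * (support_fun (A \<sigma>) (offset K z) - support_fun K (offset K z))
          - bump \<beta> K z * (support_fun (A \<tau>) (offset K z) - support_fun K (offset K z)) \<partial>lborel)"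
      unfolding Bochner_Integration.integral_diff[OF int[OF \<sigma>(1)] int[OF \<tau>]] log_tangent_def c_def[symmetric]
      by (simp add: right_diff_distrib)
    also have "\<bar>\<dots>\<bar> \<le> c * (\<integral>z. (e / (c * J + 1)) * (bump \<beta> K z * norm (offset K z)) \<partial>lborel)"
    proof -
      have "\<bar>\<integral>z. bump \<beta> K z * (support_fun (A \<sigma>) (offset K z) - support_fun K (offset K z))
          - bump \<beta> K z * (support_fun (A \<tau>) (offset K z) - support_fun K (offset K z)) \<partial>lborel\<bar>
        \<le> (\<integral>z. \<bar>bump \<beta> K z * (support_fun (A \<sigma>) (offset K z) - support_fun K (offset K z))
          - bump \<beta> K z * (support_fun (A \<tau>) (offset K z) - support_fun K (offset K z))\<bar> \<partial>lborel)"
        by (rule integral_abs_bound)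
      also have "\<dots> \<le> (\<integral>z. (e / (c * J + 1)) * (bump \<beta> K z * norm (offset K z)) \<partial>lborel)"
      proof (intro integral_mono integrable_abs Bochner_Integration.integrable_diff int \<sigma> \<tau> integrable_mult_right intJ)
        fix z
        have "\<bar>bump \<beta> K z * (support_fun (A \<sigma>) (offset K z) - support_fun K (offset K z))
          - bump \<beta> K z * (support_fun (A \<tau>) (offset K z) - support_fun K (offset K z))\<bar>
          = bump \<beta> K z * \<bar>support_fun (A \<sigma>) (offset K z) - support_fun (A \<tau>) (offset K z)\<bar>"
          using bump_nonneg[of \<beta> K z] by (simp add: abs_mult flip: right_diff_distrib)
        also have "\<dots> \<le> bump \<beta> K z * (e / (c * J + 1) * norm (offset K z))"
          using d(2)[OF \<sigma>(1) \<tau> \<sigma>(2)] bump_nonneg by (intro mult_left_mono) auto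
        finally show "\<bar>bump \<beta> K z * (support_fun (A \<sigma>) (offset K z) - support_fun K (offset K z))
          - bump \<beta> K z * (support_fun (A \<tau>) (offset K z) - support_fun K (offset K z))\<bar>
          \<le> (e / (c * J + 1)) * (bump \<beta> K z * norm (offset K z))" by (simp add: mult_ac)
      qed
      finally show ?thesis using mult_left_mono[OF _ less_imp_le[OF c]] c
        by (simp only: abs_mult abs_of_pos)
    qed
    also have "\<dots> = e * (c * J) / (c * J + 1)" by (simp add: J_def mult_ac)
    also have "\<dots> < e" using e c J by (simp add: pos_divide_less_eq add_nonneg_pos distrib_left)
    finally show ?thesis by (simp add: dist_real_def)
  qed
  then show "\<exists>d>0. \<forall>\<sigma>\<in>F. dist \<sigma> \<tau> < d \<longrightarrow> dist (log_tangent \<beta> K (A \<sigma>)) (log_tangent \<beta> K (A \<tau>)) < e"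
    using d(1) by blast
qed

end

context body_family_measure begin

text \<open>Fubini moves the average over the boundary inside the integral over \<open>z\<close>,
  where it turns the support functions of the family into that of the Minkowski integral. The terms
  depending on \<open>K\<close> alone survive because the measure has mass 1.\<close>

lemma integral_log_tangent:
  assumes K: "convex_body K" and \<beta>: "1 \<le> \<beta>"
  shows "(\<integral>\<tau>. log_tangent \<beta> K (A \<tau>) \<partial>M) = log_tangent \<beta> K (minkowski_integral M A)"
proof -
  interpret P: pair_sigma_finite M "lborel :: 'b measure" ..
  let ?w = "offset K"
  define f where "f \<tau> z = bump \<beta> K z * (support_fun (A \<tau>) (?w z) - support_fun K (?w z))" for \<tau> z
  obtain R where R: "0 < R" "\<And>\<tau> z. \<tau> \<in> F \<Longrightarrow> z \<in> A \<tau> \<Longrightarrow> norm z \<le> R" by (rule uniformly_bounded) blast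
  obtain R' where R': "0 < R'" "\<And>z. z \<in> K \<Longrightarrow> norm z \<le> R'" using convex_body_norm_bound[OF K K] by metis
  have [measurable]: "bump \<beta> K \<in> borel_measurable borel"
    by (intro borel_measurable_continuous_onI continuous_on_bump)
  have [measurable]: "?w \<in> borel_measurable borel"
    by (intro borel_measurable_continuous_onI continuous_on_offset K)
  have [measurable]: "support_fun K \<in> borel_measurable borel"
    by (intro borel_measurable_continuous_onI continuous_on_support_fun_vec K)
  have f_bound: "\<bar>f \<tau> z\<bar> \<le> (R + R') * (bump \<beta> K z * norm (?w z))" if "\<tau> \<in> F" for \<tau> z
  proof -
    have "\<bar>support_fun (A \<tau>) (?w z)\<bar> \<le> R * norm (?w z)"
      using that R by (intro support_fun_abs_le body_parts) auto
    moreover have "\<bar>support_fun K (?w z)\<bar> \<le> R' * norm (?w z)"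
      using K R' by (intro support_fun_abs_le) (auto simp: convex_body_def)
    ultimately have "\<bar>support_fun (A \<tau>) (?w z) - support_fun K (?w z)\<bar> \<le> (R + R') * norm (?w z)"
      by (simp add: distrib_right abs_le_iff)
    from mult_left_mono[OF this bump_nonneg[of \<beta> K z]] show ?thesis
      using bump_nonneg[of \<beta> K z] by (simp add: f_def abs_mult mult.left_commute)
  qed
  have f_int: "integrable lborel (f \<tau>)" if "\<tau> \<in> F" for \<tau>
    unfolding f_def
    by (intro integrable_bump_mult K \<beta> continuous_intros
        continuous_on_compose2[OF continuous_on_support_fun_vec[OF body[OF that]] continuous_on_offset[OF K]]
        continuous_on_compose2[OF continuous_on_support_fun_vec[OF K] continuous_on_offset[OF K]]) auto
  have joint: "(\<lambda>p. support_fun (A (fst p)) (?w (snd p))) \<in> borel_measurable (M \<Otimes>\<^sub>M lborel)"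
  proof -
    \<comment> \<open>Nothing is known about \<open>A\<close> off \<open>F\<close>. Extending by 0
      from the closed set \<open>F \<times> UNIV\<close>, where the support function is jointly
      continuous, yields a Borel function of the pair.\<close>
    define G where "G p = indicator (F \<times> (UNIV :: 'b set)) p *\<^sub>R support_fun (A (fst p)) (snd p)" for p
    have "closed (F \<times> (UNIV :: 'b set))" using compact_imp_closed[OF compact_F] by (intro closed_Times closed_UNIV)
    then have [measurable]: "G \<in> borel_measurable borel"
      unfolding G_def by (intro borel_measurable_continuous_on_indicator continuous_on_support_fun_joint borel_closed)
    have [measurable]: "(\<lambda>\<tau>. \<tau>) \<in> measurable M borel"
      unfolding measurable_cong_sets[OF sets_M refl] by (intro measurable_restrict_space1) auto
    have "(\<lambda>p. (fst p, ?w (snd p))) \<in> measurable (M \<Otimes>\<^sub>M lborel) (borel \<Otimes>\<^sub>M borel)" by measurable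
    then have "(\<lambda>p. (fst p, ?w (snd p))) \<in> borel_measurable (M \<Otimes>\<^sub>M lborel)" by (simp add: borel_prod)
    then have "(\<lambda>p. G (fst p, ?w (snd p))) \<in> borel_measurable (M \<Otimes>\<^sub>M lborel)"
      by (rule measurable_compose) measurable
    then show ?thesis
      by (subst measurable_cong[where g = "\<lambda>p. G (fst p, ?w (snd p))"])
        (auto simp: G_def space_pair_measure space_M)
  qed
  have f_meas[measurable]: "(\<lambda>p. f (fst p) (snd p)) \<in> borel_measurable (M \<Otimes>\<^sub>M lborel)"
    unfolding f_def using joint by measurable
  have intw: "integrable lborel (\<lambda>z. bump \<beta> K z * norm (?w z))"
    by (intro integrable_bump_mult K \<beta> continuous_on_norm continuous_on_offset)
  have "integrable (M \<Otimes>\<^sub>M lborel) (\<lambda>p. f (fst p) (snd p))"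
  proof (rule P.Fubini_integrable)
    show "integrable M (\<lambda>\<tau>. \<integral>z. norm (f (fst (\<tau>, z)) (snd (\<tau>, z))) \<partial>lborel)"
    proof (rule integrable_const_bound[where B = "\<integral>z. (R + R') * (bump \<beta> K z * norm (?w z)) \<partial>lborel"])
      show "AE \<tau> in M. norm (\<integral>z. norm (f (fst (\<tau>, z)) (snd (\<tau>, z))) \<partial>lborel) \<le> (\<integral>z. (R + R') * (bump \<beta> K z * norm (?w z)) \<partial>lborel)"
      proof (intro AE_I2)
        fix \<tau> assume "\<tau> \<in> space M"
        then have \<tau>: "\<tau> \<in> F" by (simp add: space_M)
        have "(\<integral>z. norm (f \<tau> z) \<partial>lborel) \<le> (\<integral>z. (R + R') * (bump \<beta> K z * norm (?w z)) \<partial>lborel)"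
          using f_bound[OF \<tau>] by (intro integral_mono integrable_norm f_int \<tau> integrable_mult_right intw) auto
        moreover have "0 \<le> (\<integral>z. norm (f \<tau> z) \<partial>lborel)" by (intro integral_nonneg_AE) auto
        ultimately show "norm (\<integral>z. norm (f (fst (\<tau>, z)) (snd (\<tau>, z))) \<partial>lborel) \<le> (\<integral>z. (R + R') * (bump \<beta> K z * norm (?w z)) \<partial>lborel)"
          by simp
      qed
      have "(\<lambda>p. norm (f (fst p) (snd p))) \<in> borel_measurable (M \<Otimes>\<^sub>M lborel)" by measurable
      then show "(\<lambda>\<tau>. \<integral>z. norm (f (fst (\<tau>, z)) (snd (\<tau>, z))) \<partial>lborel) \<in> borel_measurable M"
        by (intro lborel.borel_measurable_lebesgue_integral) (simp add: split_beta')
    qed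
    show "AE \<tau> in M. integrable lborel (\<lambda>z. f (fst (\<tau>, z)) (snd (\<tau>, z)))"
      using f_int by (intro AE_I2) (simp add: space_M)
  qed measurable
  then have fub: "(\<integral>z. \<integral>\<tau>. f \<tau> z \<partial>M \<partial>lborel) = (\<integral>\<tau>. \<integral>z. f \<tau> z \<partial>lborel \<partial>M)"
    by (intro P.Fubini_integral) (simp add: split_beta')
  have inner: "(\<integral>\<tau>. f \<tau> z \<partial>M) = bump \<beta> K z * (support_fun (minkowski_integral M A) (?w z) - support_fun K (?w z))" for z
    unfolding f_def minkowski_integral_support_fun(2)
    by (simp add: integrable_support_fun prob_space)
  have fi: "integrable M (\<lambda>\<tau>. \<integral>z. f \<tau> z \<partial>lborel)"
    using P.integrable_fst[of f] \<open>integrable (M \<Otimes>\<^sub>M lborel) (\<lambda>p. f (fst p) (snd p))\<close> by (simp add: split_beta')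
  have "(\<integral>\<tau>. log_tangent \<beta> K (A \<tau>) \<partial>M)
      = (\<integral>\<tau>. ln (smooth_vol \<beta> K) + 4 * \<beta> / smooth_vol \<beta> K * (\<integral>z. f \<tau> z \<partial>lborel) \<partial>M)"
    by (simp add: log_tangent_def f_def)
  also have "\<dots> = ln (smooth_vol \<beta> K) + 4 * \<beta> / smooth_vol \<beta> K * (\<integral>\<tau>. \<integral>z. f \<tau> z \<partial>lborel \<partial>M)"
    using fi by (simp add: prob_space)
  also have "\<dots> = log_tangent \<beta> K (minkowski_integral M A)"
    unfolding fub[symmetric] inner by (simp add: log_tangent_def)
  finally show ?thesis .
qed

end

section \<open>Harmonic interpolation\<close>

lemma convex_body_measure_zero_iff:
  assumes K: "convex_body K"
  shows "measure lborel K = 0 \<longleftrightarrow> interior K = {}"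
proof -
  have cK: "compact K" "convex K" using K by (auto simp: convex_body_def)
  have b: "K \<in> sets borel" using cK by (simp add: compact_imp_closed)
  have "measure lborel K = 0 \<longleftrightarrow> emeasure lborel K = 0"
    using emeasure_compact_finite[OF cK(1)] by (auto simp: measure_def enn2real_eq_0_iff)
  also have "\<dots> \<longleftrightarrow> negligible K"
    using b by (simp add: negligible_iff_null_sets null_sets_completion_iff null_sets_def)
  also have "\<dots> \<longleftrightarrow> interior K = {}" using cK(2) by (rule negligible_convex_interior)
  finally show ?thesis .
qed

text \<open>Null bodies are those contained in a hyperplane. Expressed by the width, the condition
  is linear in the support function and so becomes a statement about a harmonic function.\<close>

lemma convex_body_measure_zero_iff_width:
  assumes K: "convex_body K"
  shows "measure lborel K = 0 \<longleftrightarrow> (\<exists>a. a \<noteq> 0 \<and> support_fun K a + support_fun K (- a) = 0)"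
proof
  have cK: "compact K" "K \<noteq> {}" "convex K" using K by (auto simp: convex_body_def)
  assume "measure lborel K = 0"
  then have "interior K = {}" using convex_body_measure_zero_iff[OF K] by simp
  then obtain a b where ab: "a \<noteq> 0" "K \<subseteq> {x. a \<bullet> x = b}"
    using empty_interior_subset_hyperplane[OF cK(3)] by blast
  obtain k where k: "k \<in> K" using cK by blast
  have "support_fun K a = b" "support_fun K (- a) = - b"
    using ab k by (auto intro!: support_fun_eqI[OF cK(1) _ k] simp: inner_commute subset_iff)
  then show "\<exists>a. a \<noteq> 0 \<and> support_fun K a + support_fun K (- a) = 0" using ab by auto
next
  assume "\<exists>a. a \<noteq> 0 \<and> support_fun K a + support_fun K (- a) = 0"
  then obtain a where a: "a \<noteq> 0" "support_fun K (- a) = - support_fun K a" by (metis add_eq_0_iff)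
  have cK: "compact K" "convex K" using K by (auto simp: convex_body_def)
  have "K \<subseteq> {x. a \<bullet> x = support_fun K a}"
  proof
    fix z assume z: "z \<in> K"
    have "z \<bullet> a \<le> support_fun K a" "z \<bullet> (- a) \<le> support_fun K (- a)"
      using support_fun_ge[OF cK(1) z] by blast+
    then show "z \<in> {x. a \<bullet> x = support_fun K a}" using a(2) by (simp add: inner_commute)
  qed
  then have "negligible K" using negligible_hyperplane[of a] a(1) negligible_subset by blast
  then have "interior K = {}" using negligible_convex_interior[OF cK(2)] by simp
  then show "measure lborel K = 0" using convex_body_measure_zero_iff[OF K] by simp
qed

text \<open>Contracting \<open>K\<close> by the factor \<open>1 - t\<close> towards the centre of an
  inscribed ball of radius \<open>\<rho>\<close> lowers the support function by at least
  \<open>t * \<rho> * norm u\<close>, so the contracted body fits into \<open>L\<close>.\<close>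

lemma measure_ge_of_support_fun_ge:
  fixes K L :: "'a::euclidean_space set"
  assumes K: "convex_body K" and L: "convex_body L" and \<rho>: "cball c \<rho> \<subseteq> K" "0 < \<rho>"
    and t: "0 < t" "t < 1" and le: "\<And>u. support_fun K u - t * \<rho> * norm u \<le> support_fun L u"
  shows "(1 - t) ^ DIM('a) * measure lborel K \<le> measure lborel L"
proof -
  have cK: "compact K" "K \<noteq> {}" and cL: "compact L" using K L by (auto simp: convex_body_def)
  let ?T = "\<lambda>z. (1 - t) *\<^sub>R z + t *\<^sub>R c"
  have sub: "?T ` K \<subseteq> L"
  proof
    fix y assume "y \<in> ?T ` K"
    then obtain z where z: "z \<in> K" "y = ?T z" by blast
    have "y \<bullet> u \<le> support_fun L u" for u
    proof -
      \<comment> \<open>The point of the inscribed ball farthest in the direction \<open>u\<close>;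
        for \<open>u = 0\<close> it is the centre.\<close>
      have "c + (\<rho> / norm u) *\<^sub>R u \<in> K" using \<rho> by (intro subsetD[OF \<rho>(1)]) (simp add: dist_norm)
      then have "(c + (\<rho> / norm u) *\<^sub>R u) \<bullet> u \<le> support_fun K u" by (rule support_fun_ge[OF cK(1)])
      moreover have "(\<rho> / norm u) * (u \<bullet> u) = \<rho> * norm u"
        by (simp add: power2_norm_eq_inner[symmetric] power2_eq_square)
      ultimately have "c \<bullet> u + \<rho> * norm u \<le> support_fun K u" by (simp add: inner_add_left)
      then have "t * (c \<bullet> u + \<rho> * norm u) \<le> t * support_fun K u" using t by (intro mult_left_mono) auto
      moreover have "(1 - t) * (z \<bullet> u) \<le> (1 - t) * support_fun K u"
        using t support_fun_ge[OF cK(1) z(1), of u] by (intro mult_left_mono) auto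
      moreover have "y \<bullet> u = (1 - t) * (z \<bullet> u) + t * (c \<bullet> u)" by (simp add: z inner_add_left)
      ultimately have "y \<bullet> u \<le> support_fun K u - t * \<rho> * norm u" by (simp add: algebra_simps)
      then show ?thesis using le[of u] by linarith
    qed
    then show "y \<in> L" using mem_convex_body_iff[OF L] by blast
  qed
  have "compact (?T ` K)" by (intro compact_continuous_image continuous_intros cK)
  then have b: "?T ` K \<in> sets borel" "K \<in> sets borel" using cK by (auto simp: compact_imp_closed)
  have "measure lebesgue (?T ` K) = \<bar>1 - t\<bar> ^ DIM('a) * measure lebesgue K" by (rule measure_lebesgue_affine)
  then have "(1 - t) ^ DIM('a) * measure lborel K = measure lborel (?T ` K)" using b t by simp
  also have "\<dots> \<le> measure lborel L"
    using sub b cL emeasure_compact_finite[OF cL]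
    by (intro measure_mono_fmeasurable) (auto simp: fmeasurable_def compact_imp_closed)
  finally show ?thesis .
qed

text \<open>Evaluating the support function in the direction of \<open>z\<close> itself bounds
  \<open>|z|^2\<close> by \<open>R * |z|\<close>.\<close>

lemma (in body_family_measure) minkowski_integral_norm_le:
  assumes R: "\<And>\<tau> z. \<tau> \<in> F \<Longrightarrow> z \<in> A \<tau> \<Longrightarrow> norm z \<le> R" and z: "z \<in> minkowski_integral M A"
  shows "norm z \<le> R"
proof -
  have "z \<bullet> z \<le> support_fun (minkowski_integral M A) z"
    using z minkowski_integral_support_fun(1) by (intro support_fun_ge) (auto simp: convex_body_def)
  also have "\<dots> = (\<integral>\<tau>. support_fun (A \<tau>) z \<partial>M)" by (rule minkowski_integral_support_fun(2))
  also have "\<dots> \<le> (\<integral>\<tau>. R * norm z \<partial>M)"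
  proof (intro integral_mono integrable_support_fun)
    fix \<tau> assume "\<tau> \<in> space M"
    then have "\<tau> \<in> F" by (simp add: space_M)
    then have "\<bar>support_fun (A \<tau>) z\<bar> \<le> R * norm z" by (intro support_fun_abs_le body_parts R)
    then show "support_fun (A \<tau>) z \<le> R * norm z" by simp
  qed simp
  also have "\<dots> = R * norm z" by (simp add: prob_space)
  finally have *: "(norm z)\<^sup>2 \<le> R * norm z" by (simp add: power2_norm_eq_inner)
  obtain \<tau> w where "\<tau> \<in> F" "w \<in> A \<tau>" using not_empty space_M body_parts(1) by (metis ex_in_conv)
  then have "0 \<le> R" using R norm_ge_zero order_trans by blast
  then show ?thesis using * by (cases "norm z = 0") (auto simp: power2_eq_square)
qed

lemma harmonic_on_subset: "harmonic_on U f \<Longrightarrow> V \<subseteq> U \<Longrightarrow> harmonic_on V f"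
proof -
  have "Ck_on k U f \<Longrightarrow> V \<subseteq> U \<Longrightarrow> Ck_on k V f" for k f
    by (induction k arbitrary: f) (auto intro: continuous_on_subset)
  then show "harmonic_on U f \<Longrightarrow> V \<subseteq> U \<Longrightarrow> harmonic_on V f"
    by (auto simp: harmonic_on_def)
qed

lemma harmonic_on_imp_continuous_on: "harmonic_on U f \<Longrightarrow> continuous_on U f"
  by (auto simp: harmonic_on_def numeral_2_eq_2
      intro!: continuous_at_imp_continuous_on differentiable_imp_continuous_within)

section \<open>The interpolated bodies as functions of the interior point\<close>

locale harmonic_interpolation = body_family "frontier \<Omega>" A
  for \<Omega> :: "'a::euclidean_space set" and A :: "'a \<Rightarrow> 'b::euclidean_space set" +
  fixes \<mu> :: "'a \<Rightarrow> 'a measure"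
  assumes open_\<Omega>: "open \<Omega>" and harmonic_measure: "harmonic_measure \<Omega> \<mu>"
begin

abbreviation interp :: "'a \<Rightarrow> 'b set" where "interp x \<equiv> minkowski_integral (\<mu> x) A"

lemma body_family_measure: "x \<in> \<Omega> \<Longrightarrow> body_family_measure (frontier \<Omega>) A (\<mu> x)"
  using harmonic_measure body_family_axioms
  by (auto simp: harmonic_measure_def body_family_measure_def body_family_measure_axioms_def)

lemma interp_body: "x \<in> \<Omega> \<Longrightarrow> convex_body (interp x)"
  using body_family_measure.minkowski_integral_support_fun(1)[OF body_family_measure] .

lemma interp_support_fun: "x \<in> \<Omega> \<Longrightarrow> support_fun (interp x) u = (\<integral>\<tau>. support_fun (A \<tau>) u \<partial>\<mu> x)"
  using body_family_measure.minkowski_integral_support_fun(2)[OF body_family_measure] .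

lemma harmonic_on_integral:
  "continuous_on (frontier \<Omega>) g \<Longrightarrow> harmonic_on \<Omega> (\<lambda>x. \<integral>\<tau>. g \<tau> \<partial>\<mu> x)"
  using harmonic_measure by (auto simp: harmonic_measure_def)

text \<open>The comparison function \<open>g\<close> is minus the tangent functional at the body
  over \<open>x0\<close>. On the sphere it is at most - ln of the smoothed volume, hence at most -
  ln of the volume and so at most \<open>h\<close>; at \<open>x0\<close> the tangent is exact. The
  exponential form survives the limit in \<open>\<beta>\<close> without presupposing positive volume
  at \<open>x0\<close>.\<close>

lemma smooth_vol_interp_ge:
  assumes r: "0 < r" "cball a r \<subseteq> \<Omega>" and h: "continuous_on (cball a r) h" "harmonic_on (ball a r) h"
    and bd: "\<And>x. x \<in> sphere a r \<Longrightarrow> neg_log_vol (interp x) \<le> ereal (h x)"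
    and x0: "x0 \<in> cball a r" and \<beta>: "1 \<le> \<beta>"
  shows "exp (- h x0) \<le> smooth_vol \<beta> (interp x0)"
proof -
  have x0\<Omega>: "x0 \<in> \<Omega>" using r x0 by auto
  note K = interp_body[OF x0\<Omega>]
  define g where "g y = (\<integral>\<tau>. - log_tangent \<beta> (interp x0) (A \<tau>) \<partial>\<mu> y)" for y
  have g_eq: "g y = - log_tangent \<beta> (interp x0) (interp y)" if "y \<in> \<Omega>" for y
    unfolding g_def using body_family_measure.integral_log_tangent[OF body_family_measure[OF that] K \<beta>] by simp
  have g_harm: "harmonic_on \<Omega> g"
    unfolding g_def by (intro harmonic_on_integral continuous_on_minus continuous_on_log_tangent K \<beta>)
  have "g x0 \<le> h x0"
  proof (rule harmonic_on_ball_le[OF r(1) _ _ h _ x0])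
    show "continuous_on (cball a r) g"
      using harmonic_on_imp_continuous_on[OF g_harm] r(2) by (rule continuous_on_subset)
    show "harmonic_on (ball a r) g" using g_harm r(2) by (rule harmonic_on_subset[OF _ subset_trans[OF ball_subset_cball]])
    fix y assume y: "y \<in> sphere a r"
    then have y\<Omega>: "y \<in> \<Omega>" using r(2) by auto
    note L = interp_body[OF y\<Omega>]
    have nz: "measure lborel (interp y) \<noteq> 0" and le: "- ln (measure lborel (interp y)) \<le> h y"
      using bd[OF y] by (auto simp: neg_log_vol_def split: if_splits)
    have "0 < measure lborel (interp y)" using nz measure_nonneg[of lborel "interp y"] by linarith
    then have "ln (measure lborel (interp y)) \<le> ln (smooth_vol \<beta> (interp y))"
      using measure_le_smooth_vol[OF L \<beta>] by (simp add: ln_mono)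
    also have "\<dots> \<le> log_tangent \<beta> (interp x0) (interp y)" by (rule ln_smooth_vol_le_log_tangent[OF K L \<beta>])
    finally show "g y \<le> h y" using le g_eq[OF y\<Omega>] by linarith
  qed
  then have "- h x0 \<le> ln (smooth_vol \<beta> (interp x0))" using g_eq[OF x0\<Omega>] by (simp add: log_tangent_self)
  then have "exp (- h x0) \<le> exp (ln (smooth_vol \<beta> (interp x0)))" by simp
  then show ?thesis using smooth_vol_pos[OF K \<beta>] by simp
qed

text \<open>The lower bound \<open>exp (- h x0)\<close> is positive and independent of
  \<open>\<beta>\<close>, so the limit also excludes a degenerate body at \<open>x0\<close>, where
  \<open>neg_log_vol\<close> would be infinite.\<close>

lemma neg_log_vol_interp_le:
  assumes r: "0 < r" "cball a r \<subseteq> \<Omega>" and h: "continuous_on (cball a r) h" "harmonic_on (ball a r) h"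
    and bd: "\<And>x. x \<in> sphere a r \<Longrightarrow> neg_log_vol (interp x) \<le> ereal (h x)"
    and x0: "x0 \<in> cball a r"
  shows "neg_log_vol (interp x0) \<le> ereal (h x0)"
proof -
  have x0\<Omega>: "x0 \<in> \<Omega>" using r x0 by auto
  have "exp (- h x0) \<le> measure lborel (interp x0)"
    using smooth_vol_interp_ge[OF r h bd x0]
    by (intro LIMSEQ_le_const[OF smooth_vol_tendsto[OF interp_body[OF x0\<Omega>]]]) auto
  moreover from this have "0 < measure lborel (interp x0)" using exp_gt_zero[of "- h x0"] by linarith
  ultimately have "- h x0 \<le> ln (measure lborel (interp x0))" by (simp add: ln_ge_iff)
  then show ?thesis using \<open>0 < measure lborel (interp x0)\<close> by (simp add: neg_log_vol_def)
qed

text \<open>The direction in which the body over \<open>x\<close> is flat is kept fixed: the width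
  in that one direction vanishes on the whole component.\<close>

lemma interp_degenerate_component:
  assumes C: "C \<in> components \<Omega>" and x: "x \<in> C" "measure lborel (interp x) = 0" and y: "y \<in> C"
  shows "measure lborel (interp y) = 0"
proof -
  have C': "C \<subseteq> \<Omega>" "connected C" "open C"
    using C open_\<Omega> by (auto simp: in_components_subset in_components_connected intro: open_components)
  then have xy: "x \<in> \<Omega>" "y \<in> \<Omega>" using x y by auto
  obtain a where a: "a \<noteq> 0" "support_fun (interp x) a + support_fun (interp x) (- a) = 0"
    using convex_body_measure_zero_iff_width[OF interp_body[OF xy(1)]] x(2) by blast
  define w where "w z = (\<integral>\<tau>. support_fun (A \<tau>) a + support_fun (A \<tau>) (- a) \<partial>\<mu> z)" for z
  have w_eq: "w z = support_fun (interp z) a + support_fun (interp z) (- a)" if "z \<in> \<Omega>" for z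
    unfolding w_def interp_support_fun[OF that]
    using body_family_measure.integrable_support_fun[OF body_family_measure[OF that]] by simp
  have w_nn: "0 \<le> w z" if "z \<in> \<Omega>" for z
  proof -
    have K: "compact (interp z)" "interp z \<noteq> {}" using interp_body[OF that] by (auto simp: convex_body_def)
    show ?thesis
      unfolding w_eq[OF that]
      using support_fun_add_le[OF K, of a "- a"] support_fun_scaleR[OF K, of 0 0] by simp
  qed
  have harm: "harmonic_on \<Omega> w"
    unfolding w_def by (intro harmonic_on_integral continuous_on_add continuous_on_support_fun)
  have "w y = 0"
    using harmonic_on_zero_connected[OF harm harmonic_on_imp_continuous_on[OF harm] open_\<Omega> w_nn C'(2,3,1) x(1) _ y]
      a w_eq[OF xy(1)] by simp
  then show ?thesis
    using convex_body_measure_zero_iff_width[OF interp_body[OF xy(2)]] a(1) w_eq[OF xy(2)] by auto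
qed

text \<open>For each fixed direction, closeness is continuity of a harmonic function. Uniformity in
  the direction comes from a finite net of the sphere and the Lipschitz constant \<open>R\<close>
  common to all interpolated bodies; a net of mesh \<open>e / (4 * R)\<close> leaves three errors of
  at most \<open>e / 4\<close>.\<close>

lemma eventually_interp_support_fun_close:
  assumes x: "x \<in> \<Omega>" and e: "0 < e"
  shows "\<forall>\<^sub>F y in at x within \<Omega>. \<forall>u. \<bar>support_fun (interp y) u - support_fun (interp x) u\<bar> \<le> e * norm u"
proof -
  obtain R where R: "0 < R" "\<And>\<tau> z. \<tau> \<in> frontier \<Omega> \<Longrightarrow> z \<in> A \<tau> \<Longrightarrow> norm z \<le> R" by (rule uniformly_bounded) blast
  have lip: "\<bar>support_fun (interp y) u - support_fun (interp y) v\<bar> \<le> R * norm (u - v)" if "y \<in> \<Omega>" for y u v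
    using interp_body[OF that] body_family_measure.minkowski_integral_norm_le[OF body_family_measure[OF that] R(2)]
    by (intro support_fun_lipschitz) (auto simp: convex_body_def)
  define d where "d = e / (4 * R)"
  have d: "0 < d" "R * d = e / 4" using e R by (auto simp: d_def)
  obtain D where D: "finite D" "sphere (0::'b) 1 \<subseteq> (\<Union>v\<in>D. ball v d)"
    using compactE_image[of "sphere (0::'b) 1" "sphere 0 1" "\<lambda>v. ball v d"] d
    by (metis UN_I centre_in_ball compact_sphere open_ball subsetI)
  have "\<forall>\<^sub>F y in at x within \<Omega>. \<bar>support_fun (interp y) v - support_fun (interp x) v\<bar> < e / 4" for v
  proof -
    have "harmonic_on \<Omega> (\<lambda>y. \<integral>\<tau>. support_fun (A \<tau>) v \<partial>\<mu> y)"
      by (intro harmonic_on_integral continuous_on_support_fun)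
    then have "continuous_on \<Omega> (\<lambda>y. \<integral>\<tau>. support_fun (A \<tau>) v \<partial>\<mu> y)" by (rule harmonic_on_imp_continuous_on)
    then have "continuous_on \<Omega> (\<lambda>y. support_fun (interp y) v)"
      by (rule continuous_on_eq) (simp add: interp_support_fun)
    then have "((\<lambda>y. support_fun (interp y) v) \<longlongrightarrow> support_fun (interp x) v) (at x within \<Omega>)"
      using x by (simp add: continuous_on)
    from tendstoD[OF this, of "e / 4"] show ?thesis using e by (simp add: dist_real_def)
  qed
  then have "\<forall>\<^sub>F y in at x within \<Omega>. \<forall>v\<in>D. \<bar>support_fun (interp y) v - support_fun (interp x) v\<bar> < e / 4"
    using D(1) by (simp add: eventually_ball_finite)
  moreover have "\<forall>\<^sub>F y in at x within \<Omega>. y \<in> \<Omega>" by (simp add: eventually_at_filter)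
  ultimately show ?thesis
  proof eventually_elim
    fix y assume near: "\<forall>v\<in>D. \<bar>support_fun (interp y) v - support_fun (interp x) v\<bar> < e / 4" and y: "y \<in> \<Omega>"
    have unit: "\<bar>support_fun (interp y) v - support_fun (interp x) v\<bar> \<le> e" if "norm v = 1" for v
    proof -
      obtain v' where v': "v' \<in> D" "dist v' v < d" using D(2) \<open>norm v = 1\<close> by fastforce
      have "R * norm (v - v') \<le> R * d" using v' R by (intro mult_left_mono) (auto simp: dist_norm norm_minus_commute)
      then have "\<bar>support_fun (interp y) v - support_fun (interp y) v'\<bar> \<le> e / 4"
        "\<bar>support_fun (interp x) v - support_fun (interp x) v'\<bar> \<le> e / 4"
        using lip[OF y, of v v'] lip[OF x, of v v'] d by linarith+
      then show ?thesis using bspec[OF near v'(1)] e by linarith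
    qed
    show "\<forall>u. \<bar>support_fun (interp y) u - support_fun (interp x) u\<bar> \<le> e * norm u"
    proof
      fix u
      have b: "compact (interp y)" "interp y \<noteq> {}" "compact (interp x)" "interp x \<noteq> {}"
        using interp_body[OF x] interp_body[OF y] by (auto simp: convex_body_def)
      show "\<bar>support_fun (interp y) u - support_fun (interp x) u\<bar> \<le> e * norm u"
      proof (cases "u = 0")
        case True
        then show ?thesis using support_fun_scaleR[OF b(1,2), of 0 0] support_fun_scaleR[OF b(3,4), of 0 0] by simp
      next
        case False
        define v where "v = u /\<^sub>R norm u"
        have v: "norm v = 1" "u = norm u *\<^sub>R v" using False by (auto simp: v_def)
        have "norm u * \<bar>support_fun (interp y) v - support_fun (interp x) v\<bar> \<le> norm u * e"
          using unit[OF v(1)] by (intro mult_left_mono) auto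
        moreover have "support_fun (interp y) u = norm u * support_fun (interp y) v"
          "support_fun (interp x) u = norm u * support_fun (interp x) v"
          using support_fun_scaleR[OF b(1,2), of "norm u" v] support_fun_scaleR[OF b(3,4), of "norm u" v] v(2) by simp_all
        ultimately show ?thesis by (simp add: mult.commute abs_mult flip: right_diff_distrib)
      qed
    qed
  qed
qed

text \<open>A body of positive volume contains a ball, so nearby bodies contain a slightly
  contracted copy of it. At a degenerate body the bound is infinite.\<close>

lemma upper_semicontinuous_neg_log_vol_interp:
  assumes x: "x \<in> \<Omega>"
  shows "Limsup (at x within \<Omega>) (\<lambda>y. neg_log_vol (interp y)) \<le> neg_log_vol (interp x)"
proof (cases "measure lborel (interp x) = 0")
  case False
  note K = interp_body[OF x]
  define V where "V = measure lborel (interp x)"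
  have V: "0 < V" using False measure_nonneg[of lborel "interp x"] unfolding V_def by linarith
  have "interior (interp x) \<noteq> {}" using convex_body_measure_zero_iff[OF K] False by simp
  then obtain c \<rho> where c: "0 < \<rho>" "cball c \<rho> \<subseteq> interp x" by (auto simp: mem_interior_cball)
  show ?thesis
    unfolding Limsup_le_iff
  proof (intro allI impI)
    fix s assume s: "neg_log_vol (interp x) < s"
    \<comment> \<open>A contraction by \<open>1 - t\<close> multiplies the volume by the
      \<open>DIM('b)\<close>-th power of \<open>1 - t\<close>, which tends to 1 with
      \<open>t\<close> tending to 0; some small \<open>t\<close> thus keeps the bound below
      \<open>s\<close>.\<close>
    have "((\<lambda>t. ereal (- ln ((1 - t) ^ DIM('b) * V))) \<longlongrightarrow> ereal (- ln ((1 - 0) ^ DIM('b) * V))) (at_right 0)"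
      using V by (intro tendsto_intros lim_ereal[THEN iffD2]) auto
    then have "\<forall>\<^sub>F t in at_right 0. ereal (- ln ((1 - t) ^ DIM('b) * V)) < s"
      using s False by (intro order_tendstoD) (auto simp: neg_log_vol_def V_def)
    moreover have "\<forall>\<^sub>F t in at_right (0::real). 0 < t \<and> t < 1"
      using eventually_at_right_less eventually_at_right_real[of 0 1] by (auto elim: eventually_mono)
    ultimately have "\<forall>\<^sub>F t in at_right 0. ereal (- ln ((1 - t) ^ DIM('b) * V)) < s \<and> 0 < t \<and> t < 1"
      by (rule eventually_conj)
    then obtain t :: real where t: "ereal (- ln ((1 - t) ^ DIM('b) * V)) < s" "0 < t" "t < 1"
      using eventually_happens'[of "at_right (0::real)"] by auto
    have "0 < t * \<rho>" using t c by simp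
    from eventually_interp_support_fun_close[OF x this]
    have "\<forall>\<^sub>F y in at x within \<Omega>. \<forall>u. \<bar>support_fun (interp y) u - support_fun (interp x) u\<bar> \<le> t * \<rho> * norm u" .
    moreover have "\<forall>\<^sub>F y in at x within \<Omega>. y \<in> \<Omega>" by (simp add: eventually_at_filter)
    ultimately show "\<forall>\<^sub>F y in at x within \<Omega>. neg_log_vol (interp y) < s"
    proof eventually_elim
      fix y assume near: "\<forall>u. \<bar>support_fun (interp y) u - support_fun (interp x) u\<bar> \<le> t * \<rho> * norm u" and y: "y \<in> \<Omega>"
      have "(1 - t) ^ DIM('b) * V \<le> measure lborel (interp y)"
        unfolding V_def
      proof (rule measure_ge_of_support_fun_ge[OF K interp_body[OF y] c(2,1) t(2,3)])
        show "support_fun (interp x) u - t * \<rho> * norm u \<le> support_fun (interp y) u" for u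
          using spec[OF near, of u] by linarith
      qed
      moreover have pos: "0 < (1 - t) ^ DIM('b) * V" using t V by simp
      ultimately have "ln ((1 - t) ^ DIM('b) * V) \<le> ln (measure lborel (interp y))" "0 < measure lborel (interp y)"
        by (auto simp: ln_mono)
      then have "neg_log_vol (interp y) \<le> ereal (- ln ((1 - t) ^ DIM('b) * V))" by (simp add: neg_log_vol_def)
      then show "neg_log_vol (interp y) < s" using t(1) by (rule le_less_trans)
    qed
  qed
qed (simp add: neg_log_vol_def)

theorem subharmonic_neg_log_vol_interp: "subharmonic_on \<Omega> (\<lambda>x. neg_log_vol (interp x))"
  unfolding subharmonic_on_def
proof (intro conjI ballI allI impI)
  fix C assume C: "C \<in> components \<Omega>"
  show "(\<forall>x\<in>C. neg_log_vol (interp x) < \<infinity>) \<or> (\<forall>x\<in>C. neg_log_vol (interp x) = \<infinity>)"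
  proof (cases "\<exists>x\<in>C. measure lborel (interp x) = 0")
    case True
    then obtain x where x: "x \<in> C" "measure lborel (interp x) = 0" by blast
    show ?thesis using interp_degenerate_component[OF C x] by (simp add: neg_log_vol_def)
  qed (simp add: neg_log_vol_def)
next
  fix x assume "x \<in> \<Omega>"
  then show "Limsup (at x within \<Omega>) (\<lambda>y. neg_log_vol (interp y)) \<le> neg_log_vol (interp x)"
    by (rule upper_semicontinuous_neg_log_vol_interp)
next
  fix a r h x
  assume *: "0 < r \<and> cball a r \<subseteq> \<Omega> \<and> continuous_on (cball a r) h \<and> harmonic_on (ball a r) h \<and>
      (\<forall>x\<in>sphere a r. neg_log_vol (interp x) \<le> ereal (h x))"
    and x: "x \<in> cball a r"
  from * show "neg_log_vol (interp x) \<le> ereal (h x)"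
    by (intro neg_log_vol_interp_le[OF _ _ _ _ _ x]) simp_all
qed

end

theorem theorem1p2:
  fixes \<Omega> :: "(real ^ 'n) set"
    and A :: "real ^ 'n \<Rightarrow> (real ^ 'm) set"
    and \<mu> :: "real ^ 'n \<Rightarrow> (real ^ 'n) measure"
  assumes "open \<Omega>" and "bounded \<Omega>" and "smooth_boundary \<Omega>"
    and "\<And>\<tau>. \<tau> \<in> frontier \<Omega> \<Longrightarrow> A \<tau> \<noteq> {} \<and> compact (A \<tau>) \<and> convex (A \<tau>)"
    and "hausdorff_continuous_on (frontier \<Omega>) A"
    and "harmonic_measure \<Omega> \<mu>"
  shows "subharmonic_on \<Omega> (\<lambda>x. neg_log_vol (minkowski_integral (\<mu> x) A))"
proof -
  interpret harmonic_interpolation \<Omega> A \<mu>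
  proof
    show "compact (frontier \<Omega>)" using assms(2) by (rule compact_frontier_bounded)
  qed (use assms in \<open>auto simp: convex_body_def\<close>)
  show ?thesis by (rule subharmonic_neg_log_vol_interp)
qed

end
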